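(* Let $n\ge 1$. For every commutative ring $R$ one has an isomorphism $$\bar B_1(A_n(R))\cong \Omega^{ev}(R^n)/\Omega^{ev}_{ex}(R^n).$$ In particular, for $R=\mathbb{Z}$ one has $$\bar B_1(A_n(\mathbb{Z}))\cong H^{ev,+}(\Omega(\mathbb{Z}^n))\oplus \Omega^{ev}(\mathbb{Z}^n)/\Omega^{ev,+}_{cl}(\mathbb{Z}^n),$$ where $H^{ev,+}(\Omega(\mathbb{Z}^n)):=H^2(\Omega(\mathbb{Z}^n))\oplus H^4(\Omega(\mathbb{Z}^n))\oplus\cdots$ is the even De Rham cohomology in positive ranks.
   Context: $A_n(R)$ is the free associative unital $R$-algebra on $x_1,\dots,x_n$. For an $R$-algebra $A$, $[a,b]=ab-ba$, $L_1(A)=A$, $L_{k+1}(A)=[A,L_k(A)]$ (the $R$-span of commutators), $M_k(A)=A\,L_k(A)$ (a two-sided ideal), and $\bar B_1(A)=A/(L_2(A)+M_3(A))$. $\Omega(R^n)=\bigoplus_{i=0}^n\Omega^i(R^n)$ is the algebra of polynomial differential forms in $x_1,\dots,x_n$ with coefficients in $R$: $\Omega^i(R^n)$ is the free $R[x_1,\dots,x_n]$-module on $dx_{j_1}\wedge\cdots\wedge dx_{j_i}$, $j_1<\dots<j_i$, with De Rham differential $d:\Omega^i\to\Omega^{i+1}$; $i$ is called the rank. $\Omega^{ev}=\bigoplus_{i\text{ even}}\Omega^i$; $\Omega^{ev}_{ex}$ denotes the exact forms in $\Omega^{ev}$ (the image of $d$ there); $\Omega^{ev,+}_{cl}$ denotes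 the closed forms ($d\omega=0$) in $\bigoplus_{i\ge 2\text{ even}}\Omega^i$. $H^i(\Omega(\mathbb{Z}^n))$ is the $i$-th cohomology group of the complex $(\Omega(\mathbb{Z}^n),d)$. *)

theory Defs
  imports "HOL-Algebra.Algebra"
begin

section \<open>Modules: spans, quotients, isomorphisms\<close>

definition module_span :: "('a, 'm) ring_scheme \<Rightarrow> ('a, 'b, 'k) module_scheme \<Rightarrow> 'b set \<Rightarrow> 'b set"
  where "module_span R M S = (\<lambda>N. submodule N R M) hull S"

text \<open>The ring-theoretic fields come from the library's quotient \<open>M Quot N\<close>; its multiplication
  is meaningful only if \<open>N\<close> is an ideal and plays no role for the quotient as a module.\<close>

definition quotient_module :: "('a, 'b, 'k) module_scheme \<Rightarrow> 'b set \<Rightarrow> ('a, 'b set) module"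
  where "quotient_module M N =
    ring.extend (M Quot N) (module.fields (\<lambda>r C. \<Union>x\<in>C. N +>\<^bsub>M\<^esub> (r \<odot>\<^bsub>M\<^esub> x)))"

definition module_iso ::
  "('a, 'm) ring_scheme \<Rightarrow> ('a, 'b, 'k) module_scheme \<Rightarrow> ('a, 'c, 'l) module_scheme \<Rightarrow> ('b \<Rightarrow> 'c) set"
  where "module_iso R M N = {h \<in> iso (add_monoid M) (add_monoid N).
    \<forall>r\<in>carrier R. \<forall>x\<in>carrier M. h (r \<odot>\<^bsub>M\<^esub> x) = r \<odot>\<^bsub>N\<^esub> h x}"

definition module_isomorphic ::
  "('a, 'm) ring_scheme \<Rightarrow> ('a, 'b, 'k) module_scheme \<Rightarrow> ('a, 'c, 'l) module_scheme \<Rightarrow> bool"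
  where "module_isomorphic R M N \<longleftrightarrow> module_iso R M N \<noteq> {}"


section \<open>The lower central series of an associative algebra\<close>

text \<open>In this section \<open>A\<close> is an associative unital \<open>R\<close>-algebra, in general noncommutative.
  (The library's locale \<open>algebra\<close> demands commutativity; its record type is reused without it.)\<close>

definition commutator :: "('b, 'k) ring_scheme \<Rightarrow> 'b \<Rightarrow> 'b \<Rightarrow> 'b"
  where "commutator A a b = a \<otimes>\<^bsub>A\<^esub> b \<ominus>\<^bsub>A\<^esub> b \<otimes>\<^bsub>A\<^esub> a"

text \<open>The series starts at index 1; the value at index 0 is junk.\<close>

fun lower_central :: "('a, 'm) ring_scheme \<Rightarrow> ('a, 'b, 'k) module_scheme \<Rightarrow> nat \<Rightarrow> 'b set"
  where
    "lower_central R A 0 = carrier A"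
  | "lower_central R A (Suc 0) = carrier A"
  | "lower_central R A (Suc (Suc k)) = module_span R A
       {commutator A a l | a l. a \<in> carrier A \<and> l \<in> lower_central R A (Suc k)}"

definition lower_central_ideal ::
  "('a, 'm) ring_scheme \<Rightarrow> ('a, 'b, 'k) module_scheme \<Rightarrow> nat \<Rightarrow> 'b set"
  where "lower_central_ideal R A k = module_span R A
    {a \<otimes>\<^bsub>A\<^esub> l | a l. a \<in> carrier A \<and> l \<in> lower_central R A k}"

definition B1_bar :: "('a, 'm) ring_scheme \<Rightarrow> ('a, 'b, 'k) module_scheme \<Rightarrow> ('a, 'b set) module"
  where "B1_bar R A =
    quotient_module A (lower_central R A 2 <+>\<^bsub>A\<^esub> lower_central_ideal R A 3)"


section \<open>The free associative algebra\<close>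

text \<open>Noncommutative polynomials in \<open>x\<^sub>1, \<dots>, x\<^sub>n\<close>: finitely supported coefficient functions on
  words over \<open>{1..n}\<close>, multiplied by convolution with respect to concatenation.\<close>

definition free_algebra :: "('a, 'm) ring_scheme \<Rightarrow> nat \<Rightarrow> ('a, nat list \<Rightarrow> 'a) module"
  where "free_algebra R n =
    \<lparr>carrier = {f. (\<forall>w. f w \<in> carrier R) \<and> finite {w. f w \<noteq> \<zero>\<^bsub>R\<^esub>} \<and>
                   (\<forall>w. f w \<noteq> \<zero>\<^bsub>R\<^esub> \<longrightarrow> set w \<subseteq> {1..n})},
     monoid.mult = (\<lambda>f g w. \<Oplus>\<^bsub>R\<^esub>k\<in>{..length w}. f (take k w) \<otimes>\<^bsub>R\<^esub> g (drop k w)),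
     one = (\<lambda>w. if w = [] then \<one>\<^bsub>R\<^esub> else \<zero>\<^bsub>R\<^esub>),
     ring.zero = (\<lambda>w. \<zero>\<^bsub>R\<^esub>),
     add = (\<lambda>f g w. f w \<oplus>\<^bsub>R\<^esub> g w),
     smult = (\<lambda>r f w. r \<otimes>\<^bsub>R\<^esub> f w)\<rparr>"


section \<open>Polynomial differential forms\<close>

text \<open>Polynomials are those of \<open>HOL-Algebra.Indexed_Polynomials\<close>: coefficient functions on
  monomials, a monomial being a multiset of variable indices. A form
  \<open>\<Sum>\<^sub>J \<omega>\<^sub>J dx\<^sub>J\<close> is the function \<open>J \<mapsto> \<omega>\<^sub>J\<close>, where \<open>dx\<^sub>J\<close> is the wedge product of the \<open>dx\<^sub>j\<close>,
  \<open>j \<in> J\<close>, in increasing order.\<close>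

definition poly_mult ::
  "('a, 'm) ring_scheme \<Rightarrow> (nat multiset \<Rightarrow> 'a) \<Rightarrow> (nat multiset \<Rightarrow> 'a) \<Rightarrow> nat multiset \<Rightarrow> 'a"
  where "poly_mult R p q m = (\<Oplus>\<^bsub>R\<^esub>k\<in>{k. k \<subseteq># m}. p k \<otimes>\<^bsub>R\<^esub> q (m - k))"

definition partial_deriv ::
  "('a, 'm) ring_scheme \<Rightarrow> nat \<Rightarrow> (nat multiset \<Rightarrow> 'a) \<Rightarrow> nat multiset \<Rightarrow> 'a"
  where "partial_deriv R i p m = [Suc (count m i)] \<cdot>\<^bsub>R\<^esub> p (add_mset i m)"

text \<open>For disjoint \<open>I\<close> and \<open>K\<close>, \<open>dx\<^sub>I \<and> dx\<^sub>K = wedge_sign I K \<cdot> dx\<^bsub>I \<union> K\<^esub>\<close>.\<close>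

definition wedge_sign :: "nat set \<Rightarrow> nat set \<Rightarrow> int"
  where "wedge_sign I K = (- 1) ^ card {(i, k). i \<in> I \<and> k \<in> K \<and> k < i}"

definition forms :: "('a, 'm) ring_scheme \<Rightarrow> nat \<Rightarrow> ('a, nat set \<Rightarrow> nat multiset \<Rightarrow> 'a) module"
  where "forms R n =
    \<lparr>carrier = {\<omega>. \<forall>J. if J \<subseteq> {1..n} then \<omega> J \<in> ring.indexed_pset R {1..n} (carrier R)
                      else \<omega> J = (\<lambda>m. \<zero>\<^bsub>R\<^esub>)},
     monoid.mult = (\<lambda>\<omega> \<eta> J m. \<Oplus>\<^bsub>R\<^esub>I\<in>Pow J. [wedge_sign I (J - I)] \<cdot>\<^bsub>R\<^esub> poly_mult R (\<omega> I) (\<eta> (J - I)) m),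
     one = (\<lambda>J m. if J = {} \<and> m = {#} then \<one>\<^bsub>R\<^esub> else \<zero>\<^bsub>R\<^esub>),
     ring.zero = (\<lambda>J m. \<zero>\<^bsub>R\<^esub>),
     add = (\<lambda>\<omega> \<eta> J m. \<omega> J m \<oplus>\<^bsub>R\<^esub> \<eta> J m),
     smult = (\<lambda>r \<omega> J m. r \<otimes>\<^bsub>R\<^esub> \<omega> J m)\<rparr>"

text \<open>\<open>forms_of_rank R n S\<close> is the direct sum of the modules of forms of rank \<open>i\<close>, \<open>i \<in> S\<close>,
  inside the module of all forms.\<close>

definition forms_of_rank ::
  "('a, 'm) ring_scheme \<Rightarrow> nat \<Rightarrow> nat set \<Rightarrow> ('a, nat set \<Rightarrow> nat multiset \<Rightarrow> 'a) module"
  where "forms_of_rank R n S = (forms R n)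
    \<lparr>carrier := {\<omega> \<in> carrier (forms R n). \<forall>J. card J \<notin> S \<longrightarrow> \<omega> J = (\<lambda>m. \<zero>\<^bsub>R\<^esub>)}\<rparr>"

text \<open>From \<open>d(f dx\<^sub>I) = \<Sum>\<^sub>i \<partial>\<^sub>i f dx\<^sub>i \<and> dx\<^sub>I\<close>, collecting the coefficient of \<open>dx\<^sub>J\<close>,
  \<open>J = I \<union> {i}\<close>. No restriction to \<open>J \<subseteq> {1..n}\<close> is needed, since the coefficients of a form
  do not involve variables with index outside \<open>{1..n}\<close>.\<close>

definition de_rham_d ::
  "('a, 'm) ring_scheme \<Rightarrow> (nat set \<Rightarrow> nat multiset \<Rightarrow> 'a) \<Rightarrow> nat set \<Rightarrow> nat multiset \<Rightarrow> 'a"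
  where "de_rham_d R \<omega> J m =
    (\<Oplus>\<^bsub>R\<^esub>i\<in>J. [wedge_sign {i} (J - {i})] \<cdot>\<^bsub>R\<^esub> partial_deriv R i (\<omega> (J - {i})) m)"

definition closed_forms ::
  "('a, 'm) ring_scheme \<Rightarrow> nat \<Rightarrow> nat set \<Rightarrow> (nat set \<Rightarrow> nat multiset \<Rightarrow> 'a) set"
  where "closed_forms R n S =
    {\<omega> \<in> carrier (forms_of_rank R n S). de_rham_d R \<omega> = \<zero>\<^bsub>forms R n\<^esub>}"

definition exact_forms ::
  "('a, 'm) ring_scheme \<Rightarrow> nat \<Rightarrow> nat set \<Rightarrow> (nat set \<Rightarrow> nat multiset \<Rightarrow> 'a) set"
  where "exact_forms R n S = de_rham_d R ` carrier (forms_of_rank R n {j. Suc j \<in> S})"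

definition de_rham_cohomology ::
  "('a, 'm) ring_scheme \<Rightarrow> nat \<Rightarrow> nat \<Rightarrow> ('a, (nat set \<Rightarrow> nat multiset \<Rightarrow> 'a) set) module"
  where "de_rham_cohomology R n i =
    quotient_module ((forms R n)\<lparr>carrier := closed_forms R n {i}\<rparr>) (exact_forms R n {i})"

abbreviation even_ranks :: "nat set"
  where "even_ranks \<equiv> {i. even i}"

abbreviation pos_even_ranks :: "nat set"
  where "pos_even_ranks \<equiv> {i. even i \<and> i \<ge> 2}"

definition even_cohomology_pos ::
  "('a, 'm) ring_scheme \<Rightarrow> nat \<Rightarrow> (nat \<Rightarrow> (nat set \<Rightarrow> nat multiset \<Rightarrow> 'a) set) monoid"
  where "even_cohomology_pos R n =
    sum_group pos_even_ranks (\<lambda>i. add_monoid (de_rham_cohomology R n i))"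

end

theory Submission
  imports Defs
begin

text \<open>Write \<open>A\<close> for the free algebra and \<open>M\<^sub>3\<close> for \<open>A [A, [A, A]]\<close>. Modulo \<open>M\<^sub>3\<close> the commutators
\<open>[x\<^sub>i, x\<^sub>j]\<close> are central, and their products are alternating in the letters, exactly like products
of the two-forms \<open>dx\<^sub>i \<and> dx\<^sub>j\<close>; this holds integrally (lemmas \<open>bracket_exchange\<close> and
\<open>bracket_chain\<close>). So \<open>A / M\<^sub>3\<close> is spanned by normal-ordered monomials: an increasing product of
commutators \<open>[x\<^sub>a, x\<^sub>b] [x\<^sub>c, x\<^sub>d] \<dots>\<close> times an increasing word, and these are indexed like the basis
\<open>x\<^sup>m dx\<^sub>J\<close>, \<open>card J\<close> even, of the even forms.

In this basis left multiplication by \<open>x\<^sub>j\<close> is the operator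
\<open>X\<^sub>j = x\<^sub>j + dx\<^sub>j \<and> (\<Sum>i<j. dx\<^sub>i \<and> \<partial>\<^sub>i)\<close> on forms. It satisfies \<open>[X\<^sub>i, X\<^sub>j] = dx\<^sub>i \<and> dx\<^sub>j\<close> and
\<open>[d, X\<^sub>j] = dx\<^sub>j\<close>. By induction on words, any two words \<open>V\<close>, \<open>W\<close> in the \<open>X\<^sub>j\<close> then satisfy
\<open>[V, W] = [d, V] [d, W]\<close> (lemma \<open>act_word_bracket\<close>), and \<open>d\<^sup>2 = 0\<close> turns this one identity into
everything that is needed in one direction: applied to the form 1 it reads
\<open>[V, W] 1 = d (V (d (W 1)))\<close>, so commutators go to exact forms, and \<open>[d, V] [d, W]\<close> commutes with all
words, so \<open>M\<^sub>3\<close> goes to zero. In the other direction normal ordering sends \<open>d (dx\<^sub>k \<and> \<omega>)\<close>, modulo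
\<open>M\<^sub>3\<close>, to minus the commutator of \<open>x\<^sub>k\<close> with the normal-ordered \<open>\<omega>\<close>, hence exact forms to \<open>[A, A] + M\<^sub>3\<close>. The two maps are inverse to each other
up to \<open>[A, A] + M\<^sub>3\<close>, which gives the isomorphism. The symmetric product
\<open>a b + 1/2 da \<and> db\<close> would do the same where 2 is invertible; the normal-ordered one has integral
coefficients. Therefore all these computations take place over the integers, in type-class rings
and groups, and a base change map carries them to an arbitrary commutative ring, where only
linearity remains to be used.

Over the integers the extension of the even forms modulo closed forms by the even cohomology has
to be split. Both \<open>x\<^sub>i\<close> and \<open>dx\<^sub>i\<close> have multidegree \<open>e\<^sub>i\<close>, and \<open>d\<close> preserves multidegree. In
multidegree \<open>a\<close> the differential is the product with the covector \<open>a\<close>; contracting with integers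
\<open>c\<^sub>i\<close> such that \<open>\<Sum>i. c\<^sub>i a\<^sub>i = gcd a\<close> gives an operator \<open>h\<close> with \<open>d h + h d = gcd a\<close> (lemma
\<open>homotopy_formula\<close>). All values of \<open>d\<close> are divisible by \<open>gcd a\<close>, so \<open>(d h) / gcd a\<close> is defined over the
integers; it is a projection onto the closed forms of positive rank, and it splits the extension.\<close>

section \<open>Rings in which commutators are central\<close>

definition bracket :: "'a::ring_1 \<Rightarrow> 'a \<Rightarrow> 'a"
  where "bracket a b = a * b - b * a"

lemma bracket_self [simp]: "bracket a a = 0"
  by (simp add: bracket_def)

lemma bracket_swap: "bracket a b = - bracket b a"
  by (simp add: bracket_def)

lemma bracket_mult_right: "bracket a (b * c) = bracket a b * c + b * bracket a c"
  by (simp add: bracket_def algebra_simps)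

text \<open>The condition says that all commutators are central; the instance below is the free ring modulo
\<open>M\<^sub>3\<close>.\<close>

class two_step_ring = ring_1 +
  assumes two_step: "(b * c - c * b) * a = a * (b * c - c * b)"

lemma bracket_central: "bracket b c * a = a * bracket b c" for a :: "'a::two_step_ring"
  using two_step by (simp add: bracket_def)

lemma bracket_central_left: "a * (bracket b c * x) = bracket b c * (a * x)"
  for a :: "'a::two_step_ring"
  by (metis bracket_central mult.assoc)

text \<open>Expand the fact that \<open>[a, b c]\<close> commutes with \<open>d\<close> by the Leibniz rule.\<close>

lemma bracket_exchange: "bracket a b * bracket c d = - (bracket a c * bracket b d)"
  for a :: "'a::two_step_ring"
proof -
  have "bracket a (b * c) * d = d * bracket a (b * c)"
    by (rule bracket_central)
  then have "bracket a b * (c * d) + b * (bracket a c * d)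
      = d * (bracket a b * c) + d * (b * bracket a c)"
    by (simp add: bracket_mult_right algebra_simps)
  then have "bracket a b * (c * d) + b * d * bracket a c
      = bracket a b * (d * c) + d * b * bracket a c"
    by (simp only: bracket_central_left[of d] bracket_central[of a c d] mult.assoc)
  then have "bracket a b * bracket c d + bracket b d * bracket a c = 0"
    unfolding bracket_def[of c d] bracket_def[of b d] by (simp add: algebra_simps)
  then show ?thesis
    by (simp add: bracket_central[of b d] eq_neg_iff_add_eq_0)
qed

text \<open>Antisymmetry from the exchange rule only gives twice this product. The sharper statement comes from
\<open>[a b, b] = [a, b] b\<close>, which is central; it is what makes the construction work in characteristic 2.\<close>

lemma bracket_chain: "bracket a b * bracket b d = 0" for a :: "'a::two_step_ring"
proof -
  have eq: "bracket (a * b) b = bracket a b * b"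
    by (simp add: bracket_def algebra_simps)
  have "bracket a b * b * d = d * (bracket a b * b)"
    using bracket_central[of "a * b" b d] by (simp add: eq)
  then have "bracket a b * (b * d) = bracket a b * (d * b)"
    by (simp add: bracket_central_left mult.assoc)
  then show ?thesis
    unfolding bracket_def[of b d] by (simp add: algebra_simps)
qed

text \<open>The counterpart of \<open>dx\<^sub>i \<and> dx\<^sub>j \<and> \<dots>\<close> for the word \<open>i j \<dots>\<close>. The value 0 on words of odd length lets
the rules below hold for all words.\<close>

fun pair_brackets :: "(nat \<Rightarrow> 'a::ring_1) \<Rightarrow> nat list \<Rightarrow> 'a" where
  "pair_brackets \<xi> [] = 1"
| "pair_brackets \<xi> [i] = 0"
| "pair_brackets \<xi> (i # j # l) = bracket (\<xi> i) (\<xi> j) * pair_brackets \<xi> l"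

text \<open>Inside a pair this is antisymmetry of the bracket; across two pairs it is the exchange rule.\<close>

lemma pair_brackets_swap:
  "pair_brackets \<xi> (xs @ i # j # ys) = - pair_brackets \<xi> (xs @ j # i # ys)"
  for \<xi> :: "nat \<Rightarrow> 'a::two_step_ring"
proof (induction \<xi> xs rule: pair_brackets.induct)
  case (1 \<xi>)
  show ?case by (simp add: bracket_swap[of "\<xi> i"])
next
  case (2 \<xi> k)
  show ?case
  proof (cases ys)
    case (Cons c l)
    then show ?thesis
      by (simp flip: mult.assoc)
         (simp add: bracket_exchange[of "\<xi> k" "\<xi> i" "\<xi> j" "\<xi> c"])
  qed simp
qed simp

lemma pair_brackets_repeat: "pair_brackets \<xi> (xs @ i # i # ys) = 0"
  for \<xi> :: "nat \<Rightarrow> 'a::two_step_ring"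
proof (induction \<xi> xs rule: pair_brackets.induct)
  case (2 \<xi> k)
  show ?case
    by (cases ys) (simp_all add: bracket_chain flip: mult.assoc)
qed simp_all

text \<open>Bubbling \<open>i\<close> into an increasing word yields the sign of the wedge product.\<close>

lemma pair_brackets_insort:
  fixes \<xi> :: "nat \<Rightarrow> 'a::two_step_ring"
  assumes "sorted_wrt (<) l"
  shows "pair_brackets \<xi> (xs @ i # l) =
    (if i \<in> set l then 0
     else (-1) ^ card {k \<in> set l. k < i} * pair_brackets \<xi> (xs @ insort i l))"
  using assms
proof (induction l arbitrary: xs)
  case Nil
  then show ?case by simp
next
  case (Cons a l)
  consider "i < a" | "i = a" | "a < i" by linarith
  then show ?case
  proof cases
    case 1
    then have "{k \<in> set (a # l). k < i} = {}" "i \<notin> set (a # l)"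
      using Cons.prems by force+
    with 1 show ?thesis
      by (metis card.empty insort_key.simps(2) less_imp_le mult_1 power_0)
  next
    case 2
    then show ?thesis by (simp add: pair_brackets_repeat)
  next
    case 3
    have "a \<notin> set l" using Cons.prems by auto
    moreover have "{k \<in> set (a # l). k < i} = insert a {k \<in> set l. k < i}"
      using 3 by auto
    ultimately have "card {k \<in> set (a # l). k < i} = Suc (card {k \<in> set l. k < i})"
      by simp
    moreover have "pair_brackets \<xi> (xs @ i # a # l) = - pair_brackets \<xi> ((xs @ [a]) @ i # l)"
      by (simp add: pair_brackets_swap[of \<xi> xs i])
    ultimately show ?thesis
      using 3 Cons.IH[of "xs @ [a]"] Cons.prems by (auto simp: not_le)
  qed
qed

definition sorted_monom :: "(nat \<Rightarrow> 'a::ring_1) \<Rightarrow> nat multiset \<Rightarrow> 'a"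
  where "sorted_monom \<xi> m = prod_list (map \<xi> (sorted_list_of_multiset m))"

lemma sorted_monom_empty [simp]: "sorted_monom \<xi> {#} = 1"
  by (simp add: sorted_monom_def)

lemma sorted_monom_add_min:
  assumes "\<And>i. i \<in># m \<Longrightarrow> a \<le> i"
  shows "sorted_monom \<xi> (add_mset a m) = \<xi> a * sorted_monom \<xi> m"
proof -
  have "insort a (sorted_list_of_multiset m) = a # sorted_list_of_multiset m"
    using assms by (intro insort_is_Cons) auto
  then show ?thesis by (simp add: sorted_monom_def)
qed

lemma of_nat_left_commute: "a * (of_nat n * x) = of_nat n * (a * x)" for a :: "'a::ring_1"
  by (metis mult.assoc mult_of_nat_commute)

lemma sum_count_add_mset:
  fixes f :: "'i \<Rightarrow> 'a::ring_1"
  assumes "finite S"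
  shows "(\<Sum>i\<in>S. of_nat (count (add_mset a m) i) * f i)
    = (if a \<in> S then f a else 0) + (\<Sum>i\<in>S. of_nat (count m i) * f i)"
proof -
  have "of_nat (count (add_mset a m) i) * f i
      = (if i = a then f a else 0) + of_nat (count m i) * f i" for i
    by (simp add: algebra_simps)
  then show ?thesis
    using assms by (simp only: sum.distrib) simp
qed

text \<open>The induction step shared by the two formulas below: a least letter may be pulled out of each
summand, at the cost of one new summand.\<close>

lemma sum_bracket_monom_add_min:
  fixes \<xi> :: "nat \<Rightarrow> 'a::two_step_ring"
  assumes "finite S" and min: "\<And>i. i \<in># m \<Longrightarrow> a \<le> i"
  shows "(\<Sum>i\<in>S. of_nat (count (add_mset a m) i) *
            (bracket (\<xi> j) (\<xi> i) * sorted_monom \<xi> (add_mset a m - {#i#})))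
    = (if a \<in> S then bracket (\<xi> j) (\<xi> a) * sorted_monom \<xi> m else 0)
      + \<xi> a * (\<Sum>i\<in>S. of_nat (count m i) * (bracket (\<xi> j) (\<xi> i) * sorted_monom \<xi> (m - {#i#})))"
proof -
  have "of_nat (count m i) * (bracket (\<xi> j) (\<xi> i) * sorted_monom \<xi> (add_mset a m - {#i#}))
      = \<xi> a * (of_nat (count m i) * (bracket (\<xi> j) (\<xi> i) * sorted_monom \<xi> (m - {#i#})))" for i
  proof (cases "i \<in># m")
    case True
    then have "add_mset a m - {#i#} = add_mset a (m - {#i#})"
      by simp
    moreover have "sorted_monom \<xi> (add_mset a (m - {#i#})) = \<xi> a * sorted_monom \<xi> (m - {#i#})"
      by (rule sorted_monom_add_min) (use min in \<open>auto dest: in_diffD\<close>)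
    ultimately show ?thesis
      by (simp only: bracket_central_left[of "\<xi> a"] of_nat_left_commute[of "\<xi> a"])
  qed (simp add: not_in_iff)
  then show ?thesis
    by (simp only: sum_count_add_mset[OF assms(1)] sum_distrib_left) simp
qed

text \<open>Moving \<open>x\<^sub>j\<close> to its place past a smaller letter \<open>x\<^sub>i\<close> costs the central element \<open>[x\<^sub>j, x\<^sub>i]\<close>. This is
the formula that the operators \<open>X\<^sub>j\<close> on forms imitate.\<close>

lemma mult_sorted_monom:
  fixes \<xi> :: "nat \<Rightarrow> 'a::two_step_ring"
  shows "\<xi> j * sorted_monom \<xi> m = sorted_monom \<xi> (add_mset j m)
    + (\<Sum>i<j. of_nat (count m i) * (bracket (\<xi> j) (\<xi> i) * sorted_monom \<xi> (m - {#i#})))"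
proof (induction m rule: multiset_induct_min)
  case empty
  show ?case by (simp add: sorted_monom_def)
next
  case (add a m)
  then have min: "\<And>i. i \<in># m \<Longrightarrow> a \<le> i" by auto
  show ?case
  proof (cases "j \<le> a")
    case True
    then have "count (add_mset a m) i = 0" if "i < j" for i
      using that min[of i] by (auto simp: count_eq_zero_iff)
    moreover have "sorted_monom \<xi> (add_mset j (add_mset a m)) = \<xi> j * sorted_monom \<xi> (add_mset a m)"
      by (rule sorted_monom_add_min) (use True min in force)
    ultimately show ?thesis by simp
  next
    case False
    have "\<xi> j * sorted_monom \<xi> (add_mset a m) = \<xi> j * \<xi> a * sorted_monom \<xi> m"
      using min by (simp add: sorted_monom_add_min mult.assoc)
    also have "\<dots> = bracket (\<xi> j) (\<xi> a) * sorted_monom \<xi> m + \<xi> a * (\<xi> j * sorted_monom \<xi> m)"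
      by (simp add: bracket_def algebra_simps)
    also have "\<xi> a * (\<xi> j * sorted_monom \<xi> m) = \<xi> a * sorted_monom \<xi> (add_mset j m)
        + \<xi> a * (\<Sum>i<j. of_nat (count m i) * (bracket (\<xi> j) (\<xi> i) * sorted_monom \<xi> (m - {#i#})))"
      by (simp add: add.IH distrib_left)
    also have "\<xi> a * sorted_monom \<xi> (add_mset j m) = sorted_monom \<xi> (add_mset j (add_mset a m))"
    proof -
      have *: "a \<le> i" if "i \<in># add_mset j m" for i
        using that False min by auto
      show ?thesis
        by (simp only: sorted_monom_add_min[OF *] add_mset_commute[of j])
    qed
    finally show ?thesis
      using False
      by (simp only: sum_bracket_monom_add_min[OF finite_lessThan min]) simp
  qed
qed

lemma bracket_sorted_monom:
  fixes \<xi> :: "nat \<Rightarrow> 'a::two_step_ring"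
  assumes "finite S" and "set_mset m \<subseteq> S"
  shows "bracket (\<xi> j) (sorted_monom \<xi> m)
    = (\<Sum>i\<in>S. of_nat (count m i) * (bracket (\<xi> j) (\<xi> i) * sorted_monom \<xi> (m - {#i#})))"
  using assms(2)
proof (induction m rule: multiset_induct_min)
  case empty
  show ?case by (simp add: bracket_def)
next
  case (add a m)
  then have min: "\<And>i. i \<in># m \<Longrightarrow> a \<le> i" by auto
  show ?case
    using add.prems add.IH
    by (simp only: sum_bracket_monom_add_min[OF assms(1) min] sorted_monom_add_min[OF min])
       (simp add: bracket_mult_right)
qed

section \<open>Integral forms and normal-ordered multiplication\<close>

text \<open>An integral form in countably many variables, as a finitely supported function of the index
\<open>(J, m)\<close> of the basis form \<open>x\<^sup>m dx\<^sub>J\<close>. Leaving the number of variables open at this stage avoids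
side conditions; base change discards the superfluous variables.\<close>

type_synonym int_form = "(nat set \<times> nat multiset) \<Rightarrow>\<^sub>0 int"

lemma wedge_sign_singleton: "wedge_sign {i} J = (-1) ^ card {k \<in> J. k < i}"
proof -
  have "{(a, k). a \<in> {i} \<and> k \<in> J \<and> k < a} = Pair i ` {k \<in> J. k < i}"
    by auto
  then show ?thesis
    by (simp add: wedge_sign_def card_image inj_on_def)
qed

lemma wedge_sign_square [simp]: "wedge_sign {i} J * wedge_sign {i} J = 1"
  by (simp add: wedge_sign_singleton flip: power_add mult_2)

lemma wedge_sign_insert:
  "k \<notin> J \<Longrightarrow> wedge_sign {i} (insert k J) = (if k < i then - wedge_sign {i} J else wedge_sign {i} J)"
proof -
  assume "k \<notin> J"
  have fin: "finite {l \<in> J. l < i}"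
    by (rule finite_subset[of _ "{..<i}"]) auto
  have "{l \<in> insert k J. l < i} = (if k < i then insert k {l \<in> J. l < i} else {l \<in> J. l < i})"
    by auto
  with fin \<open>k \<notin> J\<close> show ?thesis
    by (simp add: wedge_sign_singleton)
qed

lemma wedge_sign_swap:
  assumes "i \<notin> J" "j \<notin> J" "i \<noteq> j"
  shows "wedge_sign {i} J * wedge_sign {j} (insert i J)
    = - (wedge_sign {j} J * wedge_sign {i} (insert j J))"
  using assms by (auto simp: wedge_sign_insert)

definition mul_var :: "nat \<Rightarrow> int_form \<Rightarrow> int_form"
  where "mul_var j = frag_extend (\<lambda>(J, m). frag_of (J, add_mset j m))"

definition pderiv_var :: "nat \<Rightarrow> int_form \<Rightarrow> int_form"
  where "pderiv_var j = frag_extend (\<lambda>(J, m). frag_cmul (int (count m j)) (frag_of (J, m - {#j#})))"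

definition wedge_var :: "nat \<Rightarrow> int_form \<Rightarrow> int_form"
  where "wedge_var j = frag_extend
    (\<lambda>(J, m). if j \<in> J then 0 else frag_cmul (wedge_sign {j} J) (frag_of (insert j J, m)))"

text \<open>The de Rham differential in the variables from \<open>S\<close> only.\<close>

definition d_on :: "nat set \<Rightarrow> int_form \<Rightarrow> int_form"
  where "d_on S z = (\<Sum>i\<in>S. wedge_var i (pderiv_var i z))"

text \<open>The operator \<open>X\<^sub>j\<close>: multiplication by \<open>x\<^sub>j\<close> from the left, followed by normal ordering.\<close>

definition act_var :: "nat \<Rightarrow> int_form \<Rightarrow> int_form"
  where "act_var j z = mul_var j z + wedge_var j (d_on {..<j} z)"

definition act_word :: "nat list \<Rightarrow> int_form \<Rightarrow> int_form"
  where "act_word = foldr act_var"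

lemma mul_var_of [simp]: "mul_var j (frag_of (J, m)) = frag_of (J, add_mset j m)"
  and pderiv_var_of [simp]:
    "pderiv_var j (frag_of (J, m)) = frag_cmul (int (count m j)) (frag_of (J, m - {#j#}))"
  and wedge_var_of [simp]: "wedge_var j (frag_of (J, m)) =
    (if j \<in> J then 0 else frag_cmul (wedge_sign {j} J) (frag_of (insert j J, m)))"
  by (simp_all add: mul_var_def pderiv_var_def wedge_var_def)

lemma mul_var_linear [simp]:
  "mul_var j 0 = 0" "mul_var j (y + z) = mul_var j y + mul_var j z"
  "mul_var j (y - z) = mul_var j y - mul_var j z" "mul_var j (- z) = - mul_var j z"
  "mul_var j (frag_cmul c z) = frag_cmul c (mul_var j z)"
  by (simp_all add: mul_var_def frag_extend_add frag_extend_diff frag_extend_minus frag_extend_cmul)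

lemma pderiv_var_linear [simp]:
  "pderiv_var j 0 = 0" "pderiv_var j (y + z) = pderiv_var j y + pderiv_var j z"
  "pderiv_var j (y - z) = pderiv_var j y - pderiv_var j z" "pderiv_var j (- z) = - pderiv_var j z"
  "pderiv_var j (frag_cmul c z) = frag_cmul c (pderiv_var j z)"
  by (simp_all add: pderiv_var_def frag_extend_add frag_extend_diff frag_extend_minus frag_extend_cmul)

lemma wedge_var_linear [simp]:
  "wedge_var j 0 = 0" "wedge_var j (y + z) = wedge_var j y + wedge_var j z"
  "wedge_var j (y - z) = wedge_var j y - wedge_var j z" "wedge_var j (- z) = - wedge_var j z"
  "wedge_var j (frag_cmul c z) = frag_cmul c (wedge_var j z)"
  by (simp_all add: wedge_var_def frag_extend_add frag_extend_diff frag_extend_minus frag_extend_cmul)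

lemma mul_var_sum: "mul_var j (sum f A) = (\<Sum>i\<in>A. mul_var j (f i))"
  by (induction A rule: infinite_finite_induct) simp_all

lemma pderiv_var_sum: "pderiv_var j (sum f A) = (\<Sum>i\<in>A. pderiv_var j (f i))"
  by (induction A rule: infinite_finite_induct) simp_all

lemma wedge_var_sum: "wedge_var j (sum f A) = (\<Sum>i\<in>A. wedge_var j (f i))"
  by (induction A rule: infinite_finite_induct) simp_all

lemma frag_induct [case_names zero of diff]:
  assumes "P 0" "\<And>x. P (frag_of x)" "\<And>a b. P a \<Longrightarrow> P b \<Longrightarrow> P (a - b)"
  shows "P z"
  using subset_UNIV by (rule frag_induction) (use assms in auto)

lemma mul_var_commute: "mul_var i (mul_var j z) = mul_var j (mul_var i z)"
  by (induction z rule: frag_induct) (auto simp: add_mset_commute)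

lemma pderiv_var_commute: "pderiv_var i (pderiv_var j z) = pderiv_var j (pderiv_var i z)"
proof (induction z rule: frag_induct)
  case (of x)
  then show ?case
    by (cases x; cases "i = j") (auto simp: add_mset_commute mult.commute)
qed auto

lemma pderiv_mul_var:
  "pderiv_var i (mul_var j z) = mul_var j (pderiv_var i z) + (if i = j then z else 0)"
proof (induction z rule: frag_induct)
  case (of x)
  obtain J m where x: "x = (J, m)" by fastforce
  show ?case
  proof (cases "i \<in># m")
    case True
    then show ?thesis
      by (auto simp: x frag_cmul_distrib)
  next
    case False
    then have "count m i = 0" by (simp add: not_in_iff)
    then show ?thesis by (auto simp: x)
  qed
qed auto

lemma mul_wedge_var: "mul_var i (wedge_var j z) = wedge_var j (mul_var i z)"
  by (induction z rule: frag_induct) auto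

lemma pderiv_wedge_var: "pderiv_var i (wedge_var j z) = wedge_var j (pderiv_var i z)"
  by (induction z rule: frag_induct) (auto simp: mult.commute)

lemma wedge_var_self [simp]: "wedge_var i (wedge_var i z) = 0"
  by (induction z rule: frag_induct) auto

lemma wedge_var_anticommute: "wedge_var i (wedge_var j z) = - wedge_var j (wedge_var i z)"
proof (induction z rule: frag_induct)
  case (of x)
  obtain J m where x: "x = (J, m)" by fastforce
  show ?case
    by (cases "i = j") (use wedge_sign_swap[of j J i] in \<open>auto simp: x insert_commute\<close>)
qed auto

lemma d_on_linear [simp]:
  "d_on S 0 = 0" "d_on S (y + z) = d_on S y + d_on S z"
  "d_on S (y - z) = d_on S y - d_on S z" "d_on S (- z) = - d_on S z"
  "d_on S (frag_cmul c z) = frag_cmul c (d_on S z)"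
  by (simp_all add: d_on_def sum.distrib sum_subtractf sum_negf frag_cmul_sum)

lemma d_on_wedge_var: "d_on S (wedge_var j z) = - wedge_var j (d_on S z)"
  by (simp add: d_on_def pderiv_wedge_var wedge_var_anticommute[of _ j] wedge_var_sum sum_negf)

lemma d_on_mul_var:
  "finite S \<Longrightarrow> d_on S (mul_var j z) = mul_var j (d_on S z) + (if j \<in> S then wedge_var j z else 0)"
proof -
  assume "finite S"
  have "wedge_var i (pderiv_var i (mul_var j z))
      = mul_var j (wedge_var i (pderiv_var i z)) + (if i = j then wedge_var j z else 0)" for i
    by (auto simp: pderiv_mul_var mul_wedge_var)
  with \<open>finite S\<close> show ?thesis
    by (simp add: d_on_def sum.distrib mul_var_sum)
qed

lemma d_on_anticommute: "d_on S (d_on T z) = - d_on T (d_on S z)"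
proof -
  have "d_on S (d_on T z) = (\<Sum>i\<in>S. \<Sum>k\<in>T. wedge_var i (wedge_var k (pderiv_var i (pderiv_var k z))))"
    by (simp add: d_on_def wedge_var_sum pderiv_var_sum pderiv_wedge_var)
  also have "\<dots> = (\<Sum>i\<in>S. \<Sum>k\<in>T. - wedge_var k (wedge_var i (pderiv_var k (pderiv_var i z))))"
    by (intro sum.cong refl) (metis wedge_var_anticommute pderiv_var_commute)
  also have "\<dots> = - d_on T (d_on S z)"
    by (subst sum.swap)
       (simp add: d_on_def wedge_var_sum pderiv_var_sum pderiv_wedge_var sum_negf)
  finally show ?thesis .
qed

lemma d_on_d_on [simp]: "d_on S (d_on S z) = 0"
proof (rule poly_mapping_eqI)
  fix k
  have "Poly_Mapping.lookup (d_on S (d_on S z)) k = - Poly_Mapping.lookup (d_on S (d_on S z)) k"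
    by (subst d_on_anticommute) simp
  then show "Poly_Mapping.lookup (d_on S (d_on S z)) k = Poly_Mapping.lookup 0 k"
    by simp
qed

lemma act_var_linear [simp]:
  "act_var j 0 = 0" "act_var j (y + z) = act_var j y + act_var j z"
  "act_var j (y - z) = act_var j y - act_var j z" "act_var j (- z) = - act_var j z"
  "act_var j (frag_cmul c z) = frag_cmul c (act_var j z)"
  by (simp_all add: act_var_def frag_cmul_distrib2)

lemma act_word_linear [simp]:
  "act_word w 0 = 0" "act_word w (y + z) = act_word w y + act_word w z"
  "act_word w (y - z) = act_word w y - act_word w z" "act_word w (- z) = - act_word w z"
  "act_word w (frag_cmul c z) = frag_cmul c (act_word w z)"
  by (induction w) (simp_all add: act_word_def)

lemma act_word_simps [simp]:
  "act_word [] z = z" "act_word (j # w) z = act_var j (act_word w z)"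
  "act_word (v @ w) z = act_word v (act_word w z)"
  by (simp_all add: act_word_def)

lemma act_var_wedge_var: "act_var j (wedge_var i z) = wedge_var i (act_var j z)"
proof -
  have "wedge_var j (wedge_var i y) = - wedge_var i (wedge_var j y)" for y
    by (rule wedge_var_anticommute)
  then show ?thesis
    by (simp add: act_var_def mul_wedge_var d_on_wedge_var)
qed

text \<open>The correction term of \<open>X\<^sub>j\<close> commutes with \<open>d\<close>, because \<open>d\<close> anticommutes with both of its factors.\<close>

lemma d_on_act_var:
  assumes "finite S" "j \<in> S"
  shows "d_on S (act_var j z) = act_var j (d_on S z) + wedge_var j z"
proof -
  have "d_on S (d_on {..<j} z) = - d_on {..<j} (d_on S z)"
    by (rule d_on_anticommute)
  with assms show ?thesis
    by (simp add: act_var_def d_on_mul_var d_on_wedge_var)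
qed

text \<open>Only the products of a plain multiplication with a correction term contribute: of the two
corrections exactly the one belonging to the larger index differentiates the other variable.\<close>

lemma act_var_bracket:
  "act_var i (act_var j z) - act_var j (act_var i z) = wedge_var i (wedge_var j z)"
proof -
  \<comment> \<open>Instances of anticommutation, oriented so that rewriting terminates.\<close>
  have anti: "wedge_var j (wedge_var i y) = - wedge_var i (wedge_var j y)" for y
    by (rule wedge_var_anticommute)
  have anti_d: "d_on {..<j} (d_on {..<i} z) = - d_on {..<i} (d_on {..<j} z)"
    by (rule d_on_anticommute)
  consider "i < j" | "i = j" | "j < i" by linarith
  then show ?thesis
    by cases
      (simp_all add: act_var_def d_on_mul_var d_on_wedge_var mul_wedge_var anti anti_d
        mul_var_commute[of j i])
qed

text \<open>The commutator \<open>[d, W]\<close> of the differential with the operator of the word \<open>w\<close>.\<close>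

definition word_deriv :: "nat set \<Rightarrow> nat list \<Rightarrow> int_form \<Rightarrow> int_form"
  where "word_deriv S w z = d_on S (act_word w z) - act_word w (d_on S z)"

lemma act_word_wedge_var: "act_word w (wedge_var i z) = wedge_var i (act_word w z)"
  by (induction w) (simp_all add: act_var_wedge_var)

lemma word_deriv_Cons:
  assumes "finite S" "j \<in> S"
  shows "word_deriv S (j # w) z = act_var j (word_deriv S w z) + wedge_var j (act_word w z)"
  using assms by (simp add: word_deriv_def d_on_act_var)

lemma d_on_word_deriv: "d_on S (word_deriv S w z) = - word_deriv S w (d_on S z)"
  by (simp add: word_deriv_def)

lemma act_var_word_bracket:
  assumes "finite S" "set w \<subseteq> S"
  shows "act_var i (act_word w z) - act_word w (act_var i z) = wedge_var i (word_deriv S w z)"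
  using assms(2)
proof (induction w)
  case Nil
  then show ?case by (simp add: word_deriv_def)
next
  case (Cons j w)
  have "act_var i (act_var j (act_word w z)) - act_var j (act_word w (act_var i z))
    = (act_var i (act_var j (act_word w z)) - act_var j (act_var i (act_word w z)))
      + act_var j (act_var i (act_word w z) - act_word w (act_var i z))"
    by simp
  also have "\<dots> = wedge_var i (wedge_var j (act_word w z)) + act_var j (wedge_var i (word_deriv S w z))"
    using Cons by (simp only: act_var_bracket) simp
  finally show ?case
    using Cons.prems assms(1) by (simp add: word_deriv_Cons act_var_wedge_var)
qed

text \<open>Apply \<open>[d, _]\<close> to \<open>[X\<^sub>i, W] = dx\<^sub>i [d, W]\<close>. On the right \<open>[d, W]\<close> anticommutes with \<open>d\<close>, so the result
vanishes; on the left the term \<open>[dx\<^sub>i, W]\<close> vanishes as well.\<close>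

lemma act_var_word_deriv:
  assumes "finite S" "set w \<subseteq> S" "i \<in> S"
  shows "act_var i (word_deriv S w z) = word_deriv S w (act_var i z)"
proof -
  have w: "act_word w (act_var i y) = act_var i (act_word w y) - wedge_var i (word_deriv S w y)" for y
    using act_var_word_bracket[OF assms(1,2), of i y] by (simp add: algebra_simps)
  show ?thesis
    unfolding word_deriv_def[of S w "act_var i z"]
    using assms
    by (simp add: d_on_act_var w d_on_wedge_var d_on_word_deriv act_word_wedge_var)
       (simp add: word_deriv_def)
qed

lemma act_word_word_deriv:
  assumes "finite S" "set v \<subseteq> S" "set w \<subseteq> S"
  shows "act_word v (word_deriv S w z) = word_deriv S w (act_word v z)"
  using assms(2) by (induction v) (simp_all add: act_var_word_deriv assms)

text \<open>The central identity \<open>[V, W] = [d, V] [d, W]\<close>. The induction extends it letter by letter in \<open>V\<close>;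
the case of a single letter is the lemma \<open>act_var_word_bracket\<close>.\<close>

lemma act_word_bracket:
  assumes "finite S" "set v \<subseteq> S" "set w \<subseteq> S"
  shows "act_word v (act_word w z) - act_word w (act_word v z) = word_deriv S v (word_deriv S w z)"
  using assms(2)
proof (induction v arbitrary: z)
  case Nil
  then show ?case by (simp add: word_deriv_def)
next
  case (Cons i u)
  have "act_word (i # u) (act_word w z) - act_word w (act_word (i # u) z)
    = act_var i (act_word u (act_word w z) - act_word w (act_word u z))
      + (act_var i (act_word w (act_word u z)) - act_word w (act_var i (act_word u z)))"
    by simp
  also have "\<dots> = act_var i (word_deriv S u (word_deriv S w z)) + wedge_var i (word_deriv S w (act_word u z))"
    using Cons assms by (simp only: act_var_word_bracket) simp
  also have "word_deriv S w (act_word u z) = act_word u (word_deriv S w z)"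
    using Cons.prems assms by (simp add: act_word_word_deriv)
  finally show ?case
    using Cons.prems assms(1) by (simp add: word_deriv_Cons)
qed

text \<open>Words commute with \<open>[d, V]\<close> and \<open>[d, W]\<close>, hence with their product \<open>[V, W]\<close>.\<close>

lemma act_word_double_bracket:
  fixes v w t :: "nat list"
  defines "br \<equiv> \<lambda>z. act_word v (act_word w z) - act_word w (act_word v z)"
  shows "act_word t (br z) = br (act_word t z)"
proof -
  define S where "S = set v \<union> set w \<union> set t"
  have S: "finite S" "set v \<subseteq> S" "set w \<subseteq> S" "set t \<subseteq> S"
    by (auto simp: S_def)
  then show ?thesis
    unfolding br_def act_word_bracket[OF S(1-3)] by (simp add: act_word_word_deriv)
qed

abbreviation one_form :: int_form
  where "one_form \<equiv> frag_of ({}, {#})"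

lemma d_on_one_form [simp]: "d_on S one_form = 0"
  by (simp add: d_on_def)

text \<open>Since \<open>d 1 = 0\<close>, the form \<open>[d, W] 1\<close> is \<open>d (W 1)\<close>, and \<open>[d, V]\<close> applied to it is \<open>d (V (d (W 1)))\<close>.\<close>

lemma act_word_bracket_exact:
  assumes "finite S" "set v \<subseteq> S" "set w \<subseteq> S"
  shows "act_word v (act_word w one_form) - act_word w (act_word v one_form)
    = d_on S (act_word v (d_on S (act_word w one_form)))"
  unfolding act_word_bracket[OF assms] by (simp add: word_deriv_def)

section \<open>The free ring and its normal-ordered basis\<close>

text \<open>Words carry their own type so that concatenation can be the addition of a monoid: finitely
supported integral functions on it are then the free ring, with its ring structure from the library.\<close>

datatype word = Word (letters: "nat list")

instantiation word :: monoid_add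
begin

definition zero_word :: word
  where "zero_word = Word []"

definition plus_word :: "word \<Rightarrow> word \<Rightarrow> word"
  where "plus_word u v = Word (letters u @ letters v)"

instance
  by standard (simp_all add: zero_word_def plus_word_def)

end

lemma letters_plus [simp]: "letters (u + v) = letters u @ letters v"
  by (simp add: plus_word_def)

lemma letters_zero [simp]: "letters 0 = []"
  by (simp add: zero_word_def)

type_synonym int_free = "word \<Rightarrow>\<^sub>0 int"

definition act :: "int_free \<Rightarrow> int_form \<Rightarrow> int_form"
  where "act a z = frag_extend (\<lambda>w. act_word (letters w) z) a"

lemma act_of [simp]: "act (frag_of w) z = act_word (letters w) z"
  by (simp add: act_def)

lemma act_linear [simp]:
  "act 0 z = 0" "act (a + b) z = act a z + act b z" "act (a - b) z = act a z - act b z"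
  by (simp_all add: act_def frag_extend_add frag_extend_diff)

lemma act_linear_right [simp]: "act a 0 = 0" "act a (y - z) = act a y - act a z"
  by (induction a rule: frag_induct) simp_all

lemma act_one [simp]: "act 1 z = z"
  by (simp flip: single_one)

lemma act_mult [simp]: "act (a * b) z = act a (act b z)"
proof (induction a rule: frag_induct)
  case (of v)
  show ?case
    by (induction b rule: frag_induct)
       (simp_all add: right_diff_distrib mult_single)
qed (simp_all add: left_diff_distrib)

inductive_set third_ideal :: "'a::ring_1 set" where
  zero: "0 \<in> third_ideal"
| generator: "a * bracket b (bracket c d) \<in> third_ideal"
| diff: "x \<in> third_ideal \<Longrightarrow> y \<in> third_ideal \<Longrightarrow> x - y \<in> third_ideal"

lemma third_ideal_uminus: "x \<in> third_ideal \<Longrightarrow> - x \<in> third_ideal"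
  using third_ideal.diff[OF third_ideal.zero] by fastforce

lemma third_ideal_add: "x \<in> third_ideal \<Longrightarrow> y \<in> third_ideal \<Longrightarrow> x + y \<in> third_ideal"
  using third_ideal.diff[OF _ third_ideal_uminus, of x y] by simp

lemma third_ideal_mult_left: "x \<in> third_ideal \<Longrightarrow> a * x \<in> third_ideal"
proof (induction rule: third_ideal.induct)
  case (generator b c d e)
  then show ?case
    using third_ideal.generator[of "a * b"] by (simp add: mult.assoc)
qed (simp_all add: third_ideal.zero third_ideal.diff right_diff_distrib)

text \<open>The generators are visibly closed under left multiplication only; moving a factor from the right to
the left costs another commutator.\<close>

lemma third_ideal_mult_right: "x \<in> third_ideal \<Longrightarrow> x * e \<in> third_ideal"
proof (induction rule: third_ideal.induct)
  case (generator a b c d)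
  have "a * bracket b (bracket c d) * e
      = (a * e) * bracket b (bracket c d) - a * bracket e (bracket b (bracket c d))"
    by (simp add: bracket_def[of e] algebra_simps)
  then show ?case
    by (simp only: third_ideal.intros)
qed (simp_all add: third_ideal.zero third_ideal.diff left_diff_distrib)

lemma act_bracket: "act (bracket a b) z = act a (act b z) - act b (act a z)"
  by (simp add: bracket_def)

lemma bracket_linear [simp]:
  "bracket 0 a = 0" "bracket a 0 = 0"
  "bracket (a - b) c = bracket a c - bracket b c" "bracket a (b - c) = bracket a b - bracket a c"
  by (simp_all add: bracket_def algebra_simps)

lemma act_double_bracket: "act (bracket a (bracket b c)) z = 0"
proof -
  have "act a (act (bracket b c) z) = act (bracket b c) (act a z)"
  proof (induction a rule: frag_induct)
    case (of t)
    show ?case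
    proof (induction b rule: frag_induct)
      case (of v)
      show ?case
      proof (induction c rule: frag_induct)
        case (of w)
        show ?case
          using act_word_double_bracket[of "letters t" "letters v" "letters w"]
          by (simp add: act_bracket)
      qed simp_all
    qed simp_all
  qed simp_all
  then show ?thesis
    by (simp add: act_bracket[of a])
qed

text \<open>It follows that 1 is not in the ideal, so that the quotient below is not the zero ring.\<close>

lemma act_third_ideal: "a \<in> third_ideal \<Longrightarrow> act a z = 0"
  by (induction rule: third_ideal.induct) (simp_all add: act_double_bracket)

quotient_type lie_quotient = "word \<Rightarrow>\<^sub>0 int" / "\<lambda>x y. x - y \<in> third_ideal"
proof (rule equivpI)
  show "reflp (\<lambda>x y :: int_free. x - y \<in> third_ideal)"
    by (simp add: reflp_def third_ideal.zero)
  show "symp (\<lambda>x y :: int_free. x - y \<in> third_ideal)"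
    by (rule sympI) (metis minus_diff_eq third_ideal_uminus)
  show "transp (\<lambda>x y :: int_free. x - y \<in> third_ideal)"
    by (rule transpI) (use third_ideal_add in fastforce)
qed

instantiation lie_quotient :: two_step_ring
begin

lift_definition zero_lie_quotient :: lie_quotient is 0 .
lift_definition one_lie_quotient :: lie_quotient is 1 .
lift_definition plus_lie_quotient :: "lie_quotient \<Rightarrow> lie_quotient \<Rightarrow> lie_quotient" is "(+)"
  by (metis add_diff_add third_ideal_add)
lift_definition minus_lie_quotient :: "lie_quotient \<Rightarrow> lie_quotient \<Rightarrow> lie_quotient" is "(-)"
proof -
  fix a b c d :: int_free
  assume "a - b \<in> third_ideal" "c - d \<in> third_ideal"
  moreover have "(a - c) - (b - d) = (a - b) - (c - d)"
    by (simp add: algebra_simps)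
  ultimately show "(a - c) - (b - d) \<in> third_ideal"
    by (simp only: third_ideal.diff)
qed
lift_definition uminus_lie_quotient :: "lie_quotient \<Rightarrow> lie_quotient" is "uminus"
  by (metis minus_diff_eq minus_diff_minus third_ideal_uminus)
lift_definition times_lie_quotient :: "lie_quotient \<Rightarrow> lie_quotient \<Rightarrow> lie_quotient" is "(*)"
proof -
  fix a b c d :: int_free
  assume "a - b \<in> third_ideal" "c - d \<in> third_ideal"
  moreover have "a * c - b * d = (a - b) * c + b * (c - d)"
    by (simp add: algebra_simps)
  ultimately show "a * c - b * d \<in> third_ideal"
    by (simp only: third_ideal_add third_ideal_mult_left third_ideal_mult_right)
qed

instance
proof (standard; (transfer; simp add: algebra_simps third_ideal.zero; fail)?)
  show "(0::lie_quotient) \<noteq> 1"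
  proof transfer
    show "0 - 1 \<notin> (third_ideal :: int_free set)"
    proof
      assume "0 - 1 \<in> (third_ideal :: int_free set)"
      then have "act (0 - 1) one_form = 0"
        by (rule act_third_ideal)
      then have "0 - one_form = 0"
        by (simp only: act_linear act_one)
      then show False
        by (metis diff_0 frag_of_nonzero neg_equal_0_iff_equal)
    qed
  qed
  show "(b * c - c * b) * a = a * (b * c - c * b)" for a b c :: lie_quotient
  proof (transfer)
    fix b c a :: int_free
    have "(b * c - c * b) * a - a * (b * c - c * b) = - (1 * bracket a (bracket b c))"
      by (simp add: bracket_def algebra_simps)
    then show "(b * c - c * b) * a - a * (b * c - c * b) \<in> third_ideal"
      by (simp only: third_ideal.generator third_ideal_uminus)
  qed
qed

end

definition letter :: "nat \<Rightarrow> int_free"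
  where "letter i = frag_of (Word [i])"

text \<open>On odd forms the value is 0, by the convention for \<open>pair_brackets\<close>.\<close>

definition normal_order :: "int_form \<Rightarrow> int_free"
  where "normal_order = frag_extend (\<lambda>(J, m). if finite J
    then pair_brackets letter (sorted_list_of_set J) * sorted_monom letter m else 0)"

lemma normal_order_linear [simp]:
  "normal_order 0 = 0" "normal_order (y + z) = normal_order y + normal_order z"
  "normal_order (y - z) = normal_order y - normal_order z" "normal_order (- z) = - normal_order z"
  "normal_order (frag_cmul c z) = frag_cmul c (normal_order z)"
  by (simp_all add: normal_order_def frag_extend_add frag_extend_diff frag_extend_minus frag_extend_cmul)

lemma act_pair_brackets:
  assumes "sorted_wrt (<) l" "even (length l)"
  shows "act (pair_brackets letter l) (frag_of ({}, m)) = frag_of (set l, m)"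
  using assms
proof (induction l rule: induct_list012)
  case (3 i j l)
  have less: "j \<notin> set l" "i \<notin> insert j (set l)" "{k \<in> set l. k < j} = {}" "{k \<in> insert j (set l). k < i} = {}"
    using 3 by force+
  have "wedge_sign {j} (set l) = 1" "wedge_sign {i} (insert j (set l)) = 1"
    unfolding wedge_sign_singleton less by simp_all
  with less(1,2) 3 show ?case
    by (simp add: letter_def act_bracket act_var_bracket)
qed simp_all

lemma act_sorted_monom: "act (sorted_monom letter m) one_form = frag_of ({}, m)"
proof (induction m rule: multiset_induct_min)
  case (add a m)
  then have min: "\<And>i. i \<in># m \<Longrightarrow> a \<le> i" by auto
  then have "count m i = 0" if "i < a" for i
    using that by (metis count_eq_zero_iff not_less)
  then have "d_on {..<a} (frag_of ({}, m)) = 0"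
    by (simp add: d_on_def)
  with add show ?case
    by (simp add: sorted_monom_add_min[OF min] letter_def act_var_def)
qed simp

text \<open>The product of commutators acts as multiplication by \<open>dx\<^sub>J\<close>, and no correction term arises when an
increasing word is applied to 1.\<close>

lemma act_normal_order:
  assumes "finite J" "even (card J)"
  shows "act (normal_order (frag_of (J, m))) one_form = frag_of (J, m)"
  using assms act_pair_brackets[of "sorted_list_of_set J" m]
  by (simp add: normal_order_def act_sorted_monom)

abbreviation to_quotient :: "int_free \<Rightarrow> lie_quotient"
  where "to_quotient \<equiv> abs_lie_quotient"

lemma to_quotient_hom [simp]:
  "to_quotient 0 = 0" "to_quotient 1 = 1" "to_quotient (a + b) = to_quotient a + to_quotient b"
  "to_quotient (a - b) = to_quotient a - to_quotient b" "to_quotient (- a) = - to_quotient a"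
  "to_quotient (a * b) = to_quotient a * to_quotient b"
  by (simp_all add: zero_lie_quotient.abs_eq one_lie_quotient.abs_eq plus_lie_quotient.abs_eq
      minus_lie_quotient.abs_eq uminus_lie_quotient.abs_eq times_lie_quotient.abs_eq)

lemma to_quotient_eq_iff: "to_quotient a = to_quotient b \<longleftrightarrow> a - b \<in> third_ideal"
  by (rule lie_quotient.abs_eq_iff)

lemma to_quotient_bracket [simp]: "to_quotient (bracket a b) = bracket (to_quotient a) (to_quotient b)"
  by (simp add: bracket_def)

abbreviation qletter :: "nat \<Rightarrow> lie_quotient"
  where "qletter i \<equiv> to_quotient (letter i)"

lemma to_quotient_pair_brackets: "to_quotient (pair_brackets letter l) = pair_brackets qletter l"
  by (induction l rule: induct_list012) simp_all

lemma to_quotient_sorted_monom: "to_quotient (sorted_monom letter m) = sorted_monom qletter m"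
proof -
  have "to_quotient (prod_list (map letter l)) = prod_list (map qletter l)" for l
    by (induction l) simp_all
  then show ?thesis by (simp add: sorted_monom_def)
qed

lemma to_quotient_frag_cmul [simp]: "to_quotient (frag_cmul c a) = of_int c * to_quotient a"
proof (induction c rule: int_induct[where k = 0])
  case (step1 i)
  then show ?case by (simp add: frag_cmul_distrib algebra_simps)
next
  case (step2 i)
  then show ?case by (simp add: frag_cmul_diff_distrib algebra_simps)
qed simp

text \<open>Working in the quotient replaces congruences modulo \<open>M\<^sub>3\<close> by equations in a ring with central
commutators.\<close>

definition normal_class :: "int_form \<Rightarrow> lie_quotient"
  where "normal_class z = to_quotient (normal_order z)"

lemma normal_class_linear [simp]:
  "normal_class 0 = 0" "normal_class (y + z) = normal_class y + normal_class z"
  "normal_class (y - z) = normal_class y - normal_class z" "normal_class (- z) = - normal_class z"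
  "normal_class (frag_cmul c z) = of_int c * normal_class z"
  by (simp_all add: normal_class_def)

lemma normal_class_sum: "normal_class (sum f A) = (\<Sum>i\<in>A. normal_class (f i))"
  by (induction A rule: infinite_finite_induct) simp_all

lemma normal_class_of: "normal_class (frag_of (J, m)) =
    (if finite J then pair_brackets qletter (sorted_list_of_set J) * sorted_monom qletter m else 0)"
  by (simp add: normal_class_def normal_order_def to_quotient_pair_brackets to_quotient_sorted_monom)

lemma pair_brackets_insert:
  fixes \<xi> :: "nat \<Rightarrow> 'a::two_step_ring"
  assumes "finite J"
  shows "pair_brackets \<xi> (xs @ i # sorted_list_of_set J) =
    (if i \<in> J then 0
     else of_int (wedge_sign {i} J) * pair_brackets \<xi> (xs @ sorted_list_of_set (insert i J)))"
  using assms by (simp add: pair_brackets_insort wedge_sign_singleton sorted_list_of_set.fold_insort_key.insert)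

lemma normal_class_wedge2:
  "normal_class (wedge_var j (wedge_var i z)) = bracket (qletter j) (qletter i) * normal_class z"
proof (induction z rule: frag_induct)
  case (of x)
  obtain J m where x: "x = (J, m)" by fastforce
  show ?case
  proof (cases "finite J")
    case True
    have "bracket (qletter j) (qletter i) * pair_brackets qletter (sorted_list_of_set J)
        = pair_brackets qletter ([j] @ i # sorted_list_of_set J)"
      by simp
    also have "\<dots> = (if i \<in> J then 0
        else of_int (wedge_sign {i} J) * pair_brackets qletter ([] @ j # sorted_list_of_set (insert i J)))"
      unfolding pair_brackets_insert[OF True] by simp
    also have "\<dots> = (if i \<in> J \<or> j \<in> insert i J then 0
        else of_int (wedge_sign {i} J * wedge_sign {j} (insert i J))
          * pair_brackets qletter (sorted_list_of_set (insert j (insert i J))))"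
      using True by (subst pair_brackets_insert) (simp_all add: mult.assoc)
    finally have *: "bracket (qletter j) (qletter i) * pair_brackets qletter (sorted_list_of_set J) = \<dots>" .
    show ?thesis
      using True
      by (simp only: x normal_class_of if_True mult.assoc[symmetric] *)
         (auto simp: normal_class_of mult.assoc)
  qed (simp add: x normal_class_of)
qed (simp_all add: algebra_simps)

lemma pair_brackets_central: "a * pair_brackets \<xi> l = pair_brackets \<xi> l * a"
  for a :: "'a::two_step_ring"
proof (induction l rule: induct_list012)
  case (3 i j l)
  then show ?case
    by (simp add: bracket_central_left mult.assoc)
qed simp_all

lemma normal_class_pderiv: "normal_class (pderiv_var i (frag_of (J, m))) =
    (if finite J then pair_brackets qletter (sorted_list_of_set J)
       * (of_nat (count m i) * sorted_monom qletter (m - {#i#})) else 0)"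
  by (simp add: normal_class_of of_nat_left_commute)

text \<open>Normal ordering turns \<open>X\<^sub>j\<close> into multiplication by \<open>x\<^sub>j\<close>: the two correction terms, one from
the definition of \<open>X\<^sub>j\<close> and one from sorting the monomial, agree.\<close>

lemma normal_class_act_var: "normal_class (act_var j z) = qletter j * normal_class z"
proof (induction z rule: frag_induct)
  case (of x)
  obtain J m where x: "x = (J, m)" by fastforce
  show ?case
  proof (cases "finite J")
    case True
    let ?u = "pair_brackets qletter (sorted_list_of_set J)"
    have "bracket (qletter j) (qletter i) * (?u * (of_nat (count m i) * sorted_monom qletter (m - {#i#})))
      = ?u * (of_nat (count m i) * (bracket (qletter j) (qletter i) * sorted_monom qletter (m - {#i#})))" for i
      by (simp only: bracket_central_left[of ?u, symmetric] of_nat_left_commute)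
    then have "normal_class (act_var j (frag_of x)) = ?u * (sorted_monom qletter (add_mset j m)
        + (\<Sum>i<j. of_nat (count m i) * (bracket (qletter j) (qletter i) * sorted_monom qletter (m - {#i#}))))"
      using True
      by (simp add: x act_var_def d_on_def wedge_var_sum normal_class_sum normal_class_wedge2
          normal_class_pderiv distrib_left sum_distrib_left del: pderiv_var_of)
         (simp add: normal_class_of)
    also have "\<dots> = ?u * (qletter j * sorted_monom qletter m)"
      by (simp only: mult_sorted_monom[where \<xi> = qletter])
    finally show ?thesis
      using True by (simp add: x normal_class_of pair_brackets_central flip: mult.assoc)
  qed (simp add: x normal_class_of act_var_def d_on_def wedge_var_sum normal_class_sum
        normal_class_wedge2 normal_class_pderiv del: pderiv_var_of wedge_var_of)
qed (simp_all add: algebra_simps)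

lemma normal_order_act_word: "normal_order (act_word w one_form) - frag_of (Word w) \<in> third_ideal"
proof -
  have "normal_class (act_word w one_form) = to_quotient (frag_of (Word w))"
  proof (induction w)
    case Nil
    have "frag_of (Word []) = (1 :: int_free)"
      by (simp flip: single_one zero_word_def)
    then show ?case
      by (simp add: normal_class_of)
  next
    case (Cons j w)
    have "letter j * frag_of (Word w) = frag_of (Word (j # w))"
      by (simp add: letter_def mult_single plus_word_def)
    then show ?case
      using Cons by (simp add: normal_class_act_var flip: to_quotient_hom)
  qed
  then show ?thesis
    by (simp add: normal_class_def to_quotient_eq_iff)
qed

lemma normal_class_d_wedge:
  assumes "finite S" "set_mset m \<subseteq> S"
  shows "normal_class (d_on S (wedge_var k (frag_of (J, m)))) = - bracket (qletter k) (normal_class (frag_of (J, m)))"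
proof (cases "finite J")
  case True
  let ?u = "pair_brackets qletter (sorted_list_of_set J)"
  have "bracket (qletter k) (qletter i) * (?u * (of_nat (count m i) * sorted_monom qletter (m - {#i#})))
    = ?u * (of_nat (count m i) * (bracket (qletter k) (qletter i) * sorted_monom qletter (m - {#i#})))" for i
    by (simp only: bracket_central_left[of ?u, symmetric] of_nat_left_commute)
  then have "normal_class (wedge_var k (d_on S (frag_of (J, m)))) = ?u * bracket (qletter k) (sorted_monom qletter m)"
    using True
    by (simp add: d_on_def wedge_var_sum normal_class_sum normal_class_wedge2 normal_class_pderiv
        bracket_sorted_monom[OF assms, where \<xi> = qletter] sum_distrib_left del: pderiv_var_of)
  also have "\<dots> = bracket (qletter k) (?u * sorted_monom qletter m)"
    by (simp add: bracket_mult_right) (simp add: bracket_def pair_brackets_central)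
  finally show ?thesis
    using True by (simp add: d_on_wedge_var normal_class_of del: wedge_var_of)
qed (simp add: d_on_wedge_var normal_class_of del: wedge_var_of,
      simp add: d_on_def wedge_var_sum normal_class_sum
        normal_class_wedge2 normal_class_pderiv del: pderiv_var_of wedge_var_of)

text \<open>Any \<open>k \<in> J\<close> may be pulled to the front of \<open>dx\<^sub>J\<close>, which writes the basis form as \<open>dx\<^sub>k \<and> \<eta>\<close> up to sign.\<close>

lemma normal_order_exact:
  assumes "finite S" "set_mset m \<subseteq> S" "k \<in> J"
  obtains b c where "normal_order (d_on S (frag_of (J, m))) - bracket b c \<in> third_ideal"
proof -
  let ?K = "J - {k}"
  have "frag_of (J, m) = frag_cmul (wedge_sign {k} ?K) (wedge_var k (frag_of (?K, m)))"
    using \<open>k \<in> J\<close> by (simp add: insert_absorb)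
  then have "normal_class (d_on S (frag_of (J, m)))
      = of_int (wedge_sign {k} ?K) * - bracket (qletter k) (normal_class (frag_of (?K, m)))"
    by (simp add: normal_class_d_wedge[OF assms(1,2)] del: wedge_var_of)
  also have "\<dots> = to_quotient (bracket (letter k) (frag_cmul (- wedge_sign {k} ?K) (normal_order (frag_of (?K, m)))))"
    by (simp add: normal_class_def bracket_def algebra_simps) (metis mult.assoc mult_of_int_commute)
  finally show ?thesis
    by (intro that) (simp only: normal_class_def to_quotient_eq_iff)
qed

section \<open>Linear maps, spans and quotient modules\<close>

definition linear_map ::
  "('a, 'm) ring_scheme \<Rightarrow> ('a, 'b, 'k) module_scheme \<Rightarrow> ('a, 'c, 'l) module_scheme \<Rightarrow> ('b \<Rightarrow> 'c) \<Rightarrow> bool"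
  where "linear_map R M N h \<longleftrightarrow> h \<in> carrier M \<rightarrow> carrier N
    \<and> (\<forall>x\<in>carrier M. \<forall>y\<in>carrier M. h (x \<oplus>\<^bsub>M\<^esub> y) = h x \<oplus>\<^bsub>N\<^esub> h y)
    \<and> (\<forall>r\<in>carrier R. \<forall>x\<in>carrier M. h (r \<odot>\<^bsub>M\<^esub> x) = r \<odot>\<^bsub>N\<^esub> h x)"

lemma linear_mapD:
  assumes "linear_map R M N h"
  shows linear_map_closed: "x \<in> carrier M \<Longrightarrow> h x \<in> carrier N"
    and linear_map_add: "x \<in> carrier M \<Longrightarrow> y \<in> carrier M \<Longrightarrow> h (x \<oplus>\<^bsub>M\<^esub> y) = h x \<oplus>\<^bsub>N\<^esub> h y"
    and linear_map_smult: "r \<in> carrier R \<Longrightarrow> x \<in> carrier M \<Longrightarrow> h (r \<odot>\<^bsub>M\<^esub> x) = r \<odot>\<^bsub>N\<^esub> h x"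
  using assms by (auto simp: linear_map_def)

lemma linear_map_comp:
  "linear_map R L M h \<Longrightarrow> linear_map R M N k \<Longrightarrow> linear_map R L N (\<lambda>x. k (h x))"
  by (simp add: linear_map_def Pi_iff)

lemma linear_map_zero:
  assumes "module R M" "module R N" "linear_map R M N h"
  shows "h \<zero>\<^bsub>M\<^esub> = \<zero>\<^bsub>N\<^esub>"
proof -
  interpret M: module R M by fact
  interpret N: module R N by fact
  have "h \<zero>\<^bsub>M\<^esub> = h (\<zero>\<^bsub>R\<^esub> \<odot>\<^bsub>M\<^esub> \<zero>\<^bsub>M\<^esub>)"
    by simp
  also have "\<dots> = \<zero>\<^bsub>R\<^esub> \<odot>\<^bsub>N\<^esub> h \<zero>\<^bsub>M\<^esub>"
    by (rule linear_map_smult[OF assms(3)]) simp_all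
  finally show ?thesis
    using linear_map_closed[OF assms(3)] by simp
qed

lemma (in module) uminus_eq_smult: "x \<in> carrier M \<Longrightarrow> \<ominus>\<^bsub>M\<^esub> x = (\<ominus>\<^bsub>R\<^esub> \<one>\<^bsub>R\<^esub>) \<odot>\<^bsub>M\<^esub> x"
  by (simp add: smult_l_minus)

lemma linear_map_uminus:
  assumes "module R M" "module R N" "linear_map R M N h" "x \<in> carrier M"
  shows "h (\<ominus>\<^bsub>M\<^esub> x) = \<ominus>\<^bsub>N\<^esub> h x"
proof -
  interpret M: module R M by fact
  interpret N: module R N by fact
  show ?thesis
    using assms(4) linear_map_closed[OF assms(3,4)]
    by (simp add: M.uminus_eq_smult N.uminus_eq_smult linear_map_smult[OF assms(3)])
qed

lemma linear_map_minus:
  assumes "module R M" "module R N" "linear_map R M N h" "x \<in> carrier M" "y \<in> carrier M"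
  shows "h (x \<ominus>\<^bsub>M\<^esub> y) = h x \<ominus>\<^bsub>N\<^esub> h y"
proof -
  interpret M: module R M by fact
  show ?thesis
    using assms(4,5) by (simp add: a_minus_def linear_map_add[OF assms(3)] linear_map_uminus[OF assms(1-3)])
qed

lemma (in module) linear_map_minus_fun:
  assumes "linear_map R L M h" "linear_map R L M k"
  shows "linear_map R L M (\<lambda>x. h x \<ominus>\<^bsub>M\<^esub> k x)"
  using assms
  by (auto simp: linear_map_def Pi_iff smult_r_distr a_minus_def M.minus_add smult_r_minus M.add.m_ac)

lemma (in module) submodule_zero: "submodule {\<zero>\<^bsub>M\<^esub>} R M"
  by (rule submoduleI) auto

lemma submodule_vimage:
  assumes "module R M" "module R N" "linear_map R M N h" "submodule E R N"
  shows "submodule {x \<in> carrier M. h x \<in> E} R M"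
proof -
  interpret M: module R M by fact
  interpret N: module R N by fact
  note E = N.submoduleE[OF assms(4)]
  show ?thesis
  proof (rule M.submoduleI)
    have "\<zero>\<^bsub>N\<^esub> \<in> E"
      using submodule.axioms(1)[OF assms(4)] subgroup.one_closed by fastforce
    then show "\<zero>\<^bsub>M\<^esub> \<in> {x \<in> carrier M. h x \<in> E}"
      by (simp add: linear_map_zero[OF assms(1-3)])
  qed (use E in \<open>auto simp: linear_map_uminus[OF assms(1-3)] linear_mapD[OF assms(3)]\<close>)
qed

lemma submodule_image:
  assumes "module R M" "module R N" "linear_map R M N h"
  shows "submodule (h ` carrier M) R N"
proof -
  interpret M: module R M by fact
  interpret N: module R N by fact
  show ?thesis
  proof (rule N.submoduleI)
    show "\<zero>\<^bsub>N\<^esub> \<in> h ` carrier M"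
      using linear_map_zero[OF assms] by (metis M.M.zero_closed imageI)
    show "\<ominus>\<^bsub>N\<^esub> a \<in> h ` carrier M" if "a \<in> h ` carrier M" for a
      using that linear_map_uminus[OF assms] by (metis (no_types, lifting) M.M.a_inv_closed imageE imageI)
    show "a \<oplus>\<^bsub>N\<^esub> b \<in> h ` carrier M" if "a \<in> h ` carrier M" "b \<in> h ` carrier M" for a b
      using that linear_map_add[OF assms(3)] by (metis (no_types, lifting) M.M.a_closed imageE imageI)
    show "r \<odot>\<^bsub>N\<^esub> a \<in> h ` carrier M" if "r \<in> carrier R" "a \<in> h ` carrier M" for r a
      using that linear_map_smult[OF assms(3)] by (metis (no_types, lifting) M.smult_closed imageE imageI)
  qed (use linear_map_closed[OF assms(3)] in auto)
qed

lemma (in module) module_span_incl: "x \<in> S \<Longrightarrow> x \<in> module_span R M S"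
  by (simp add: module_span_def hull_inc)

lemma (in module) module_span_least:
  "S \<subseteq> N \<Longrightarrow> submodule N R M \<Longrightarrow> module_span R M S \<subseteq> N"
  unfolding module_span_def by (rule hull_minimal)

lemma (in module) submodule_Inter:
  assumes "T \<noteq> {}" "\<And>N. N \<in> T \<Longrightarrow> submodule N R M"
  shows "submodule (\<Inter>T) R M"
proof (rule submoduleI)
  show "\<zero>\<^bsub>M\<^esub> \<in> \<Inter>T"
    using assms(2) subgroup.one_closed[OF submodule.axioms(1)] by fastforce
  show "\<Inter>T \<subseteq> carrier M"
    using assms submoduleE(1) by blast
qed (auto dest: assms(2) submoduleE(3-5)[OF assms(2)])

lemma (in module) submodule_module_span:
  assumes "S \<subseteq> carrier M"
  shows "submodule (module_span R M S) R M"
  unfolding module_span_def hull_def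
  by (rule submodule_Inter) (use assms carrier_is_submodule in auto)

lemma (in module) linear_map_span:
  assumes "module R N" "linear_map R M N h" "submodule E R N"
    and "S \<subseteq> carrier M" "\<And>s. s \<in> S \<Longrightarrow> h s \<in> E" "x \<in> module_span R M S"
  shows "h x \<in> E"
proof -
  have "module_span R M S \<subseteq> {x \<in> carrier M. h x \<in> E}"
    by (rule module_span_least)
       (use assms in \<open>auto intro!: submodule_vimage module_axioms\<close>)
  with assms(6) show ?thesis by auto
qed

lemma (in module) submodule_abelian_subgroup: "submodule N R M \<Longrightarrow> abelian_subgroup N M"
  by (rule abelian_subgroupI2) (auto simp: submodule_def M.a_comm_group)

lemma (in module) submodule_set_add:
  assumes "submodule N R M" "submodule N' R M"
  shows "submodule (N <+>\<^bsub>M\<^esub> N') R M"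
proof -
  note N = submoduleE[OF assms(1)] and N' = submoduleE[OF assms(2)]
  have 0: "\<zero>\<^bsub>M\<^esub> \<in> N" "\<zero>\<^bsub>M\<^esub> \<in> N'"
    using assms[THEN submodule.axioms(1), THEN subgroup.one_closed] by simp_all
  have carr: "x \<in> carrier M" if "x \<in> N \<or> x \<in> N'" for x
    using that N(1) N'(1) by auto
  show ?thesis
  proof (rule submoduleI)
    show "N <+>\<^bsub>M\<^esub> N' \<subseteq> carrier M"
      using carr by (auto simp: set_add_def')
    show "\<zero>\<^bsub>M\<^esub> \<in> N <+>\<^bsub>M\<^esub> N'"
      using 0 by (force simp: set_add_def')
    show "\<ominus>\<^bsub>M\<^esub> a \<in> N <+>\<^bsub>M\<^esub> N'" if "a \<in> N <+>\<^bsub>M\<^esub> N'" for a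
      using that N(3) N'(3) carr by (fastforce simp: set_add_def' M.minus_add)
    show "a \<oplus>\<^bsub>M\<^esub> b \<in> N <+>\<^bsub>M\<^esub> N'" if ab: "a \<in> N <+>\<^bsub>M\<^esub> N'" "b \<in> N <+>\<^bsub>M\<^esub> N'" for a b
    proof -
      obtain x y x' y' where xy: "x \<in> N" "x' \<in> N'" "a = x \<oplus>\<^bsub>M\<^esub> x'" "y \<in> N" "y' \<in> N'" "b = y \<oplus>\<^bsub>M\<^esub> y'"
        using ab by (auto simp: set_add_def')
      then have "a \<oplus>\<^bsub>M\<^esub> b = (x \<oplus>\<^bsub>M\<^esub> y) \<oplus>\<^bsub>M\<^esub> (x' \<oplus>\<^bsub>M\<^esub> y')"
        using carr by (simp add: M.add.m_ac)
      then show ?thesis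
        using N(5) N'(5) xy by (force simp: set_add_def')
    qed
    show "r \<odot>\<^bsub>M\<^esub> a \<in> N <+>\<^bsub>M\<^esub> N'" if "r \<in> carrier R" "a \<in> N <+>\<^bsub>M\<^esub> N'" for r a
      using that N(4) N'(4) carr by (fastforce simp: set_add_def' smult_r_distr)
  qed
qed

lemma (in module) set_add_incl:
  assumes "submodule N R M" "submodule N' R M"
  shows "x \<in> N \<Longrightarrow> x \<in> N <+>\<^bsub>M\<^esub> N'" "x \<in> N' \<Longrightarrow> x \<in> N <+>\<^bsub>M\<^esub> N'"
proof -
  have 0: "\<zero>\<^bsub>M\<^esub> \<in> N" "\<zero>\<^bsub>M\<^esub> \<in> N'"
    using assms[THEN submodule.axioms(1), THEN subgroup.one_closed] by simp_all
  show "x \<in> N <+>\<^bsub>M\<^esub> N'" if "x \<in> N"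
    using that 0 submoduleE(1)[OF assms(1)] by (force simp: set_add_def')
  show "x \<in> N <+>\<^bsub>M\<^esub> N'" if "x \<in> N'"
    using that 0 submoduleE(1)[OF assms(2)] by (force simp: set_add_def')
qed

lemma quotient_module_simps:
  "carrier (quotient_module M N) = (\<lambda>x. N +>\<^bsub>M\<^esub> x) ` carrier M"
  "x \<oplus>\<^bsub>quotient_module M N\<^esub> y = x <+>\<^bsub>M\<^esub> y"
  "\<zero>\<^bsub>quotient_module M N\<^esub> = N"
  "r \<odot>\<^bsub>quotient_module M N\<^esub> C = (\<Union>x\<in>C. N +>\<^bsub>M\<^esub> (r \<odot>\<^bsub>M\<^esub> x))"
  by (auto simp: quotient_module_def ring.defs module.defs FactRing_def A_RCOSETS_def')

context module
begin

context
  fixes N assumes N: "submodule N R M"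
begin

interpretation N: abelian_subgroup N M
  by (rule submodule_abelian_subgroup[OF N])

lemma coset_eq_iff:
  assumes "x \<in> carrier M" "y \<in> carrier M"
  shows "N +>\<^bsub>M\<^esub> x = N +>\<^bsub>M\<^esub> y \<longleftrightarrow> x \<ominus>\<^bsub>M\<^esub> y \<in> N"
proof -
  have "N +>\<^bsub>M\<^esub> x = N +>\<^bsub>M\<^esub> y \<longleftrightarrow> x \<in> N +>\<^bsub>M\<^esub> y"
    using assms N.a_repr_independence' N.a_rcos_self by metis
  then show ?thesis
    using assms by (simp add: N.a_rcos_module a_minus_def)
qed

lemma quotient_add: "x \<in> carrier M \<Longrightarrow> y \<in> carrier M \<Longrightarrow>
    (N +>\<^bsub>M\<^esub> x) \<oplus>\<^bsub>quotient_module M N\<^esub> (N +>\<^bsub>M\<^esub> y) = N +>\<^bsub>M\<^esub> (x \<oplus>\<^bsub>M\<^esub> y)"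
  by (simp add: quotient_module_simps N.a_rcos_sum)

lemma coset_closed: "x \<in> carrier M \<Longrightarrow> y \<in> N +>\<^bsub>M\<^esub> x \<Longrightarrow> y \<in> carrier M"
  by (metis N.a_elemrcos_carrier)

lemma in_coset_iff: "x \<in> carrier M \<Longrightarrow> y \<in> carrier M \<Longrightarrow> y \<in> N +>\<^bsub>M\<^esub> x \<longleftrightarrow> N +>\<^bsub>M\<^esub> y = N +>\<^bsub>M\<^esub> x"
  using N.a_repr_independence'[of y x] N.a_rcos_self[of y] by auto

lemma quotient_map:
  assumes "x \<in> carrier M" "module R L" "linear_map R M L f" "submodule E R L"
    and "\<And>a. a \<in> N \<Longrightarrow> f a \<in> E"
  shows "(\<Union>y\<in>N +>\<^bsub>M\<^esub> x. E +>\<^bsub>L\<^esub> f y) = E +>\<^bsub>L\<^esub> f x"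
proof -
  interpret L: module R L by fact
  have "E +>\<^bsub>L\<^esub> f y = E +>\<^bsub>L\<^esub> f x" if "y \<in> N +>\<^bsub>M\<^esub> x" for y
  proof -
    have y: "y \<in> carrier M"
      using that by (rule coset_closed[OF assms(1)])
    then have "y \<ominus>\<^bsub>M\<^esub> x \<in> N"
      using that assms(1) by (simp add: in_coset_iff coset_eq_iff)
    then have "f y \<ominus>\<^bsub>L\<^esub> f x \<in> E"
      using assms(5) linear_map_minus[OF module_axioms assms(2,3) y assms(1)] by fastforce
    then show ?thesis
      using y assms(1,3) by (simp add: module.coset_eq_iff[OF assms(2,4)] linear_map_closed)
  qed
  moreover have "x \<in> N +>\<^bsub>M\<^esub> x"
    by (rule N.a_rcos_self) fact
  ultimately show ?thesis by blast
qed

lemma linear_map_smult_self: "r \<in> carrier R \<Longrightarrow> linear_map R M M (\<lambda>x. r \<odot>\<^bsub>M\<^esub> x)"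
  by (auto simp: linear_map_def smult_r_distr R.m_comm simp flip: smult_assoc1)

lemma quotient_smult: "r \<in> carrier R \<Longrightarrow> x \<in> carrier M \<Longrightarrow>
    r \<odot>\<^bsub>quotient_module M N\<^esub> (N +>\<^bsub>M\<^esub> x) = N +>\<^bsub>M\<^esub> (r \<odot>\<^bsub>M\<^esub> x)"
  using quotient_map[OF _ module_axioms linear_map_smult_self N, of x r] submoduleE(4)[OF N]
  by (simp add: quotient_module_simps)

end

end

text \<open>Two maps that need to be inverse to each other only modulo the submodules still induce mutually
inverse maps of the quotients.\<close>

lemma quotient_module_isomorphic:
  assumes "module R M" "module R L" and N: "submodule N R M" and E: "submodule E R L"
    and f: "linear_map R M L f" and g: "linear_map R L M g"
    and fN: "\<And>a. a \<in> N \<Longrightarrow> f a \<in> E" and gE: "\<And>b. b \<in> E \<Longrightarrow> g b \<in> N"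
    and gf: "\<And>x. x \<in> carrier M \<Longrightarrow> g (f x) \<ominus>\<^bsub>M\<^esub> x \<in> N"
    and fg: "\<And>y. y \<in> carrier L \<Longrightarrow> f (g y) \<ominus>\<^bsub>L\<^esub> y \<in> E"
  shows "module_isomorphic R (quotient_module M N) (quotient_module L E)"
proof -
  interpret M: module R M by fact
  interpret L: module R L by fact
  define h where "h C = (\<Union>x\<in>C. E +>\<^bsub>L\<^esub> f x)" for C
  define k where "k C = (\<Union>y\<in>C. N +>\<^bsub>M\<^esub> g y)" for C
  have h: "h (N +>\<^bsub>M\<^esub> x) = E +>\<^bsub>L\<^esub> f x" if "x \<in> carrier M" for x
    unfolding h_def by (rule M.quotient_map) (use assms that in auto)
  have k: "k (E +>\<^bsub>L\<^esub> y) = N +>\<^bsub>M\<^esub> g y" if "y \<in> carrier L" for y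
    unfolding k_def by (rule L.quotient_map) (use assms that in auto)
  note [simp] = linear_map_closed[OF f] linear_map_closed[OF g]
  have "bij_betw h (carrier (quotient_module M N)) (carrier (quotient_module L E))"
  proof (rule bij_betw_byWitness[where f' = k])
    show "\<forall>C\<in>carrier (quotient_module M N). k (h C) = C"
      using gf by (auto simp: quotient_module_simps h k M.coset_eq_iff[OF N])
    show "\<forall>C\<in>carrier (quotient_module L E). h (k C) = C"
      using fg by (auto simp: quotient_module_simps h k L.coset_eq_iff[OF E])
  qed (auto simp: quotient_module_simps h k)
  moreover have "h \<in> hom (add_monoid (quotient_module M N)) (add_monoid (quotient_module L E))"
  proof (rule homI; simp)
    fix C assume "C \<in> carrier (quotient_module M N)"
    then show "h C \<in> carrier (quotient_module L E)"
      by (auto simp: quotient_module_simps h)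
  next
    fix C D assume "C \<in> carrier (quotient_module M N)" "D \<in> carrier (quotient_module M N)"
    then obtain x y where "x \<in> carrier M" "y \<in> carrier M" "C = N +>\<^bsub>M\<^esub> x" "D = N +>\<^bsub>M\<^esub> y"
      by (auto simp: quotient_module_simps)
    then show "h (C \<oplus>\<^bsub>quotient_module M N\<^esub> D) = h C \<oplus>\<^bsub>quotient_module L E\<^esub> h D"
      by (simp add: M.quotient_add[OF N] L.quotient_add[OF E] h linear_map_add[OF f])
  qed
  moreover have "h (r \<odot>\<^bsub>quotient_module M N\<^esub> C) = r \<odot>\<^bsub>quotient_module L E\<^esub> h C"
    if "r \<in> carrier R" "C \<in> carrier (quotient_module M N)" for r C
    using that by (auto simp: quotient_module_simps(1) M.quotient_smult[OF N] L.quotient_smult[OF E]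
        h linear_map_smult[OF f])
  ultimately have "h \<in> module_iso R (quotient_module M N) (quotient_module L E)"
    by (simp add: module_iso_def iso_def)
  then show ?thesis
    by (auto simp: module_isomorphic_def)
qed

section \<open>The free algebra over a commutative ring\<close>

context cring
begin

text \<open>The canonical ring homomorphism from the integers.\<close>

definition int_image :: "int \<Rightarrow> 'a"
  where "int_image k = [k] \<cdot> \<one>"

lemma int_image_closed [simp]: "int_image k \<in> carrier R"
  unfolding int_image_def add_pow_def using add.int_pow_closed[of \<one> k] by (simp add: add_pow_def)

lemma int_image_hom:
  shows int_image_0 [simp]: "int_image 0 = \<zero>" and int_image_1 [simp]: "int_image 1 = \<one>"
    and int_image_add: "int_image (k + l) = int_image k \<oplus> int_image l"
    and int_image_mult: "int_image (k * l) = int_image k \<otimes> int_image l"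
proof -
  show "int_image 0 = \<zero>" "int_image 1 = \<one>"
    by (simp_all add: int_image_def add_pow_def int_pow_def2)
  show "int_image (k + l) = int_image k \<oplus> int_image l"
    using add.int_pow_mult[of \<one> k l] by (simp add: int_image_def)
  have "int_image k \<otimes> int_image l = [k] \<cdot> (\<one> \<otimes> int_image l)"
    unfolding int_image_def[of k] by (rule add_pow_ldistr_int) simp_all
  also have "\<dots> = int_image (l * k)"
    using add.int_pow_pow[of \<one> k l] by (simp add: int_image_def)
  finally show "int_image (k * l) = int_image k \<otimes> int_image l"
    by (simp add: mult.commute)
qed

lemma int_image_smult: "x \<in> carrier R \<Longrightarrow> [k] \<cdot> x = int_image k \<otimes> x"
  using add_pow_ldistr_int[of \<one> x k] by (simp add: int_image_def)

lemma nat_image_smult: "x \<in> carrier R \<Longrightarrow> [k] \<cdot> x = int_image (int k) \<otimes> x"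
  by (simp add: add_pow_int_ge flip: int_image_smult)

lemma int_image_sum: "int_image (sum f A) = (\<Oplus>i\<in>A. int_image (f i))"
  by (induction A rule: infinite_finite_induct) (simp_all add: int_image_add)

definition fin_supp :: "'i set \<Rightarrow> ('i \<Rightarrow> 'a) set"
  where "fin_supp S = {f. (\<forall>i. f i \<in> carrier R) \<and> finite {i. f i \<noteq> \<zero>} \<and> (\<forall>i. f i \<noteq> \<zero> \<longrightarrow> i \<in> S)}"

lemma fin_suppD:
  assumes "f \<in> fin_supp S"
  shows "f i \<in> carrier R" "finite {i. f i \<noteq> \<zero>}" "f i \<noteq> \<zero> \<Longrightarrow> i \<in> S"
  using assms by (auto simp: fin_supp_def)

lemma fin_supp_zero: "(\<lambda>i. \<zero>) \<in> fin_supp S"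
  by (simp add: fin_supp_def)

lemma fin_supp_add:
  assumes "f \<in> fin_supp S" "g \<in> fin_supp S"
  shows "(\<lambda>i. f i \<oplus> g i) \<in> fin_supp S"
proof -
  have "{i. f i \<oplus> g i \<noteq> \<zero>} \<subseteq> {i. f i \<noteq> \<zero>} \<union> {i. g i \<noteq> \<zero>}"
    using assms by (auto simp: fin_supp_def)
  moreover have "finite \<dots>"
    using assms by (simp add: fin_supp_def)
  ultimately have "finite {i. f i \<oplus> g i \<noteq> \<zero>}"
    by (rule finite_subset)
  with assms show ?thesis
    by (auto simp: fin_supp_def) (metis r_zero zero_closed)
qed

lemma fin_supp_smult:
  assumes "r \<in> carrier R" "f \<in> fin_supp S"
  shows "(\<lambda>i. r \<otimes> f i) \<in> fin_supp S"
proof -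
  have "{i. r \<otimes> f i \<noteq> \<zero>} \<subseteq> {i. f i \<noteq> \<zero>}"
    using assms(1) by auto
  moreover have "finite \<dots>"
    using assms by (simp add: fin_supp_def)
  ultimately have "finite {i. r \<otimes> f i \<noteq> \<zero>}"
    by (rule finite_subset)
  with assms show ?thesis
    by (auto simp: fin_supp_def) (metis r_null)
qed

lemma fin_supp_uminus: "f \<in> fin_supp S \<Longrightarrow> (\<lambda>i. \<ominus> f i) \<in> fin_supp S"
  by (auto simp: fin_supp_def)

definition delta :: "'i \<Rightarrow> 'i \<Rightarrow> 'a"
  where "delta j = (\<lambda>i. if i = j then \<one> else \<zero>)"

lemma delta_fin_supp: "j \<in> S \<Longrightarrow> delta j \<in> fin_supp S"
  by (auto simp: delta_def fin_supp_def)

lemma fin_supp_induct [consumes 1, case_names zero add]: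
  assumes "f \<in> fin_supp S" "P (\<lambda>i. \<zero>)"
    and step: "\<And>f r j. f \<in> fin_supp S \<Longrightarrow> P f \<Longrightarrow> r \<in> carrier R \<Longrightarrow> j \<in> S \<Longrightarrow>
      P (\<lambda>i. r \<otimes> delta j i \<oplus> f i)"
  shows "P f"
  using assms(1)
proof (induction "card {i. f i \<noteq> \<zero>}" arbitrary: f)
  case 0
  then have "f = (\<lambda>i. \<zero>)"
    using fin_suppD(2)[OF 0(2)] by auto
  with assms(2) show ?case by simp
next
  case (Suc k)
  note f = fin_suppD[OF Suc.prems]
  obtain j where j: "f j \<noteq> \<zero>"
    using Suc.hyps(2) by (metis (mono_tags, lifting) card.empty empty_Collect_eq nat.distinct(1))
  define g where "g = f(j := \<zero>)"
  have supp: "{i. g i \<noteq> \<zero>} = {i. f i \<noteq> \<zero>} - {j}"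
    by (auto simp: g_def)
  have g: "g \<in> fin_supp S"
    using f by (auto simp: fin_supp_def supp) (auto simp: g_def split: if_splits)
  have "card {i. g i \<noteq> \<zero>} = k"
    using Suc.hyps(2) j f(2) by (simp add: supp)
  with Suc.hyps(1) g have "P g" by simp
  with g f j have "P (\<lambda>i. f j \<otimes> delta j i \<oplus> g i)"
    by (intro step) auto
  moreover have "(\<lambda>i. f j \<otimes> delta j i \<oplus> g i) = f"
    using f(1) by (auto simp: g_def delta_def)
  ultimately show ?case by simp
qed

text \<open>Coefficients are mapped to \<open>R\<close>, and basis elements with index outside \<open>S\<close> are sent to 0.\<close>

definition base_change :: "'i set \<Rightarrow> ('i \<Rightarrow>\<^sub>0 int) \<Rightarrow> 'i \<Rightarrow> 'a"
  where "base_change S z i = (if i \<in> S then int_image (Poly_Mapping.lookup z i) else \<zero>)"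

lemma base_change_fin_supp: "base_change S z \<in> fin_supp S"
proof -
  have "{i. base_change S z i \<noteq> \<zero>} \<subseteq> Poly_Mapping.keys z"
    by (auto simp: base_change_def in_keys_iff)
  then have "finite {i. base_change S z i \<noteq> \<zero>}"
    by (rule finite_subset) simp
  then show ?thesis
    by (auto simp: fin_supp_def) (auto simp: base_change_def split: if_splits)
qed

lemma base_change_0: "base_change S 0 = (\<lambda>i. \<zero>)"
  by (auto simp: base_change_def)

lemma base_change_add: "base_change S (y + z) = (\<lambda>i. base_change S y i \<oplus> base_change S z i)"
  by (auto simp: base_change_def lookup_add int_image_add fun_eq_iff)

lemma base_change_of: "base_change S (frag_of j) = (if j \<in> S then delta j else (\<lambda>i. \<zero>))"
  by (auto simp: base_change_def delta_def lookup_single)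

end

context module
begin

text \<open>The linear map from the free module on the index set that sends the basis to the family \<open>t\<close>.\<close>

definition lin_comb :: "('i \<Rightarrow> 'a) \<Rightarrow> ('i \<Rightarrow> 'c) \<Rightarrow> 'c"
  where "lin_comb f t = (\<Oplus>\<^bsub>M\<^esub>i\<in>{i. f i \<noteq> \<zero>\<^bsub>R\<^esub>}. f i \<odot>\<^bsub>M\<^esub> t i)"

lemma lin_comb_superset:
  assumes "f \<in> fin_supp S" "\<And>i. i \<in> S \<Longrightarrow> t i \<in> carrier M"
    and "finite I" "{i. f i \<noteq> \<zero>\<^bsub>R\<^esub>} \<subseteq> I" "I \<subseteq> S"
  shows "lin_comb f t = (\<Oplus>\<^bsub>M\<^esub>i\<in>I. f i \<odot>\<^bsub>M\<^esub> t i)"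
  unfolding lin_comb_def
  by (rule M.add.finprod_mono_neutral_cong_left)
     (use assms fin_suppD[OF assms(1)] in \<open>auto intro!: smult_l_null\<close>)

context
  fixes S :: "'i set" and t :: "'i \<Rightarrow> 'c"
  assumes t: "\<And>i. i \<in> S \<Longrightarrow> t i \<in> carrier M"
begin

lemma lin_comb_closed: "f \<in> fin_supp S \<Longrightarrow> lin_comb f t \<in> carrier M"
  unfolding lin_comb_def using t fin_suppD[of f S] by (intro M.finsum_closed) auto

lemma lin_comb_add:
  assumes "f \<in> fin_supp S" "g \<in> fin_supp S"
  shows "lin_comb (\<lambda>i. f i \<oplus>\<^bsub>R\<^esub> g i) t = lin_comb f t \<oplus>\<^bsub>M\<^esub> lin_comb g t"
proof -
  define I where "I = {i. f i \<noteq> \<zero>\<^bsub>R\<^esub>} \<union> {i. g i \<noteq> \<zero>\<^bsub>R\<^esub>}"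
  have I: "finite I" "I \<subseteq> S"
    using fin_suppD[OF assms(1)] fin_suppD[OF assms(2)] by (auto simp: I_def)
  have "lin_comb (\<lambda>i. f i \<oplus>\<^bsub>R\<^esub> g i) t = (\<Oplus>\<^bsub>M\<^esub>i\<in>I. (f i \<oplus>\<^bsub>R\<^esub> g i) \<odot>\<^bsub>M\<^esub> t i)"
    by (rule lin_comb_superset[OF fin_supp_add[OF assms] t]) (use I in \<open>auto simp: I_def\<close>)
  also have "\<dots> = (\<Oplus>\<^bsub>M\<^esub>i\<in>I. f i \<odot>\<^bsub>M\<^esub> t i \<oplus>\<^bsub>M\<^esub> g i \<odot>\<^bsub>M\<^esub> t i)"
    using I t fin_suppD(1)[OF assms(1)] fin_suppD(1)[OF assms(2)]
    by (intro M.finsum_cong') (auto simp: smult_l_distr)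
  also have "\<dots> = (\<Oplus>\<^bsub>M\<^esub>i\<in>I. f i \<odot>\<^bsub>M\<^esub> t i) \<oplus>\<^bsub>M\<^esub> (\<Oplus>\<^bsub>M\<^esub>i\<in>I. g i \<odot>\<^bsub>M\<^esub> t i)"
    using I t fin_suppD(1)[OF assms(1)] fin_suppD(1)[OF assms(2)]
    by (intro M.finsum_addf) auto
  also have "(\<Oplus>\<^bsub>M\<^esub>i\<in>I. f i \<odot>\<^bsub>M\<^esub> t i) = lin_comb f t"
    by (rule lin_comb_superset[symmetric, OF assms(1) t]) (use I in \<open>auto simp: I_def\<close>)
  also have "(\<Oplus>\<^bsub>M\<^esub>i\<in>I. g i \<odot>\<^bsub>M\<^esub> t i) = lin_comb g t"
    by (rule lin_comb_superset[symmetric, OF assms(2) t]) (use I in \<open>auto simp: I_def\<close>)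
  finally show ?thesis .
qed

lemma lin_comb_smult:
  assumes "r \<in> carrier R" "f \<in> fin_supp S"
  shows "lin_comb (\<lambda>i. r \<otimes>\<^bsub>R\<^esub> f i) t = r \<odot>\<^bsub>M\<^esub> lin_comb f t"
proof -
  note f = fin_suppD[OF assms(2)]
  have "lin_comb (\<lambda>i. r \<otimes>\<^bsub>R\<^esub> f i) t = (\<Oplus>\<^bsub>M\<^esub>i\<in>{i. f i \<noteq> \<zero>\<^bsub>R\<^esub>}. (r \<otimes>\<^bsub>R\<^esub> f i) \<odot>\<^bsub>M\<^esub> t i)"
    by (rule lin_comb_superset[OF fin_supp_smult[OF assms] t]) (use f assms(1) in auto)
  also have "\<dots> = (\<Oplus>\<^bsub>M\<^esub>i\<in>{i. f i \<noteq> \<zero>\<^bsub>R\<^esub>}. r \<odot>\<^bsub>M\<^esub> (f i \<odot>\<^bsub>M\<^esub> t i))"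
    using f t assms(1) by (intro M.finsum_cong') (auto simp: smult_assoc1)
  also have "\<dots> = r \<odot>\<^bsub>M\<^esub> lin_comb f t"
    unfolding lin_comb_def using f t assms(1)
    by (intro finsum_smult_ldistr[symmetric]) auto
  finally show ?thesis .
qed

lemma lin_comb_delta: "j \<in> S \<Longrightarrow> lin_comb (delta j) t = t j"
proof -
  assume "j \<in> S"
  then have "lin_comb (delta j) t = (\<Oplus>\<^bsub>M\<^esub>i\<in>{j}. delta j i \<odot>\<^bsub>M\<^esub> t i)"
    by (intro lin_comb_superset[OF delta_fin_supp t]) (auto simp: delta_def)
  with \<open>j \<in> S\<close> show ?thesis
    using t by (simp add: delta_def)
qed

end

end

definition words_upto :: "nat \<Rightarrow> nat list set"
  where "words_upto n = {w. set w \<subseteq> {1..n}}"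

lemma free_algebra_simps:
  "x \<oplus>\<^bsub>free_algebra R n\<^esub> y = (\<lambda>w. x w \<oplus>\<^bsub>R\<^esub> y w)"
  "\<zero>\<^bsub>free_algebra R n\<^esub> = (\<lambda>w. \<zero>\<^bsub>R\<^esub>)"
  "r \<odot>\<^bsub>free_algebra R n\<^esub> x = (\<lambda>w. r \<otimes>\<^bsub>R\<^esub> x w)"
  "x \<otimes>\<^bsub>free_algebra R n\<^esub> y = (\<lambda>w. \<Oplus>\<^bsub>R\<^esub>k\<in>{..length w}. x (take k w) \<otimes>\<^bsub>R\<^esub> y (drop k w))"
  by (simp_all add: free_algebra_def)

context cring
begin

lemma carrier_free_algebra: "carrier (free_algebra R n) = fin_supp (words_upto n)"
  by (auto simp: free_algebra_def fin_supp_def words_upto_def)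

lemma module_free_algebra: "module R (free_algebra R n)"
proof (rule moduleI)
  show "abelian_group (free_algebra R n)"
  proof (rule abelian_groupI; (simp add: carrier_free_algebra free_algebra_simps fin_supp_zero fin_supp_add)?)
    fix x assume x: "x \<in> fin_supp (words_upto n)"
    then show "\<exists>y\<in>fin_supp (words_upto n). (\<lambda>w. y w \<oplus> x w) = (\<lambda>w. \<zero>)"
      by (intro bexI[of _ "\<lambda>w. \<ominus> x w"]) (auto simp: fin_suppD(1) l_neg fin_supp_uminus)
  qed (auto simp: fin_suppD(1) a_ac)
qed (auto simp: is_cring carrier_free_algebra free_algebra_simps fin_supp_smult fin_suppD(1)
      l_distr r_distr m_assoc)

lemma free_mult_closed:
  assumes x: "x \<in> fin_supp (words_upto n)" and y: "y \<in> fin_supp (words_upto n)"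
  shows "x \<otimes>\<^bsub>free_algebra R n\<^esub> y \<in> fin_supp (words_upto n)"
proof -
  note x' = fin_suppD[OF x] and y' = fin_suppD[OF y]
  have *: "\<exists>k. x (take k w) \<noteq> \<zero> \<and> y (drop k w) \<noteq> \<zero>"
    if "(\<Oplus>k\<in>{..length w}. x (take k w) \<otimes> y (drop k w)) \<noteq> \<zero>" for w
  proof (rule ccontr)
    assume "\<not> ?thesis"
    then have "x (take k w) \<otimes> y (drop k w) = \<zero>" for k
      using x'(1)[of "take k w"] y'(1)[of "drop k w"] by (metis l_null r_null)
    with that show False by simp
  qed
  have "{w. (\<Oplus>k\<in>{..length w}. x (take k w) \<otimes> y (drop k w)) \<noteq> \<zero>}
      \<subseteq> (\<lambda>(u, v). u @ v) ` ({u. x u \<noteq> \<zero>} \<times> {v. y v \<noteq> \<zero>})"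
  proof
    fix w assume "w \<in> {w. (\<Oplus>k\<in>{..length w}. x (take k w) \<otimes> y (drop k w)) \<noteq> \<zero>}"
    then obtain k where "x (take k w) \<noteq> \<zero>" "y (drop k w) \<noteq> \<zero>"
      using * by blast
    then show "w \<in> (\<lambda>(u, v). u @ v) ` ({u. x u \<noteq> \<zero>} \<times> {v. y v \<noteq> \<zero>})"
      by (intro image_eqI[of _ _ "(take k w, drop k w)"]) auto
  qed
  then have "finite {w. (\<Oplus>k\<in>{..length w}. x (take k w) \<otimes> y (drop k w)) \<noteq> \<zero>}"
    by (rule finite_subset) (use x'(2) y'(2) in simp)
  moreover have "w \<in> words_upto n" if nz: "(\<Oplus>k\<in>{..length w}. x (take k w) \<otimes> y (drop k w)) \<noteq> \<zero>" for w
  proof -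
    obtain k where "take k w \<in> words_upto n" "drop k w \<in> words_upto n"
      using *[OF nz] x'(3) y'(3) by blast
    then show ?thesis
      using set_append[of "take k w" "drop k w"] by (auto simp: words_upto_def)
  qed
  ultimately show ?thesis
    using x'(1) y'(1) by (auto simp: fin_supp_def free_algebra_simps)
qed

lemma linear_free_mult_left:
  assumes a: "a \<in> carrier (free_algebra R n)"
  shows "linear_map R (free_algebra R n) (free_algebra R n) (\<lambda>x. a \<otimes>\<^bsub>free_algebra R n\<^esub> x)"
proof -
  note a' = fin_suppD(1)[OF a[unfolded carrier_free_algebra]]
  show ?thesis
    unfolding linear_map_def
  proof (intro conjI ballI)
    show "(\<lambda>x. a \<otimes>\<^bsub>free_algebra R n\<^esub> x) \<in> carrier (free_algebra R n) \<rightarrow> carrier (free_algebra R n)"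
      using a by (auto simp: carrier_free_algebra free_mult_closed)
    fix x y assume "x \<in> carrier (free_algebra R n)" "y \<in> carrier (free_algebra R n)"
    then show "a \<otimes>\<^bsub>free_algebra R n\<^esub> (x \<oplus>\<^bsub>free_algebra R n\<^esub> y)
        = a \<otimes>\<^bsub>free_algebra R n\<^esub> x \<oplus>\<^bsub>free_algebra R n\<^esub> a \<otimes>\<^bsub>free_algebra R n\<^esub> y"
      using a' fin_suppD(1)[of x "words_upto n"] fin_suppD(1)[of y "words_upto n"]
      by (simp add: carrier_free_algebra free_algebra_simps r_distr finsum_addf Pi_def)
  next
    fix r x assume "r \<in> carrier R" "x \<in> carrier (free_algebra R n)"
    then show "a \<otimes>\<^bsub>free_algebra R n\<^esub> (r \<odot>\<^bsub>free_algebra R n\<^esub> x) = r \<odot>\<^bsub>free_algebra R n\<^esub> (a \<otimes>\<^bsub>free_algebra R n\<^esub> x)"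
      using a' fin_suppD(1)[of x "words_upto n"]
      by (simp add: carrier_free_algebra free_algebra_simps m_lcomm finsum_rdistr Pi_def)
  qed
qed

lemma linear_free_mult_right:
  assumes a: "a \<in> carrier (free_algebra R n)"
  shows "linear_map R (free_algebra R n) (free_algebra R n) (\<lambda>x. x \<otimes>\<^bsub>free_algebra R n\<^esub> a)"
proof -
  note a' = fin_suppD(1)[OF a[unfolded carrier_free_algebra]]
  show ?thesis
    unfolding linear_map_def
  proof (intro conjI ballI)
    show "(\<lambda>x. x \<otimes>\<^bsub>free_algebra R n\<^esub> a) \<in> carrier (free_algebra R n) \<rightarrow> carrier (free_algebra R n)"
      using a by (auto simp: carrier_free_algebra free_mult_closed)
    fix x y assume "x \<in> carrier (free_algebra R n)" "y \<in> carrier (free_algebra R n)"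
    then show "(x \<oplus>\<^bsub>free_algebra R n\<^esub> y) \<otimes>\<^bsub>free_algebra R n\<^esub> a
        = x \<otimes>\<^bsub>free_algebra R n\<^esub> a \<oplus>\<^bsub>free_algebra R n\<^esub> y \<otimes>\<^bsub>free_algebra R n\<^esub> a"
      using a' fin_suppD(1)[of x "words_upto n"] fin_suppD(1)[of y "words_upto n"]
      by (simp add: carrier_free_algebra free_algebra_simps l_distr finsum_addf Pi_def)
  next
    fix r x assume "r \<in> carrier R" "x \<in> carrier (free_algebra R n)"
    then show "(r \<odot>\<^bsub>free_algebra R n\<^esub> x) \<otimes>\<^bsub>free_algebra R n\<^esub> a = r \<odot>\<^bsub>free_algebra R n\<^esub> (x \<otimes>\<^bsub>free_algebra R n\<^esub> a)"
      using a' fin_suppD(1)[of x "words_upto n"]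
      by (simp add: carrier_free_algebra free_algebra_simps m_assoc finsum_rdistr Pi_def)
  qed
qed

lemma free_algebra_induct:
  assumes "submodule N R (free_algebra R n)" "\<And>w. w \<in> words_upto n \<Longrightarrow> delta w \<in> N"
    and "f \<in> carrier (free_algebra R n)"
  shows "f \<in> N"
proof -
  interpret A: module R "free_algebra R n"
    by (rule module_free_algebra)
  note N = A.submoduleE[OF assms(1)]
  show ?thesis
    using assms(3) unfolding carrier_free_algebra
  proof (induction rule: fin_supp_induct)
    case zero
    then show ?case
      using subgroup.one_closed[OF submodule.axioms(1)[OF assms(1)]] by (simp add: free_algebra_simps)
  next
    case (add f r j)
    then show ?case
      using N(5)[OF N(4)[OF add(2) assms(2)[OF add(3)]] add(4)] by (simp add: free_algebra_simps)
  qed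
qed

text \<open>Letters outside \<open>{1..n}\<close> are sent to 0. Restricting the support in this way is compatible with
concatenation, so that the map is multiplicative on the whole free ring.\<close>

definition free_base_change :: "nat \<Rightarrow> int_free \<Rightarrow> nat list \<Rightarrow> 'a"
  where "free_base_change n a = (\<lambda>w. base_change (Word ` words_upto n) a (Word w))"

lemma free_base_change_closed: "free_base_change n a \<in> carrier (free_algebra R n)"
proof -
  note z = fin_suppD[OF base_change_fin_supp, of "Word ` words_upto n" a]
  have "finite {w. free_base_change n a w \<noteq> \<zero>}"
    using finite_vimageI[OF z(2), of Word] by (simp add: inj_on_def vimage_def free_base_change_def)
  then show ?thesis
    using z by (auto simp: carrier_free_algebra fin_supp_def free_base_change_def)
qed

lemma free_base_change_0: "free_base_change n 0 = \<zero>\<^bsub>free_algebra R n\<^esub>"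
  by (simp add: free_base_change_def base_change_0 free_algebra_simps)

lemma free_base_change_add: "free_base_change n (a + b) = free_base_change n a \<oplus>\<^bsub>free_algebra R n\<^esub> free_base_change n b"
  by (simp add: free_base_change_def base_change_add free_algebra_simps)

lemma free_base_change_diff: "free_base_change n (a - b) = free_base_change n a \<ominus>\<^bsub>free_algebra R n\<^esub> free_base_change n b"
proof -
  interpret A: module R "free_algebra R n"
    by (rule module_free_algebra)
  have "free_base_change n a = free_base_change n (a - b) \<oplus>\<^bsub>free_algebra R n\<^esub> free_base_change n b"
    by (simp flip: free_base_change_add)
  then show ?thesis
    using free_base_change_closed
    by (simp add: A.minus_eq A.M.add.m_assoc A.M.r_neg)
qed

lemma free_base_change_of:
  "free_base_change n (frag_of (Word w)) = (if w \<in> words_upto n then delta w else \<zero>\<^bsub>free_algebra R n\<^esub>)"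
  by (auto simp: free_base_change_def base_change_of delta_def free_algebra_simps)

lemma delta_mult: "delta u \<otimes>\<^bsub>free_algebra R n\<^esub> delta v = delta (u @ v)"
proof
  fix w
  have *: "delta u (take k w) \<otimes> delta v (drop k w) = (if w = u @ v \<and> k = length u then \<one> else \<zero>)"
    if "k \<le> length w" for k
    using that by (auto simp: delta_def min_def) (metis append_take_drop_id)+
  have "(delta u \<otimes>\<^bsub>free_algebra R n\<^esub> delta v) w
      = (\<Oplus>k\<in>{..length w}. if w = u @ v \<and> k = length u then \<one> else \<zero>)"
    unfolding free_algebra_simps by (intro finsum_cong') (auto simp: *)
  also have "\<dots> = delta (u @ v) w"
  proof (cases "w = u @ v")
    case True
    then show ?thesis
      using add.finprod_singleton_swap[of "length u" "{..length w}" "\<lambda>k. \<one>"]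
      by (simp add: delta_def)
  qed (simp add: delta_def)
  finally show "(delta u \<otimes>\<^bsub>free_algebra R n\<^esub> delta v) w = delta (u @ v) w" .
qed

lemma free_base_change_mult:
  "free_base_change n (a * b) = free_base_change n a \<otimes>\<^bsub>free_algebra R n\<^esub> free_base_change n b"
proof -
  interpret A: module R "free_algebra R n"
    by (rule module_free_algebra)
  note left = linear_free_mult_left[OF free_base_change_closed]
    and right = linear_free_mult_right[OF free_base_change_closed]
  have zero_left: "free_base_change n a \<otimes>\<^bsub>free_algebra R n\<^esub> \<zero>\<^bsub>free_algebra R n\<^esub> = \<zero>\<^bsub>free_algebra R n\<^esub>" for a
    by (rule linear_map_zero[OF module_free_algebra module_free_algebra left])
  have zero_right: "\<zero>\<^bsub>free_algebra R n\<^esub> \<otimes>\<^bsub>free_algebra R n\<^esub> free_base_change n a = \<zero>\<^bsub>free_algebra R n\<^esub>" for a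
    by (rule linear_map_zero[OF module_free_algebra module_free_algebra right])
  show ?thesis
  proof (induction a rule: frag_induct)
    case zero
    show ?case
      by (simp add: free_base_change_0 zero_right)
  next
    case (of x)
    obtain u where x: "x = Word u" by (cases x)
    show ?case
    proof (induction b rule: frag_induct)
      case zero
      show ?case
        by (simp add: free_base_change_0 zero_left)
    next
      case (of y)
      obtain v where y: "y = Word v" by (cases y)
      have "frag_of x * frag_of y = frag_of (Word (u @ v))"
        by (simp add: x y mult_single plus_word_def)
      then show ?case
        using zero_left[of "frag_of x"] zero_right[of "frag_of y"]
        by (auto simp: x y free_base_change_of delta_mult words_upto_def split: if_splits)
    next
      case (diff b c)
      then show ?case
        using free_base_change_closed
        by (simp add: right_diff_distrib free_base_change_diff
            linear_map_minus[OF module_free_algebra module_free_algebra left])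
    qed
  next
    case (diff a c)
    then show ?case
      using free_base_change_closed
      by (simp add: left_diff_distrib free_base_change_diff
          linear_map_minus[OF module_free_algebra module_free_algebra right])
  qed
qed

lemma free_base_change_bracket:
  "free_base_change n (bracket a b) = commutator (free_algebra R n) (free_base_change n a) (free_base_change n b)"
  by (simp add: bracket_def commutator_def free_base_change_diff free_base_change_mult)

end

section \<open>Differential forms over a commutative ring\<close>

definition form_index :: "nat \<Rightarrow> nat set \<Rightarrow> (nat set \<times> nat multiset) set"
  where "form_index n T = {(J, m). J \<subseteq> {1..n} \<and> card J \<in> T \<and> set_mset m \<subseteq> {1..n}}"

lemma forms_simps:
  "\<omega> \<oplus>\<^bsub>forms R n\<^esub> \<eta> = (\<lambda>J m. \<omega> J m \<oplus>\<^bsub>R\<^esub> \<eta> J m)"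
  "\<zero>\<^bsub>forms R n\<^esub> = (\<lambda>J m. \<zero>\<^bsub>R\<^esub>)"
  "r \<odot>\<^bsub>forms R n\<^esub> \<omega> = (\<lambda>J m. r \<otimes>\<^bsub>R\<^esub> \<omega> J m)"
  by (simp_all add: forms_def)

lemma forms_of_rank_simps:
  "\<omega> \<oplus>\<^bsub>forms_of_rank R n T\<^esub> \<eta> = (\<lambda>J m. \<omega> J m \<oplus>\<^bsub>R\<^esub> \<eta> J m)"
  "\<zero>\<^bsub>forms_of_rank R n T\<^esub> = (\<lambda>J m. \<zero>\<^bsub>R\<^esub>)"
  "r \<odot>\<^bsub>forms_of_rank R n T\<^esub> \<omega> = (\<lambda>J m. r \<otimes>\<^bsub>R\<^esub> \<omega> J m)"
  by (simp_all add: forms_of_rank_def forms_simps)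

context cring
begin

lemma indexed_pset_monomial:
  assumes "c \<in> carrier R" "set_mset m \<subseteq> I"
  shows "(\<lambda>k. if k = m then c else \<zero>) \<in> indexed_pset I (carrier R)"
  using assms(2)
proof (induction m)
  case empty
  show ?case
    using indexed_pset.indexed_const[OF assms(1)] by (simp add: indexed_const_def)
next
  case (add i m)
  have "indexed_pmult (\<lambda>k. if k = m then c else \<zero>) i = (\<lambda>k. if k = add_mset i m then c else \<zero>)"
    by (auto simp: indexed_pmult_def fun_eq_iff)
  with add indexed_pset.indexed_pmult[of _ I "carrier R" i] show ?case
    by (metis insert_subset set_mset_add_mset_insert)
qed

text \<open>The inductively generated polynomials are the finitely supported coefficient functions: monomials
are obtained by multiplying constants with variables, and all others are sums of monomials.\<close>

lemma indexed_pset_eq: "indexed_pset I (carrier R) = fin_supp {m. set_mset m \<subseteq> I}"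
proof (intro equalityI subsetI)
  fix p assume "p \<in> indexed_pset I (carrier R)"
  then show "p \<in> fin_supp {m. set_mset m \<subseteq> I}"
  proof (induction rule: indexed_pset.induct)
    case (indexed_const k)
    have "finite {m. m = {#} \<and> k \<noteq> \<zero>}"
      by (rule finite_subset[of _ "{{#}}"]) auto
    with indexed_const show ?case
      by (auto simp: fin_supp_def indexed_const_def)
  next
    case (indexed_padd P Q)
    then show ?case
      by (auto simp: indexed_padd_def intro: fin_supp_add)
  next
    case (indexed_pmult P i)
    have "{m. (P \<Otimes> i) m \<noteq> \<zero>} \<subseteq> add_mset i ` {m. P m \<noteq> \<zero>}"
      by (auto simp: indexed_pmult_def intro!: image_eqI[where x = "_ - {#i#}"])
    then have "finite {m. (P \<Otimes> i) m \<noteq> \<zero>}"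
      by (rule finite_subset) (use fin_suppD[OF indexed_pmult.IH] in simp)
    moreover have "set_mset m \<subseteq> I" if nz: "(P \<Otimes> i) m \<noteq> \<zero>" for m
    proof -
      have "i \<in># m" "set_mset (m - {#i#}) \<subseteq> I"
        using nz fin_suppD(3)[OF indexed_pmult.IH, of "m - {#i#}"]
        by (auto simp: indexed_pmult_def split: if_splits)
      then show ?thesis
        using indexed_pmult.hyps(2) by (metis insert_DiffM insert_subset set_mset_add_mset_insert)
    qed
    ultimately show ?case
      using fin_suppD(1)[OF indexed_pmult.IH] by (auto simp: fin_supp_def) (auto simp: indexed_pmult_def)
  qed
next
  fix p assume "p \<in> fin_supp {m. set_mset m \<subseteq> I}"
  then show "p \<in> indexed_pset I (carrier R)"
  proof (induction rule: fin_supp_induct)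
    case zero
    show ?case
      using indexed_pset.indexed_const[OF zero_closed] by (simp add: indexed_zero_def)
  next
    case (add f r j)
    have eq: "(\<lambda>i. r \<otimes> delta j i \<oplus> f i) = indexed_padd (\<lambda>k. if k = j then r else \<zero>) f"
      using add by (auto simp: indexed_padd_def delta_def fun_eq_iff)
    show ?case
      unfolding eq by (rule indexed_pset.indexed_padd) (use add in \<open>auto intro: indexed_pset_monomial\<close>)
  qed
qed

lemma carrier_forms_of_rank:
  "\<omega> \<in> carrier (forms_of_rank R n T) \<longleftrightarrow> case_prod \<omega> \<in> fin_supp (form_index n T)"
proof
  assume "\<omega> \<in> carrier (forms_of_rank R n T)"
  then have J: "\<And>J. J \<subseteq> {1..n} \<Longrightarrow> \<omega> J \<in> fin_supp {m. set_mset m \<subseteq> {1..n}}"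
    and notJ: "\<And>J. \<not> J \<subseteq> {1..n} \<Longrightarrow> \<omega> J = (\<lambda>m. \<zero>)"
    and T: "\<And>J. card J \<notin> T \<Longrightarrow> \<omega> J = (\<lambda>m. \<zero>)"
    by (auto simp: forms_of_rank_def forms_def indexed_pset_eq split: if_splits)
  have "\<omega> J m \<in> carrier R" for J m
    by (metis J notJ fin_suppD(1) zero_closed)
  moreover have "{(J, m). \<omega> J m \<noteq> \<zero>} \<subseteq> (SIGMA J:Pow {1..n}. {m. \<omega> J m \<noteq> \<zero>})"
    using notJ by fastforce
  then have "finite {(J, m). \<omega> J m \<noteq> \<zero>}"
    by (rule finite_subset) (use J fin_suppD(2) in \<open>auto intro!: finite_SigmaI\<close>)
  moreover have "(J, m) \<in> form_index n T" if nz: "\<omega> J m \<noteq> \<zero>" for J m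
  proof -
    have "J \<subseteq> {1..n}" "card J \<in> T"
      using nz notJ T by metis+
    then show ?thesis
      using fin_suppD(3)[OF J nz] by (auto simp: form_index_def)
  qed
  ultimately show "case_prod \<omega> \<in> fin_supp (form_index n T)"
    by (auto simp: fin_supp_def case_prod_unfold)
next
  assume \<omega>: "case_prod \<omega> \<in> fin_supp (form_index n T)"
  note \<omega>' = fin_suppD[OF \<omega>]
  have "\<omega> J \<in> fin_supp {m. set_mset m \<subseteq> {1..n}}" for J
  proof -
    have "finite {m. \<omega> J m \<noteq> \<zero>}"
      using finite_vimageI[OF \<omega>'(2), of "Pair J"] by (simp add: inj_on_def vimage_def)
    then show ?thesis
      using \<omega>'(1)[of "(J, _)"] \<omega>'(3)[of "(J, _)"] by (auto simp: fin_supp_def form_index_def)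
  qed
  moreover have "\<omega> J = (\<lambda>m. \<zero>)" if "\<not> J \<subseteq> {1..n}" for J
    by (rule ext) (use \<omega>'(3)[of "(J, m)" for m] that in \<open>auto simp: form_index_def\<close>)
  moreover have "\<omega> J = (\<lambda>m. \<zero>)" if "card J \<notin> T" for J
    by (rule ext) (use \<omega>'(3)[of "(J, m)" for m] that in \<open>auto simp: form_index_def\<close>)
  ultimately show "\<omega> \<in> carrier (forms_of_rank R n T)"
    by (simp add: forms_of_rank_def forms_def indexed_pset_eq)
qed

lemma forms_of_rank_UNIV: "forms_of_rank R n UNIV = forms R n"
  by (simp add: forms_of_rank_def)

lemma form_coeff_closed: "\<omega> \<in> carrier (forms_of_rank R n T) \<Longrightarrow> \<omega> J m \<in> carrier R"
  using fin_suppD(1)[of "case_prod \<omega>" "form_index n T" "(J, m)"] by (simp add: carrier_forms_of_rank)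

lemma module_forms_of_rank: "module R (forms_of_rank R n T)"
proof (rule moduleI)
  have add: "\<omega> \<oplus>\<^bsub>forms_of_rank R n T\<^esub> \<eta> \<in> carrier (forms_of_rank R n T)"
    if "\<omega> \<in> carrier (forms_of_rank R n T)" "\<eta> \<in> carrier (forms_of_rank R n T)" for \<omega> \<eta>
    using that fin_supp_add[of "case_prod \<omega>" "form_index n T" "case_prod \<eta>"]
    by (simp add: carrier_forms_of_rank forms_of_rank_simps case_prod_unfold)
  show "abelian_group (forms_of_rank R n T)"
  proof (rule abelian_groupI)
    show "\<zero>\<^bsub>forms_of_rank R n T\<^esub> \<in> carrier (forms_of_rank R n T)"
      using fin_supp_zero[of "form_index n T"]
      by (simp add: carrier_forms_of_rank forms_of_rank_simps case_prod_unfold)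
    fix \<omega> assume \<omega>: "\<omega> \<in> carrier (forms_of_rank R n T)"
    have "(\<lambda>J m. \<ominus> \<omega> J m) \<in> carrier (forms_of_rank R n T)"
      using \<omega> fin_supp_uminus[of "case_prod \<omega>" "form_index n T"]
      by (simp add: carrier_forms_of_rank case_prod_unfold)
    moreover have "(\<lambda>J m. \<ominus> \<omega> J m) \<oplus>\<^bsub>forms_of_rank R n T\<^esub> \<omega> = \<zero>\<^bsub>forms_of_rank R n T\<^esub>"
      using form_coeff_closed[OF \<omega>] by (simp add: forms_of_rank_simps l_neg)
    ultimately show "\<exists>\<eta>\<in>carrier (forms_of_rank R n T). \<eta> \<oplus>\<^bsub>forms_of_rank R n T\<^esub> \<omega> = \<zero>\<^bsub>forms_of_rank R n T\<^esub>"
      by blast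
  qed (use add in \<open>auto simp: forms_of_rank_simps form_coeff_closed a_ac\<close>)
  show "r \<odot>\<^bsub>forms_of_rank R n T\<^esub> \<omega> \<in> carrier (forms_of_rank R n T)"
    if "r \<in> carrier R" "\<omega> \<in> carrier (forms_of_rank R n T)" for r \<omega>
    using that fin_supp_smult[of r "case_prod \<omega>" "form_index n T"]
    by (simp add: carrier_forms_of_rank forms_of_rank_simps case_prod_unfold)
qed (auto simp: is_cring forms_of_rank_simps form_coeff_closed l_distr r_distr m_assoc)

definition form_delta :: "nat set \<times> nat multiset \<Rightarrow> nat set \<Rightarrow> nat multiset \<Rightarrow> 'a"
  where "form_delta x = curry (delta x)"

lemma forms_induct:
  assumes "submodule N R (forms_of_rank R n T)" "\<And>x. x \<in> form_index n T \<Longrightarrow> form_delta x \<in> N"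
    and "\<omega> \<in> carrier (forms_of_rank R n T)"
  shows "\<omega> \<in> N"
proof -
  interpret M: module R "forms_of_rank R n T"
    by (rule module_forms_of_rank)
  note N = M.submoduleE[OF assms(1)]
  have "curry f \<in> N" if "f \<in> fin_supp (form_index n T)" for f
    using that
  proof (induction rule: fin_supp_induct)
    case zero
    then show ?case
      using subgroup.one_closed[OF submodule.axioms(1)[OF assms(1)]]
      by (simp add: forms_of_rank_simps curry_def)
  next
    case (add f r j)
    then show ?case
      using N(5)[OF N(4)[OF add(2) assms(2)[OF add(3)]] add(4)]
      by (simp add: forms_of_rank_simps curry_def form_delta_def)
  qed
  from this[of "case_prod \<omega>"] show ?thesis
    using assms(3) by (simp add: carrier_forms_of_rank)
qed

definition form_base_change :: "nat \<Rightarrow> nat set \<Rightarrow> int_form \<Rightarrow> nat set \<Rightarrow> nat multiset \<Rightarrow> 'a"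
  where "form_base_change n T z = curry (base_change (form_index n T) z)"

lemma form_base_change_closed: "form_base_change n T z \<in> carrier (forms_of_rank R n T)"
  by (simp add: carrier_forms_of_rank form_base_change_def base_change_fin_supp)

lemma form_base_change_0: "form_base_change n T 0 = \<zero>\<^bsub>forms_of_rank R n T\<^esub>"
  by (simp add: form_base_change_def base_change_0 forms_of_rank_simps curry_def)

lemma form_base_change_add:
  "form_base_change n T (y + z) = form_base_change n T y \<oplus>\<^bsub>forms_of_rank R n T\<^esub> form_base_change n T z"
  by (simp add: form_base_change_def base_change_add forms_of_rank_simps curry_def)

lemma form_base_change_diff:
  "form_base_change n T (y - z) = form_base_change n T y \<ominus>\<^bsub>forms_of_rank R n T\<^esub> form_base_change n T z"
proof -
  interpret M: module R "forms_of_rank R n T"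
    by (rule module_forms_of_rank)
  have "form_base_change n T y = form_base_change n T (y - z) \<oplus>\<^bsub>forms_of_rank R n T\<^esub> form_base_change n T z"
    by (simp flip: form_base_change_add)
  then show ?thesis
    using form_base_change_closed
    by (simp add: M.minus_eq M.M.add.m_assoc M.M.r_neg)
qed

lemma form_base_change_of:
  "x \<in> form_index n T \<Longrightarrow> form_base_change n T (frag_of x) = form_delta x"
  by (simp add: form_base_change_def base_change_of form_delta_def)

lemma de_rham_d_coeff:
  assumes "\<omega> \<in> carrier (forms_of_rank R n T)"
  shows "de_rham_d R \<omega> J m
    = (\<Oplus>i\<in>J. int_image (wedge_sign {i} (J - {i}) * int (Suc (count m i))) \<otimes> \<omega> (J - {i}) (add_mset i m))"
proof -
  have "[c] \<cdot> ([Suc k] \<cdot> x) = int_image (c * int (Suc k)) \<otimes> x" if "x \<in> carrier R" for c k x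
    by (simp only: nat_image_smult[OF that] int_image_smult[OF m_closed[OF int_image_closed that]]
        int_image_mult m_assoc[OF int_image_closed int_image_closed that])
  then show ?thesis
    unfolding de_rham_d_def partial_deriv_def
    using form_coeff_closed[OF assms] by (intro finsum_cong') auto
qed

lemma linear_de_rham_d:
  assumes "\<And>k. k \<in> T \<Longrightarrow> Suc k \<in> T'"
  shows "linear_map R (forms_of_rank R n T) (forms_of_rank R n T') (de_rham_d R)"
  unfolding linear_map_def
proof (intro conjI ballI funcsetI)
  fix \<omega> assume \<omega>: "\<omega> \<in> carrier (forms_of_rank R n T)"
  note \<omega>' = fin_suppD[OF \<omega>[unfolded carrier_forms_of_rank]]
  have ex: "\<exists>i\<in>J. \<omega> (J - {i}) (add_mset i m) \<noteq> \<zero>" if "de_rham_d R \<omega> J m \<noteq> \<zero>" for J m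
  proof (rule ccontr)
    assume "\<not> ?thesis"
    then have "de_rham_d R \<omega> J m = (\<Oplus>i\<in>J. \<zero>)"
      unfolding de_rham_d_coeff[OF \<omega>] by (intro finsum_cong') auto
    with that show False by simp
  qed
  have "{(J, m). de_rham_d R \<omega> J m \<noteq> \<zero>}
      \<subseteq> (\<lambda>(i, J, m). (insert i J, m - {#i#})) ` ({1..n} \<times> {(J, m). \<omega> J m \<noteq> \<zero>})"
  proof clarify
    fix J m assume "de_rham_d R \<omega> J m \<noteq> \<zero>"
    then obtain i where i: "i \<in> J" "\<omega> (J - {i}) (add_mset i m) \<noteq> \<zero>"
      using ex by blast
    then have "i \<in> {1..n}"
      using \<omega>'(3)[of "(J - {i}, add_mset i m)"] by (auto simp: form_index_def)
    with i show "(J, m) \<in> (\<lambda>(i, J, m). (insert i J, m - {#i#})) ` ({1..n} \<times> {(J, m). \<omega> J m \<noteq> \<zero>})"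
      by (intro image_eqI[of _ _ "(i, J - {i}, add_mset i m)"]) auto
  qed
  then have "finite {(J, m). de_rham_d R \<omega> J m \<noteq> \<zero>}"
    by (rule finite_subset) (use \<omega>'(2) in \<open>simp add: case_prod_unfold\<close>)
  moreover have "(J, m) \<in> form_index n T'" if nz: "de_rham_d R \<omega> J m \<noteq> \<zero>" for J m
  proof -
    obtain i where i: "i \<in> J" "\<omega> (J - {i}) (add_mset i m) \<noteq> \<zero>"
      using ex nz by blast
    then have K: "J - {i} \<subseteq> {1..n}" "card (J - {i}) \<in> T" "i \<in> {1..n}" "set_mset m \<subseteq> {1..n}"
      using \<omega>'(3)[of "(J - {i}, add_mset i m)"] by (auto simp: form_index_def)
    have "finite (J - {i})"
      using K(1) by (rule finite_subset) simp
    then have "card J = Suc (card (J - {i}))"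
      using i(1) card_Suc_Diff1[of J i] by auto
    then have "card J \<in> T'"
      using assms[OF K(2)] by simp
    with K show ?thesis
      by (auto simp: form_index_def)
  qed
  moreover have "de_rham_d R \<omega> J m \<in> carrier R" for J m
    unfolding de_rham_d_coeff[OF \<omega>] using form_coeff_closed[OF \<omega>] by (intro finsum_closed) auto
  ultimately show "de_rham_d R \<omega> \<in> carrier (forms_of_rank R n T')"
    by (auto simp: carrier_forms_of_rank fin_supp_def case_prod_unfold)
next
  interpret M: module R "forms_of_rank R n T"
    by (rule module_forms_of_rank)
  {
    fix \<omega> \<eta> assume \<omega>: "\<omega> \<in> carrier (forms_of_rank R n T)" and \<eta>: "\<eta> \<in> carrier (forms_of_rank R n T)"
    show "de_rham_d R (\<omega> \<oplus>\<^bsub>forms_of_rank R n T\<^esub> \<eta>) = de_rham_d R \<omega> \<oplus>\<^bsub>forms_of_rank R n T'\<^esub> de_rham_d R \<eta>"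
    proof (intro ext)
      fix J m
      show "de_rham_d R (\<omega> \<oplus>\<^bsub>forms_of_rank R n T\<^esub> \<eta>) J m
          = (de_rham_d R \<omega> \<oplus>\<^bsub>forms_of_rank R n T'\<^esub> de_rham_d R \<eta>) J m"
        using form_coeff_closed[OF \<omega>] form_coeff_closed[OF \<eta>]
        by (subst de_rham_d_coeff[OF M.M.a_closed[OF \<omega> \<eta>]])
           (simp add: de_rham_d_coeff[OF \<omega>] de_rham_d_coeff[OF \<eta>] forms_of_rank_simps
              r_distr finsum_addf Pi_def)
    qed
  }
  fix r \<omega> assume r: "r \<in> carrier R" and \<omega>: "\<omega> \<in> carrier (forms_of_rank R n T)"
  show "de_rham_d R (r \<odot>\<^bsub>forms_of_rank R n T\<^esub> \<omega>) = r \<odot>\<^bsub>forms_of_rank R n T'\<^esub> de_rham_d R \<omega>"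
  proof (intro ext)
    fix J m
    show "de_rham_d R (r \<odot>\<^bsub>forms_of_rank R n T\<^esub> \<omega>) J m = (r \<odot>\<^bsub>forms_of_rank R n T'\<^esub> de_rham_d R \<omega>) J m"
    proof (cases "finite J")
      case True
      then show ?thesis
        using r form_coeff_closed[OF \<omega>]
        by (subst de_rham_d_coeff[OF M.smult_closed[OF r \<omega>]])
           (simp add: de_rham_d_coeff[OF \<omega>] forms_of_rank_simps m_lcomm finsum_rdistr Pi_def)
    qed (use r in \<open>simp add: de_rham_d_def forms_of_rank_simps finsum_infinite\<close>)
  qed
qed

end

lemma lookup_wedge_var: "Poly_Mapping.lookup (wedge_var i z) (J, m)
    = (if i \<in> J then wedge_sign {i} (J - {i}) * Poly_Mapping.lookup z (J - {i}, m) else 0)"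
proof (induction z rule: frag_induct)
  case (of x)
  obtain K l where x: "x = (K, l)" by fastforce
  show ?case
    by (auto simp: x lookup_single when_def insert_Diff_if)
qed (simp_all add: lookup_minus algebra_simps)

lemma lookup_pderiv_var: "Poly_Mapping.lookup (pderiv_var i z) (J, m)
    = int (Suc (count m i)) * Poly_Mapping.lookup z (J, add_mset i m)"
proof (induction z rule: frag_induct)
  case (of x)
  obtain K l where x: "x = (K, l)" by fastforce
  show ?case
  proof (cases "i \<in># l")
    case True
    then show ?thesis
      by (auto simp: x lookup_single when_def dest!: multi_member_split)
  next
    case False
    then have "count l i = 0" by (simp add: not_in_iff)
    with False show ?thesis by (auto simp: x lookup_single when_def)
  qed
qed (simp_all add: lookup_minus algebra_simps)

lemma lookup_sum_fun: "Poly_Mapping.lookup (sum f A) k = (\<Sum>i\<in>A. Poly_Mapping.lookup (f i) k)"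
  by (induction A rule: infinite_finite_induct) (simp_all add: lookup_add)

lemma lookup_d_on:
  assumes "finite S"
  shows "Poly_Mapping.lookup (d_on S z) (J, m) = (\<Sum>i\<in>S \<inter> J.
    wedge_sign {i} (J - {i}) * int (Suc (count m i)) * Poly_Mapping.lookup z (J - {i}, add_mset i m))"
  using assms
  by (simp add: d_on_def lookup_sum_fun lookup_wedge_var lookup_pderiv_var sum.inter_restrict mult.assoc
      del: of_nat_Suc cong: if_cong)

text \<open>Both sides are compared coefficient by coefficient. A coefficient whose index is out of range
vanishes on either side, as passing from \<open>(J, m)\<close> to \<open>(J - {i}, m + i)\<close> does not change the variables
that occur.\<close>

lemma (in cring) de_rham_d_base_change:
  "de_rham_d R (form_base_change n {k. Suc k \<in> T} z) = form_base_change n T (d_on {1..n} z)"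
proof (intro ext)
  fix J m
  let ?U = "{k. Suc k \<in> T}"
  let ?c = "\<lambda>i. wedge_sign {i} (J - {i}) * int (Suc (count m i))"
  have d: "de_rham_d R (form_base_change n ?U z) J m
      = (\<Oplus>i\<in>J. int_image (?c i) \<otimes> form_base_change n ?U z (J - {i}) (add_mset i m))"
    by (rule de_rham_d_coeff[OF form_base_change_closed])
  show "de_rham_d R (form_base_change n ?U z) J m = form_base_change n T (d_on {1..n} z) J m"
  proof (cases "(J, m) \<in> form_index n T")
    case True
    then have J: "J \<subseteq> {1..n}" and m: "set_mset m \<subseteq> {1..n}" and T: "card J \<in> T"
      by (auto simp: form_index_def)
    have fin: "finite J"
      using J by (rule finite_subset) simp
    have "form_base_change n ?U z (J - {i}) (add_mset i m) = int_image (Poly_Mapping.lookup z (J - {i}, add_mset i m))"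
      if "i \<in> J" for i
    proof -
      have "Suc (card (J - {i})) = card J"
        using fin that by (rule card_Suc_Diff1)
      then have "(J - {i}, add_mset i m) \<in> form_index n ?U"
        using J m T that by (auto simp: form_index_def)
      then show ?thesis
        by (simp add: form_base_change_def base_change_def)
    qed
    then have "de_rham_d R (form_base_change n ?U z) J m
        = (\<Oplus>i\<in>J. int_image (?c i * Poly_Mapping.lookup z (J - {i}, add_mset i m)))"
      unfolding d by (intro finsum_cong') (auto simp: int_image_mult simp del: of_nat_Suc)
    also have "\<dots> = form_base_change n T (d_on {1..n} z) J m"
      using True J by (simp add: form_base_change_def base_change_def lookup_d_on Int_absorb1
          int_image_sum del: of_nat_Suc)
    finally show ?thesis .
  next
    case False
    have "form_base_change n ?U z (J - {i}) (add_mset i m) = \<zero>" if i: "i \<in> J" for i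
    proof -
      have "(J - {i}, add_mset i m) \<notin> form_index n ?U"
      proof
        assume *: "(J - {i}, add_mset i m) \<in> form_index n ?U"
        then have "J - {i} \<subseteq> {1..n}"
          by (simp add: form_index_def)
        then have "finite (J - {i})"
          by (rule finite_subset) simp
        then have "Suc (card (J - {i})) = card J"
          using i by (intro card_Suc_Diff1) auto
        with * i False show False
          by (auto simp: form_index_def)
      qed
      then show ?thesis
        by (simp add: form_base_change_def base_change_def)
    qed
    then have "de_rham_d R (form_base_change n ?U z) J m = (\<Oplus>i\<in>J. \<zero>)"
      unfolding d by (intro finsum_cong') auto
    with False show ?thesis
      by (simp add: form_base_change_def base_change_def)
  qed
qed

section \<open>Even forms modulo exact forms\<close>

text \<open>On integral elements with support in the right index set no basis element is lost under base change.\<close>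

definition supported_in :: "('i \<Rightarrow>\<^sub>0 int) \<Rightarrow> 'i set \<Rightarrow> bool"
  where "supported_in z S \<longleftrightarrow> Poly_Mapping.keys z \<subseteq> S"

lemma supported_in_linear:
  "supported_in 0 S" "supported_in (frag_of i) S \<longleftrightarrow> i \<in> S"
  "supported_in y S \<Longrightarrow> supported_in z S \<Longrightarrow> supported_in (y + z) S"
  "supported_in y S \<Longrightarrow> supported_in z S \<Longrightarrow> supported_in (y - z) S"
  "supported_in z S \<Longrightarrow> supported_in (frag_cmul c z) S"
  using Poly_Mapping.keys_add[of y z] keys_diff[of y z] by (auto simp: supported_in_def)

lemma supported_in_sum: "(\<And>i. i \<in> A \<Longrightarrow> supported_in (f i) S) \<Longrightarrow> supported_in (sum f A) S"
  by (induction A rule: infinite_finite_induct) (auto simp: supported_in_linear)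

lemma supported_in_frag_extend:
  assumes "supported_in z S" "\<And>i. i \<in> S \<Longrightarrow> supported_in (f i) S'"
  shows "supported_in (frag_extend f z) S'"
  using assms keys_frag_extend[of f z] unfolding supported_in_def by blast

lemma supported_in_induct [consumes 1, case_names zero of diff]:
  assumes "supported_in z S" "P 0" "\<And>x. x \<in> S \<Longrightarrow> P (frag_of x)"
    "\<And>a b. P a \<Longrightarrow> P b \<Longrightarrow> P (a - b)"
  shows "P z"
  using assms(1) unfolding supported_in_def by (rule frag_induction) (use assms in auto)

lemma supported_mul_var:
  assumes "supported_in z (form_index n T)" "j \<in> {1..n}"
  shows "supported_in (mul_var j z) (form_index n T)"
  unfolding mul_var_def
  by (rule supported_in_frag_extend[OF assms(1)])
     (use assms(2) in \<open>auto simp: supported_in_linear form_index_def\<close>)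

lemma supported_wedge_var:
  assumes "supported_in z (form_index n T)" "j \<in> {1..n}" "\<And>k. k \<in> T \<Longrightarrow> Suc k \<in> T'"
  shows "supported_in (wedge_var j z) (form_index n T')"
  unfolding wedge_var_def
proof (rule supported_in_frag_extend[OF assms(1)], clarify)
  fix J m assume Jm: "(J, m) \<in> form_index n T"
  then have "J \<subseteq> {1..n}" by (simp add: form_index_def)
  then have "finite J" by (rule finite_subset) simp
  then have "j \<notin> J \<Longrightarrow> (insert j J, m) \<in> form_index n T'"
    using Jm assms(2,3) by (simp add: form_index_def)
  then show "supported_in (if j \<in> J then 0 else frag_cmul (wedge_sign {j} J) (frag_of (insert j J, m)))
      (form_index n T')"
    by (simp add: supported_in_linear)
qed

lemma supported_pderiv_var:
  assumes "supported_in z (form_index n T)"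
  shows "supported_in (pderiv_var j z) (form_index n T)"
  unfolding pderiv_var_def
  by (rule supported_in_frag_extend[OF assms(1)])
     (auto simp: supported_in_linear form_index_def dest!: in_diffD intro!: supported_in_linear(5))

lemma pderiv_var_outside:
  assumes "supported_in z (form_index n T)" "j \<notin> {1..n}"
  shows "pderiv_var j z = 0"
  using assms(1)
proof (induction rule: supported_in_induct)
  case (of x)
  obtain J m where x: "x = (J, m)" by fastforce
  have "j \<notin># m"
    using of assms(2) by (auto simp: x form_index_def)
  then show ?case by (simp add: x not_in_iff)
qed auto

lemma supported_d_on:
  assumes "supported_in z (form_index n T)" "\<And>k. k \<in> T \<Longrightarrow> Suc k \<in> T'"
  shows "supported_in (d_on S z) (form_index n T')"
  unfolding d_on_def
proof (rule supported_in_sum)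
  fix i
  show "supported_in (wedge_var i (pderiv_var i z)) (form_index n T')"
  proof (cases "i \<in> {1..n}")
    case True
    then show ?thesis
      using assms supported_pderiv_var supported_wedge_var by blast
  next
    case False
    then show ?thesis
      using pderiv_var_outside[OF assms(1)] by (simp add: supported_in_linear)
  qed
qed

lemma supported_act_word:
  assumes "w \<in> words_upto n" "supported_in z (form_index n T)"
    and "\<And>k. k \<in> T \<Longrightarrow> Suc k \<in> T'" "\<And>k. k \<in> T' \<Longrightarrow> Suc k \<in> T"
  shows "supported_in (act_word w z) (form_index n T)"
  using assms(1)
proof (induction w)
  case (Cons j w)
  then have w: "supported_in (act_word w z) (form_index n T)" and j: "j \<in> {1..n}"
    by (auto simp: words_upto_def)
  show ?case
    unfolding act_word_simps act_var_def
    by (intro supported_in_linear(3) supported_mul_var[OF w j]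
        supported_wedge_var[OF supported_d_on[OF w, of T'] j]) (use assms(3,4) in auto)
qed (use assms(2) in simp)

abbreviation word_index :: "nat \<Rightarrow> word set"
  where "word_index n \<equiv> Word ` words_upto n"

lemma supported_in_mult:
  assumes "supported_in a (word_index n)" "supported_in b (word_index n)"
  shows "supported_in (a * b) (word_index n)"
proof -
  have "Word u + Word v \<in> word_index n" if "u \<in> words_upto n" "v \<in> words_upto n" for u v
    using that by (auto simp: plus_word_def words_upto_def)
  then show ?thesis
    using assms keys_mult[of a b] unfolding supported_in_def by fast
qed

lemma supported_in_one: "supported_in (1 :: int_free) (word_index n)"
proof -
  have one: "1 = frag_of (Word [])"
    by (simp flip: single_one zero_word_def)
  show ?thesis
    unfolding one by (simp add: supported_in_linear words_upto_def)
qed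

lemma supported_in_bracket:
  "supported_in a (word_index n) \<Longrightarrow> supported_in b (word_index n) \<Longrightarrow> supported_in (bracket a b) (word_index n)"
  unfolding bracket_def by (intro supported_in_linear(4) supported_in_mult)

lemma supported_in_letter: "i \<in> {1..n} \<Longrightarrow> supported_in (letter i) (word_index n)"
  by (auto simp: letter_def supported_in_linear words_upto_def)

lemma supported_normal_order:
  assumes "(J, m) \<in> form_index n T"
  shows "supported_in (normal_order (frag_of (J, m))) (word_index n)"
proof -
  have J: "J \<subseteq> {1..n}" and m: "set_mset m \<subseteq> {1..n}"
    using assms by (auto simp: form_index_def)
  have fin: "finite J"
    using J by (rule finite_subset) simp
  have pb: "set l \<subseteq> {1..n} \<Longrightarrow> supported_in (pair_brackets letter l) (word_index n)" for l
    by (induction l rule: induct_list012)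
       (auto intro!: supported_in_one supported_in_linear(1) supported_in_mult supported_in_bracket supported_in_letter)
  have "set l \<subseteq> {1..n} \<Longrightarrow> supported_in (prod_list (map letter l)) (word_index n)" for l
    by (induction l) (auto intro!: supported_in_one supported_in_mult supported_in_letter)
  then have "supported_in (sorted_monom letter m) (word_index n)"
    unfolding sorted_monom_def using m by simp
  with pb[of "sorted_list_of_set J"] J fin show ?thesis
    by (simp add: normal_order_def supported_in_mult)
qed

context cring
begin

text \<open>The map from the free algebra to even forms: let an element act on the form 1.\<close>

definition form_of :: "nat \<Rightarrow> (nat list \<Rightarrow> 'a) \<Rightarrow> nat set \<Rightarrow> nat multiset \<Rightarrow> 'a"
  where "form_of n f = module.lin_comb R (forms_of_rank R n even_ranks) f
    (\<lambda>w. form_base_change n even_ranks (act_word w one_form))"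

text \<open>The map back: replace each basis form by its normal-ordered monomial.\<close>

definition ordered_lift :: "nat \<Rightarrow> (nat set \<Rightarrow> nat multiset \<Rightarrow> 'a) \<Rightarrow> nat list \<Rightarrow> 'a"
  where "ordered_lift n \<omega> = module.lin_comb R (free_algebra R n) (case_prod \<omega>)
    (\<lambda>x. free_base_change n (normal_order (frag_of x)))"

lemma linear_form_of: "linear_map R (free_algebra R n) (forms_of_rank R n even_ranks) (form_of n)"
proof -
  interpret M: module R "forms_of_rank R n even_ranks"
    by (rule module_forms_of_rank)
  show ?thesis
    unfolding linear_map_def form_of_def carrier_free_algebra free_algebra_simps
    by (intro conjI ballI funcsetI M.lin_comb_closed M.lin_comb_add M.lin_comb_smult)
       (auto simp: form_base_change_closed)
qed

lemma linear_ordered_lift: "linear_map R (forms_of_rank R n even_ranks) (free_algebra R n) (ordered_lift n)"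
proof -
  interpret A: module R "free_algebra R n"
    by (rule module_free_algebra)
  show ?thesis
    unfolding linear_map_def ordered_lift_def
    using A.lin_comb_closed[of "form_index n even_ranks" "\<lambda>x. free_base_change n (normal_order (frag_of x))"]
      A.lin_comb_add[of "form_index n even_ranks" "\<lambda>x. free_base_change n (normal_order (frag_of x))"]
      A.lin_comb_smult[of "form_index n even_ranks" "\<lambda>x. free_base_change n (normal_order (frag_of x))"]
    by (auto simp: carrier_forms_of_rank forms_of_rank_simps free_base_change_closed case_prod_unfold)
qed

lemma form_of_delta:
  "w \<in> words_upto n \<Longrightarrow> form_of n (delta w) = form_base_change n even_ranks (act_word w one_form)"
proof -
  interpret M: module R "forms_of_rank R n even_ranks"
    by (rule module_forms_of_rank)
  assume "w \<in> words_upto n"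
  then show ?thesis
    unfolding form_of_def by (intro M.lin_comb_delta) (auto simp: form_base_change_closed)
qed

lemma form_of_base_change:
  assumes "supported_in a (word_index n)"
  shows "form_of n (free_base_change n a) = form_base_change n even_ranks (act a one_form)"
  using assms
proof (induction rule: supported_in_induct)
  case zero
  show ?case
    using linear_map_zero[OF module_free_algebra module_forms_of_rank linear_form_of]
    by (simp add: free_base_change_0 form_base_change_0)
next
  case (of x)
  then show ?case
    by (auto simp: free_base_change_of form_of_delta)
next
  case (diff a b)
  then show ?case
    by (simp add: free_base_change_diff form_base_change_diff free_base_change_closed
        linear_map_minus[OF module_free_algebra module_forms_of_rank linear_form_of])
qed

lemma ordered_lift_delta:
  assumes "x \<in> form_index n even_ranks"
  shows "ordered_lift n (form_delta x) = free_base_change n (normal_order (frag_of x))"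
proof -
  interpret A: module R "free_algebra R n"
    by (rule module_free_algebra)
  show ?thesis
    unfolding ordered_lift_def form_delta_def
    using A.lin_comb_delta[of "form_index n even_ranks" "\<lambda>x. free_base_change n (normal_order (frag_of x))", OF _ assms]
    by (simp add: free_base_change_closed)
qed

lemma ordered_lift_base_change:
  assumes "supported_in z (form_index n even_ranks)"
  shows "ordered_lift n (form_base_change n even_ranks z) = free_base_change n (normal_order z)"
  using assms
proof (induction rule: supported_in_induct)
  case zero
  show ?case
    using linear_map_zero[OF module_forms_of_rank module_free_algebra linear_ordered_lift]
    by (simp add: free_base_change_0 form_base_change_0)
next
  case (of x)
  then show ?case
    by (simp add: form_base_change_of ordered_lift_delta)
next
  case (diff a b)
  then show ?case
    by (simp add: free_base_change_diff form_base_change_diff form_base_change_closed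
        linear_map_minus[OF module_forms_of_rank module_free_algebra linear_ordered_lift])
qed

lemma linear_commutator:
  assumes "a \<in> carrier (free_algebra R n)"
  shows "linear_map R (free_algebra R n) (free_algebra R n) (commutator (free_algebra R n) a)"
    and "linear_map R (free_algebra R n) (free_algebra R n) (\<lambda>x. commutator (free_algebra R n) x a)"
  unfolding commutator_def
  by (intro module.linear_map_minus_fun[OF module_free_algebra] linear_free_mult_left[OF assms]
      linear_free_mult_right[OF assms])+

text \<open>A linear condition on the free algebra may be tested on words. Applied once in each argument, this
reduces multilinear conditions to the integral identities for words.\<close>

lemma linear_on_free_algebra:
  assumes "module R N" "linear_map R (free_algebra R n) N h" "submodule E R N"
    and "\<And>w. w \<in> words_upto n \<Longrightarrow> h (free_base_change n (frag_of (Word w))) \<in> E"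
    and "f \<in> carrier (free_algebra R n)"
  shows "h f \<in> E"
proof -
  have "f \<in> {x \<in> carrier (free_algebra R n). h x \<in> E}"
  proof (rule free_algebra_induct[OF submodule_vimage[OF module_free_algebra assms(1-3)] _ assms(5)])
    fix w assume "w \<in> words_upto n"
    then show "delta w \<in> {x \<in> carrier (free_algebra R n). h x \<in> E}"
      using assms(4) by (simp add: free_base_change_of carrier_free_algebra delta_fin_supp)
  qed
  then show ?thesis by simp
qed

lemma lower_central_2: "lower_central R A 2 = module_span R A
    {commutator A a b | a b. a \<in> carrier A \<and> b \<in> carrier A}"
  by (simp add: numeral_2_eq_2)

lemma lower_central_3: "lower_central R A 3 = module_span R A
    {commutator A a l | a l. a \<in> carrier A \<and> l \<in> lower_central R A 2}"
  by (simp add: numeral_2_eq_2 numeral_3_eq_3)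

lemma commutator_closed:
  "a \<in> carrier (free_algebra R n) \<Longrightarrow> b \<in> carrier (free_algebra R n) \<Longrightarrow>
    commutator (free_algebra R n) a b \<in> carrier (free_algebra R n)"
  by (rule linear_map_closed[OF linear_commutator(1)])

lemma free_mult_closed':
  "a \<in> carrier (free_algebra R n) \<Longrightarrow> b \<in> carrier (free_algebra R n) \<Longrightarrow>
    a \<otimes>\<^bsub>free_algebra R n\<^esub> b \<in> carrier (free_algebra R n)"
  by (rule linear_map_closed[OF linear_free_mult_left])

lemma submodule_lower_central_2: "submodule (lower_central R (free_algebra R n) 2) R (free_algebra R n)"
  unfolding lower_central_2
  by (rule module.submodule_module_span[OF module_free_algebra]) (auto intro: commutator_closed)

lemma lower_central_2_closed:
  "x \<in> lower_central R (free_algebra R n) 2 \<Longrightarrow> x \<in> carrier (free_algebra R n)"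
  using module.submoduleE(1)[OF module_free_algebra submodule_lower_central_2] by blast

lemma submodule_lower_central_3: "submodule (lower_central R (free_algebra R n) 3) R (free_algebra R n)"
  unfolding lower_central_3
  by (rule module.submodule_module_span[OF module_free_algebra])
     (auto intro: commutator_closed lower_central_2_closed)

lemma lower_central_3_closed:
  "x \<in> lower_central R (free_algebra R n) 3 \<Longrightarrow> x \<in> carrier (free_algebra R n)"
  using module.submoduleE(1)[OF module_free_algebra submodule_lower_central_3] by blast

lemma submodule_lower_central_ideal_3:
  "submodule (lower_central_ideal R (free_algebra R n) 3) R (free_algebra R n)"
  unfolding lower_central_ideal_def
  by (rule module.submodule_module_span[OF module_free_algebra])
     (auto intro: free_mult_closed' lower_central_3_closed)

lemma base_change_third_ideal:
  "x \<in> third_ideal \<Longrightarrow> free_base_change n x \<in> lower_central_ideal R (free_algebra R n) 3"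
proof (induction rule: third_ideal.induct)
  interpret A: module R "free_algebra R n"
    by (rule module_free_algebra)
  note sub = A.submoduleE[OF submodule_lower_central_ideal_3]
  {
    case zero
    show ?case
      using subgroup.one_closed[OF submodule.axioms(1)[OF submodule_lower_central_ideal_3]]
      by (simp add: free_base_change_0)
  next
    case (generator a b c d)
    have "free_base_change n (bracket c d) \<in> lower_central R (free_algebra R n) 2"
      unfolding lower_central_2 free_base_change_bracket
      by (rule A.module_span_incl) (use free_base_change_closed in blast)
    then have "free_base_change n (bracket b (bracket c d)) \<in> lower_central R (free_algebra R n) 3"
      unfolding lower_central_3 free_base_change_bracket[of n b]
      by (intro A.module_span_incl) (use free_base_change_closed in blast)
    then show ?case
      unfolding lower_central_ideal_def free_base_change_mult[of n a]
      by (intro A.module_span_incl) (use free_base_change_closed in blast)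
  next
    case (diff x y)
    then show ?case
      using sub(3)[OF diff.IH(2)] sub(5) by (simp add: free_base_change_diff a_minus_def)
  }
qed

lemma base_change_bracket_lower_central:
  "free_base_change n (bracket b c) \<in> lower_central R (free_algebra R n) 2"
  unfolding lower_central_2 free_base_change_bracket
  by (rule module.module_span_incl[OF module_free_algebra]) (use free_base_change_closed in blast)

lemma exact_forms_eq: "exact_forms R n even_ranks = de_rham_d R ` carrier (forms_of_rank R n {k. Suc k \<in> even_ranks})"
  by (simp add: exact_forms_def)

lemma submodule_exact_even: "submodule (exact_forms R n even_ranks) R (forms_of_rank R n even_ranks)"
  unfolding exact_forms_eq
  by (rule submodule_image[OF module_forms_of_rank module_forms_of_rank linear_de_rham_d]) simp

lemma form_of_commutator_exact:
  assumes a: "a \<in> carrier (free_algebra R n)" and b: "b \<in> carrier (free_algebra R n)"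
  shows "form_of n (commutator (free_algebra R n) a b) \<in> exact_forms R n even_ranks"
proof (rule linear_on_free_algebra[OF module_forms_of_rank _ submodule_exact_even _ a])
  show "linear_map R (free_algebra R n) (forms_of_rank R n even_ranks)
      (\<lambda>a. form_of n (commutator (free_algebra R n) a b))"
    by (rule linear_map_comp[OF linear_commutator(2)[OF b] linear_form_of])
  fix v assume v: "v \<in> words_upto n"
  let ?v = "free_base_change n (frag_of (Word v))"
  show "form_of n (commutator (free_algebra R n) ?v b) \<in> exact_forms R n even_ranks"
  proof (rule linear_on_free_algebra[OF module_forms_of_rank _ submodule_exact_even _ b])
    show "linear_map R (free_algebra R n) (forms_of_rank R n even_ranks)
        (\<lambda>b. form_of n (commutator (free_algebra R n) ?v b))"
      by (rule linear_map_comp[OF linear_commutator(1)[OF free_base_change_closed] linear_form_of])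
    fix w assume w: "w \<in> words_upto n"
    \<comment> \<open>The primitive from the integral identity; its ranks are odd because words preserve the parity of the rank.\<close>
    let ?\<eta> = "act_word v (d_on {1..n} (act_word w one_form))"
    let ?odd = "{k. Suc k \<in> even_ranks}"
    have "supported_in (act_word w one_form) (form_index n even_ranks)"
      by (rule supported_act_word[OF w, where T' = ?odd]) (auto simp: supported_in_linear form_index_def)
    then have "supported_in ?\<eta> (form_index n ?odd)"
      by (intro supported_act_word[OF v, where T' = even_ranks] supported_d_on) auto
    have "form_of n (commutator (free_algebra R n) ?v (free_base_change n (frag_of (Word w))))
        = form_of n (free_base_change n (bracket (frag_of (Word v)) (frag_of (Word w))))"
      by (simp only: free_base_change_bracket)
    also have "\<dots> = form_base_change n even_ranks (act (bracket (frag_of (Word v)) (frag_of (Word w))) one_form)"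
      using v w by (intro form_of_base_change supported_in_bracket) (auto simp: supported_in_linear)
    also have "act (bracket (frag_of (Word v)) (frag_of (Word w))) one_form = d_on {1..n} ?\<eta>"
      using act_word_bracket_exact[of "{1..n}" v w] v w by (simp add: act_bracket words_upto_def)
    also have "form_base_change n even_ranks (d_on {1..n} ?\<eta>) = de_rham_d R (form_base_change n ?odd ?\<eta>)"
      by (rule de_rham_d_base_change[symmetric])
    finally show "form_of n (commutator (free_algebra R n) ?v (free_base_change n (frag_of (Word w))))
        \<in> exact_forms R n even_ranks"
      unfolding exact_forms_eq using form_base_change_closed by auto
  qed
qed

lemma form_of_double_commutator:
  assumes a: "a \<in> carrier (free_algebra R n)" and b: "b \<in> carrier (free_algebra R n)"
    and c: "c \<in> carrier (free_algebra R n)" and e: "e \<in> carrier (free_algebra R n)"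
  shows "form_of n (a \<otimes>\<^bsub>free_algebra R n\<^esub> commutator (free_algebra R n) b (commutator (free_algebra R n) c e))
    = \<zero>\<^bsub>forms_of_rank R n even_ranks\<^esub>"
proof -
  interpret M: module R "forms_of_rank R n even_ranks"
    by (rule module_forms_of_rank)
  let ?A = "free_algebra R n" and ?M = "forms_of_rank R n even_ranks" and ?b = "free_base_change n"
  note induct = linear_on_free_algebra[OF module_forms_of_rank _ M.submodule_zero]
  note carr = free_base_change_closed
  have "form_of n (a \<otimes>\<^bsub>?A\<^esub> commutator ?A b (commutator ?A c e)) \<in> {\<zero>\<^bsub>?M\<^esub>}"
  proof (rule induct[where h = "\<lambda>a. form_of n (a \<otimes>\<^bsub>?A\<^esub> commutator ?A b (commutator ?A c e))", OF _ _ a])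
    show "linear_map R ?A ?M (\<lambda>a. form_of n (a \<otimes>\<^bsub>?A\<^esub> commutator ?A b (commutator ?A c e)))"
      by (rule linear_map_comp[OF linear_free_mult_right linear_form_of]) (use b c e commutator_closed in blast)
    fix t assume t: "t \<in> words_upto n"
    let ?t = "frag_of (Word t)"
    show "form_of n (?b ?t \<otimes>\<^bsub>?A\<^esub> commutator ?A b (commutator ?A c e)) \<in> {\<zero>\<^bsub>?M\<^esub>}"
    proof (rule induct[where h = "\<lambda>b. form_of n (?b ?t \<otimes>\<^bsub>?A\<^esub> commutator ?A b (commutator ?A c e))", OF _ _ b])
      show "linear_map R ?A ?M (\<lambda>b. form_of n (?b ?t \<otimes>\<^bsub>?A\<^esub> commutator ?A b (commutator ?A c e)))"
        by (intro linear_map_comp[OF linear_map_comp[OF linear_commutator(2) linear_free_mult_left] linear_form_of])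
           (use c e commutator_closed carr in blast)+
      fix u assume u: "u \<in> words_upto n"
      let ?u = "frag_of (Word u)"
      show "form_of n (?b ?t \<otimes>\<^bsub>?A\<^esub> commutator ?A (?b ?u) (commutator ?A c e)) \<in> {\<zero>\<^bsub>?M\<^esub>}"
      proof (rule induct[where h = "\<lambda>c. form_of n (?b ?t \<otimes>\<^bsub>?A\<^esub> commutator ?A (?b ?u) (commutator ?A c e))", OF _ _ c])
        show "linear_map R ?A ?M (\<lambda>c. form_of n (?b ?t \<otimes>\<^bsub>?A\<^esub> commutator ?A (?b ?u) (commutator ?A c e)))"
          by (intro linear_map_comp[OF linear_map_comp[OF linear_map_comp[OF linear_commutator(2)
                linear_commutator(1)] linear_free_mult_left] linear_form_of]) (use e carr in blast)+
        fix v assume v: "v \<in> words_upto n"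
        let ?v = "frag_of (Word v)"
        show "form_of n (?b ?t \<otimes>\<^bsub>?A\<^esub> commutator ?A (?b ?u) (commutator ?A (?b ?v) e)) \<in> {\<zero>\<^bsub>?M\<^esub>}"
        proof (rule induct[where h = "\<lambda>e. form_of n (?b ?t \<otimes>\<^bsub>?A\<^esub> commutator ?A (?b ?u) (commutator ?A (?b ?v) e))", OF _ _ e])
          show "linear_map R ?A ?M (\<lambda>e. form_of n (?b ?t \<otimes>\<^bsub>?A\<^esub> commutator ?A (?b ?u) (commutator ?A (?b ?v) e)))"
            by (intro linear_map_comp[OF linear_map_comp[OF linear_map_comp[OF linear_commutator(1)
                linear_commutator(1)] linear_free_mult_left] linear_form_of]) (use carr in blast)+
          fix w assume w: "w \<in> words_upto n"
          let ?w = "frag_of (Word w)"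
          have "form_of n (?b ?t \<otimes>\<^bsub>?A\<^esub> commutator ?A (?b ?u) (commutator ?A (?b ?v) (?b ?w)))
              = form_of n (?b (?t * bracket ?u (bracket ?v ?w)))"
            by (simp only: free_base_change_bracket free_base_change_mult)
          also have "\<dots> = form_base_change n even_ranks (act (?t * bracket ?u (bracket ?v ?w)) one_form)"
            using t u v w
            by (intro form_of_base_change supported_in_mult supported_in_bracket)
               (auto simp: supported_in_linear)
          also have "\<dots> = \<zero>\<^bsub>?M\<^esub>"
            by (simp add: act_double_bracket form_base_change_0)
          finally show "form_of n (?b ?t \<otimes>\<^bsub>?A\<^esub> commutator ?A (?b ?u) (commutator ?A (?b ?v) (?b ?w))) \<in> {\<zero>\<^bsub>?M\<^esub>}"
            by simp
        qed
      qed
    qed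
  qed
  then show ?thesis by simp
qed

lemma form_of_lower_central_2:
  assumes "x \<in> lower_central R (free_algebra R n) 2"
  shows "form_of n x \<in> exact_forms R n even_ranks"
  by (rule module.linear_map_span[OF module_free_algebra module_forms_of_rank linear_form_of
        submodule_exact_even _ _ assms[unfolded lower_central_2]])
     (auto intro: commutator_closed form_of_commutator_exact)

lemma form_of_lower_central_ideal_3:
  assumes "x \<in> lower_central_ideal R (free_algebra R n) 3"
  shows "form_of n x = \<zero>\<^bsub>forms_of_rank R n even_ranks\<^esub>"
proof -
  interpret M: module R "forms_of_rank R n even_ranks"
    by (rule module_forms_of_rank)
  interpret A: module R "free_algebra R n"
    by (rule module_free_algebra)
  let ?A = "free_algebra R n" and ?M = "forms_of_rank R n even_ranks"
  note span = A.linear_map_span[OF module_forms_of_rank _ M.submodule_zero]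
  have two: "form_of n (a \<otimes>\<^bsub>?A\<^esub> commutator ?A b l) \<in> {\<zero>\<^bsub>?M\<^esub>}"
    if "a \<in> carrier ?A" "b \<in> carrier ?A" "l \<in> lower_central R ?A 2" for a b l
    by (rule span[where h = "\<lambda>l. form_of n (a \<otimes>\<^bsub>?A\<^esub> commutator ?A b l)", OF _ _ _ that(3)[unfolded lower_central_2]])
       (use that(1,2) in \<open>auto intro: commutator_closed form_of_double_commutator
          intro!: linear_map_comp[OF linear_map_comp[OF linear_commutator(1) linear_free_mult_left] linear_form_of]\<close>)
  have three: "form_of n (a \<otimes>\<^bsub>?A\<^esub> l) \<in> {\<zero>\<^bsub>?M\<^esub>}"
    if "a \<in> carrier ?A" "l \<in> lower_central R ?A 3" for a l
    by (rule span[where h = "\<lambda>l. form_of n (a \<otimes>\<^bsub>?A\<^esub> l)", OF _ _ _ that(2)[unfolded lower_central_3]])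
       (use that(1) two in \<open>auto intro: commutator_closed lower_central_2_closed
          intro!: linear_map_comp[OF linear_free_mult_left linear_form_of]\<close>)
  have "form_of n x \<in> {\<zero>\<^bsub>?M\<^esub>}"
    by (rule span[where h = "form_of n", OF linear_form_of _ _ assms[unfolded lower_central_ideal_def]])
       (use three in \<open>auto intro: free_mult_closed' lower_central_3_closed\<close>)
  then show ?thesis by simp
qed

text \<open>The maps \<open>form_of\<close> and \<open>ordered_lift\<close> are inverse to each other modulo the two submodules; as they are
linear, every condition is checked on a basis, where it is the base change of an integral identity.\<close>

theorem B1_bar_free_algebra_isomorphic:
  "module_isomorphic R (B1_bar R (free_algebra R n))
     (quotient_module (forms_of_rank R n even_ranks) (exact_forms R n even_ranks))"
proof -
  interpret A: module R "free_algebra R n"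
    by (rule module_free_algebra)
  interpret M: module R "forms_of_rank R n even_ranks"
    by (rule module_forms_of_rank)
  let ?A = "free_algebra R n" and ?M = "forms_of_rank R n even_ranks" and ?E = "exact_forms R n even_ranks"
  let ?odd = "{k. Suc k \<in> even_ranks}"
  define L where "L = lower_central R ?A 2"
  define I where "I = lower_central_ideal R ?A 3"
  have L: "submodule L R ?A" and I: "submodule I R ?A"
    by (simp_all add: L_def I_def submodule_lower_central_2 submodule_lower_central_ideal_3)
  have LI: "submodule (L <+>\<^bsub>?A\<^esub> I) R ?A"
    by (rule A.submodule_set_add[OF L I])
  note incl = A.set_add_incl[OF L I]
  note E0 = subgroup.one_closed[OF submodule.axioms(1)[OF submodule_exact_even], simplified]
  show ?thesis
    unfolding B1_bar_def L_def[symmetric] I_def[symmetric]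
  proof (rule quotient_module_isomorphic[OF module_free_algebra module_forms_of_rank LI submodule_exact_even
        linear_form_of linear_ordered_lift])
    fix x assume "x \<in> L <+>\<^bsub>?A\<^esub> I"
    then obtain l i where li: "l \<in> L" "i \<in> I" and x: "x = l \<oplus>\<^bsub>?A\<^esub> i"
      by (auto simp: set_add_def')
    then have carr: "l \<in> carrier ?A" "i \<in> carrier ?A"
      using A.submoduleE(1)[OF L] A.submoduleE(1)[OF I] by auto
    have l: "form_of n l \<in> ?E"
      using li(1) by (simp add: L_def form_of_lower_central_2)
    then have "form_of n l \<in> carrier ?M"
      using M.submoduleE(1)[OF submodule_exact_even] by blast
    with l show "form_of n x \<in> ?E"
      using li(2) carr
      by (simp add: x linear_map_add[OF linear_form_of] form_of_lower_central_ideal_3 I_def)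
  next
    fix \<omega> assume "\<omega> \<in> ?E"
    then obtain \<eta> where \<eta>: "\<eta> \<in> carrier (forms_of_rank R n ?odd)" and \<omega>: "\<omega> = de_rham_d R \<eta>"
      by (auto simp: exact_forms_eq)
    have lin: "linear_map R (forms_of_rank R n ?odd) ?A (\<lambda>\<eta>. ordered_lift n (de_rham_d R \<eta>))"
      by (rule linear_map_comp[OF linear_de_rham_d linear_ordered_lift]) simp
    have "\<eta> \<in> {\<eta> \<in> carrier (forms_of_rank R n ?odd). ordered_lift n (de_rham_d R \<eta>) \<in> L <+>\<^bsub>?A\<^esub> I}"
    proof (rule forms_induct[OF submodule_vimage[OF module_forms_of_rank module_free_algebra lin LI] _ \<eta>])
      fix x assume x: "x \<in> form_index n ?odd"
      obtain J m where Jm: "x = (J, m)" by fastforce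
      have "J \<noteq> {}"
        using x by (auto simp: Jm form_index_def)
      then obtain k where "k \<in> J" by blast
      then obtain b c where bc: "normal_order (d_on {1..n} (frag_of x)) - bracket b c \<in> third_ideal"
        using normal_order_exact[of "{1..n}" m k J] x by (auto simp: Jm form_index_def)
      have "ordered_lift n (de_rham_d R (form_delta x))
          = ordered_lift n (form_base_change n even_ranks (d_on {1..n} (frag_of x)))"
        by (simp only: form_base_change_of[OF x, symmetric] de_rham_d_base_change)
      also have "\<dots> = free_base_change n (normal_order (d_on {1..n} (frag_of x)))"
        by (intro ordered_lift_base_change supported_d_on[where T = ?odd]) (use x in \<open>auto simp: supported_in_linear\<close>)
      also have "\<dots> = free_base_change n (bracket b c) \<oplus>\<^bsub>?A\<^esub>
          free_base_change n (normal_order (d_on {1..n} (frag_of x)) - bracket b c)"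
        by (simp flip: free_base_change_add)
      also have "\<dots> \<in> L <+>\<^bsub>?A\<^esub> I"
        using base_change_bracket_lower_central[of n b c] base_change_third_ideal[OF bc, of n]
        unfolding L_def I_def set_add_def' by blast
      finally show "form_delta x \<in> {\<eta> \<in> carrier (forms_of_rank R n ?odd). ordered_lift n (de_rham_d R \<eta>) \<in> L <+>\<^bsub>?A\<^esub> I}"
        using x form_base_change_closed[of n ?odd "frag_of x"] by (simp add: form_base_change_of)
    qed
    then show "ordered_lift n \<omega> \<in> L <+>\<^bsub>?A\<^esub> I"
      by (simp add: \<omega>)
  next
    fix x assume x: "x \<in> carrier ?A"
    have id: "linear_map R ?A ?A (\<lambda>x. x)"
      by (simp add: linear_map_def)
    show "ordered_lift n (form_of n x) \<ominus>\<^bsub>?A\<^esub> x \<in> L <+>\<^bsub>?A\<^esub> I"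
    proof (rule linear_on_free_algebra[OF module_free_algebra _ LI _ x])
      show "linear_map R ?A ?A (\<lambda>x. ordered_lift n (form_of n x) \<ominus>\<^bsub>?A\<^esub> x)"
        by (intro A.linear_map_minus_fun linear_map_comp[OF linear_form_of linear_ordered_lift] id)
      fix w assume w: "w \<in> words_upto n"
      have "supported_in (act_word w one_form) (form_index n even_ranks)"
        by (rule supported_act_word[OF w, where T' = ?odd]) (auto simp: supported_in_linear form_index_def)
      then have "ordered_lift n (form_of n (free_base_change n (frag_of (Word w))))
            \<ominus>\<^bsub>?A\<^esub> free_base_change n (frag_of (Word w))
          = free_base_change n (normal_order (act_word w one_form) - frag_of (Word w))"
        using w by (simp add: form_of_base_change ordered_lift_base_change supported_in_linear free_base_change_diff)
      also have "\<dots> \<in> L <+>\<^bsub>?A\<^esub> I"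
        by (intro incl(2)) (simp add: I_def base_change_third_ideal normal_order_act_word)
      finally show "ordered_lift n (form_of n (free_base_change n (frag_of (Word w))))
            \<ominus>\<^bsub>?A\<^esub> free_base_change n (frag_of (Word w)) \<in> L <+>\<^bsub>?A\<^esub> I" .
    qed
  next
    fix \<omega> assume \<omega>: "\<omega> \<in> carrier ?M"
    have id: "linear_map R ?M ?M (\<lambda>x. x)"
      by (simp add: linear_map_def)
    have lin: "linear_map R ?M ?M (\<lambda>\<omega>. form_of n (ordered_lift n \<omega>) \<ominus>\<^bsub>?M\<^esub> \<omega>)"
      by (intro M.linear_map_minus_fun linear_map_comp[OF linear_ordered_lift linear_form_of] id)
    have "\<omega> \<in> {\<omega> \<in> carrier ?M. form_of n (ordered_lift n \<omega>) \<ominus>\<^bsub>?M\<^esub> \<omega> \<in> ?E}"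
    proof (rule forms_induct[OF submodule_vimage[OF module_forms_of_rank module_forms_of_rank lin submodule_exact_even] _ \<omega>])
      fix x assume x: "x \<in> form_index n even_ranks"
      obtain J m where Jm: "x = (J, m)" by fastforce
      have "J \<subseteq> {1..n}"
        using x by (simp add: Jm form_index_def)
      then have "finite J"
        by (rule finite_subset) simp
      then have "form_of n (ordered_lift n (form_delta x)) = form_delta x"
        using x by (simp add: ordered_lift_delta form_of_base_change supported_normal_order Jm
            act_normal_order form_base_change_of) (simp add: act_normal_order form_index_def form_base_change_of)
      moreover have "form_delta x \<in> carrier ?M"
        using x form_base_change_closed[of n even_ranks "frag_of x"] by (simp add: form_base_change_of)
      ultimately show "form_delta x \<in> {\<omega> \<in> carrier ?M. form_of n (ordered_lift n \<omega>) \<ominus>\<^bsub>?M\<^esub> \<omega> \<in> ?E}"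
        using E0 by (simp add: a_minus_def M.M.r_neg)
    qed
    then show "form_of n (ordered_lift n \<omega>) \<ominus>\<^bsub>?M\<^esub> \<omega> \<in> ?E"
      by simp
  qed
qed

end

section \<open>A projection of integral forms onto the closed forms\<close>

lemma (in cring) carrier_forms_mono:
  "T \<subseteq> T' \<Longrightarrow> \<omega> \<in> carrier (forms_of_rank R n T) \<Longrightarrow> \<omega> \<in> carrier (forms_of_rank R n T')"
  by (auto simp: forms_of_rank_def)

text \<open>By linearity it suffices to consider basis forms, which come from integral forms.\<close>

lemma (in cring) de_rham_d_square:
  assumes "\<omega> \<in> carrier (forms_of_rank R n T)"
  shows "de_rham_d R (de_rham_d R \<omega>) = (\<lambda>J m. \<zero>)"
proof -
  let ?M = "forms_of_rank R n UNIV"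
  have lin: "linear_map R ?M ?M (\<lambda>\<omega>. de_rham_d R (de_rham_d R \<omega>))"
    by (rule linear_map_comp[OF linear_de_rham_d[of UNIV UNIV] linear_de_rham_d[of UNIV UNIV]]) simp_all
  have "\<omega> \<in> {\<omega> \<in> carrier ?M. de_rham_d R (de_rham_d R \<omega>) \<in> {\<zero>\<^bsub>?M\<^esub>}}"
  proof (rule forms_induct[OF submodule_vimage[OF module_forms_of_rank module_forms_of_rank lin
          module.submodule_zero[OF module_forms_of_rank]]])
    show "\<omega> \<in> carrier ?M"
      using assms by (rule carrier_forms_mono[rotated]) simp
    fix x assume x: "x \<in> form_index n UNIV"
    have d: "de_rham_d R (form_base_change n UNIV z) = form_base_change n UNIV (d_on {1..n} z)" for z
      using de_rham_d_base_change[of n UNIV z] by simp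
    have "de_rham_d R (de_rham_d R (form_delta x)) = \<zero>\<^bsub>?M\<^esub>"
      unfolding form_base_change_of[OF x, symmetric] d d_on_d_on by (rule form_base_change_0)
    then show "form_delta x \<in> {\<omega> \<in> carrier ?M. de_rham_d R (de_rham_d R \<omega>) \<in> {\<zero>\<^bsub>?M\<^esub>}}"
      using form_base_change_closed[of n UNIV "frag_of x"] by (simp add: form_base_change_of[OF x])
  qed
  then show ?thesis
    by (simp add: forms_of_rank_simps)
qed

lemma add_pow_int_ring: "[k] \<cdot>\<^bsub>\<Z>\<^esub> x = k * x" for k :: int
proof -
  have nat: "[j] \<cdot>\<^bsub>\<Z>\<^esub> x = int j * x" for j :: nat
    by (induction j) (simp_all add: add_pow_def algebra_simps)
  have inv: "\<ominus>\<^bsub>\<Z>\<^esub> y = - y" for y :: int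
    using abelian_group.minus_equality[of \<Z> "- y" y] cring.axioms(1)[OF int_is_cring] 
    by (simp add: ring_def)
  show ?thesis
  proof (cases "k \<ge> 0")
    case True
    then show ?thesis using nat[of "nat k"] by (simp add: add_pow_int_ge)
  next
    case False
    then show ?thesis using nat[of "nat (- k)"] by (simp add: add_pow_int_lt inv)
  qed
qed

lemma add_pow_nat_int_ring: "[k] \<cdot>\<^bsub>\<Z>\<^esub> x = int k * x" for k :: nat and x :: int
  using add_pow_int_ring[of "int k" x] by (simp add: add_pow_int_ge)

lemma de_rham_d_int: "de_rham_d \<Z> \<omega> J m
    = (\<Sum>i\<in>J. wedge_sign {i} (J - {i}) * int (Suc (count m i)) * \<omega> (J - {i}) (add_mset i m))"
  unfolding de_rham_d_def partial_deriv_def add_pow_int_ring add_pow_nat_int_ring int_finsum_eq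
  by (simp add: mult.assoc)

lemma bezout_Gcd_int:
  fixes f :: "'i \<Rightarrow> int"
  assumes "finite S"
  shows "\<exists>c. (\<Sum>k\<in>S. c k * f k) = Gcd (f ` S)"
  using assms
proof (induction S rule: finite_induct)
  case (insert s S)
  then obtain c where c: "(\<Sum>k\<in>S. c k * f k) = Gcd (f ` S)" by blast
  obtain u v where uv: "u * f s + v * Gcd (f ` S) = gcd (f s) (Gcd (f ` S))"
    using bezout_int by blast
  \<comment> \<open>Scale the coefficients of the smaller sum by the second Bezout coefficient.\<close>
  define c' where "c' k = (if k = s then u else v * c k)" for k
  have "(\<Sum>k\<in>S. c' k * f k) = v * (\<Sum>k\<in>S. c k * f k)"
    unfolding sum_distrib_left using insert.hyps by (intro sum.cong) (auto simp: c'_def)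
  then have "(\<Sum>k\<in>insert s S. c' k * f k) = Gcd (f ` insert s S)"
    using insert.hyps uv c by (simp add: c'_def)
  then show ?case by blast
qed simp

definition content :: "nat multiset \<Rightarrow> int"
  where "content a = Gcd ((\<lambda>i. int (count a i)) ` set_mset a)"

text \<open>Coefficients of a Bezout identity for the exponents in the multidegree. They depend on the
multidegree alone, so that all forms of one multidegree are contracted with the same vector.\<close>

definition bezout :: "nat multiset \<Rightarrow> nat \<Rightarrow> int"
  where "bezout a = (SOME c. (\<Sum>i\<in>set_mset a. c i * int (count a i)) = content a)"

lemma sum_bezout: "(\<Sum>i\<in>set_mset a. bezout a i * int (count a i)) = content a"
  unfolding bezout_def content_def by (rule someI_ex[OF bezout_Gcd_int]) simp

lemma content_dvd: "i \<in># a \<Longrightarrow> content a dvd int (count a i)"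
  by (simp add: content_def)

lemma content_nonzero: "i \<in># a \<Longrightarrow> content a \<noteq> 0"
  using content_dvd[of i a] by (metis count_eq_zero_iff dvd_0_left_iff of_nat_eq_0_iff)

abbreviation multidegree :: "nat set \<Rightarrow> nat multiset \<Rightarrow> nat multiset"
  where "multidegree J m \<equiv> m + mset_set J"

type_synonym int_form_fun = "nat set \<Rightarrow> nat multiset \<Rightarrow> int"

text \<open>In terms of the basis \<open>x\<^sup>m dx\<^sub>J\<close> of the forms of multidegree \<open>a\<close>, labelled by \<open>J\<close> alone, this is the
interior product with the vector \<open>bezout a\<close>.\<close>

definition contraction :: "int_form_fun \<Rightarrow> int_form_fun"
  where "contraction \<omega> J m = (\<Sum>k\<in>set_mset m - J.
    bezout (multidegree J m) k * wedge_sign {k} J * \<omega> (insert k J) (m - {#k#}))"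

lemma multidegree_shift:
  assumes "finite J" "i \<in> J"
  shows "multidegree (J - {i}) (add_mset i m) = multidegree J m"
proof -
  have "mset_set J = add_mset i (mset_set (J - {i}))"
    using assms by (rule mset_set.remove)
  then show ?thesis
    by (metis union_mset_add_mset_left union_mset_add_mset_right)
qed

text \<open>The identity \<open>\<iota>\<^sub>c (a \<and> \<omega>) + a \<and> \<iota>\<^sub>c \<omega> = (\<Sum>i. c\<^sub>i a\<^sub>i) \<omega>\<close> for the exterior algebra over the variables that
occur in the multidegree \<open>a\<close>.\<close>

lemma homotopy_formula:
  assumes fin: "finite J"
  shows "de_rham_d \<Z> (contraction \<omega>) J m + contraction (de_rham_d \<Z> \<omega>) J m
    = content (multidegree J m) * \<omega> J m"
proof -
  define a where "a = multidegree J m"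
  define c where "c = bezout a"
  define s where "s i K = wedge_sign {i} K" for i K
  have ss: "s i K * s i K = 1" "s i K * (s i K * x) = x" for i K x
    using wedge_sign_square[of i K] by (simp_all add: s_def flip: mult.assoc)
  let ?D = "set_mset m - J"
  \<comment> \<open>The common factor of the two terms in which \<open>i\<close> is added to and \<open>k\<close> removed from the degree of the polynomial.\<close>
  define F where "F i k = c k * int (Suc (count m i)) * \<omega> (insert k (J - {i})) (add_mset i m - {#k#})" for i k
  have deg: "multidegree (J - {i}) (add_mset i m) = a" if "i \<in> J" for i
    unfolding a_def using fin that by (rule multidegree_shift)
  have contr: "contraction \<omega> (J - {i}) (add_mset i m)
      = c i * s i (J - {i}) * \<omega> J m
        + (\<Sum>k\<in>?D. c k * s k (J - {i}) * \<omega> (insert k (J - {i})) (add_mset i m - {#k#}))" if i: "i \<in> J" for i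
  proof -
    have D: "set_mset (add_mset i m) - (J - {i}) = insert i ?D" "i \<notin> ?D"
      using i by auto
    show ?thesis
      unfolding contraction_def deg[OF i] D(1) using D(2) i
      by (simp add: c_def s_def insert_absorb)
  qed
  have dh: "de_rham_d \<Z> (contraction \<omega>) J m
      = (\<Sum>i\<in>J. c i * int (count a i)) * \<omega> J m + (\<Sum>i\<in>J. \<Sum>k\<in>?D. s i (J - {i}) * s k (J - {i}) * F i k)"
  proof -
    have "s i (J - {i}) * int (Suc (count m i)) * contraction \<omega> (J - {i}) (add_mset i m)
        = c i * int (count a i) * \<omega> J m + (\<Sum>k\<in>?D. s i (J - {i}) * s k (J - {i}) * F i k)" if i: "i \<in> J" for i
    proof -
      have "count a i = Suc (count m i)"
        using fin i by (simp add: a_def)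
      then show ?thesis
        unfolding contr[OF i]
        by (simp only: distrib_left sum_distrib_left F_def mult_ac ss mult_1_right)
    qed
    then show ?thesis
      unfolding de_rham_d_int s_def[symmetric] by (simp add: sum.distrib sum_distrib_right)
  qed
  have hd: "contraction (de_rham_d \<Z> \<omega>) J m
      = (\<Sum>k\<in>?D. c k * int (count a k)) * \<omega> J m + (\<Sum>i\<in>J. \<Sum>k\<in>?D. s k J * s i (insert k (J - {i})) * F i k)"
  proof -
    have "c k * s k J * de_rham_d \<Z> \<omega> (insert k J) (m - {#k#})
        = c k * int (count a k) * \<omega> J m + (\<Sum>i\<in>J. s k J * s i (insert k (J - {i})) * F i k)" if k: "k \<in> ?D" for k
    proof -
      have ak: "count a k = count m k" "Suc (count (m - {#k#}) k) = count m k"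
        using fin k by (simp_all add: a_def)
      have "de_rham_d \<Z> \<omega> (insert k J) (m - {#k#}) = s k J * int (count a k) * \<omega> J m
          + (\<Sum>i\<in>J. s i (insert k (J - {i})) * int (Suc (count m i)) * \<omega> (insert k (J - {i})) (add_mset i m - {#k#}))"
      proof -
        have "insert k J - {i} = insert k (J - {i})" "count (m - {#k#}) i = count m i"
          "add_mset i (m - {#k#}) = add_mset i m - {#k#}" if "i \<in> J" for i
          using k that by auto
        then have "(\<Sum>i\<in>J. s i (insert k J - {i}) * int (Suc (count (m - {#k#}) i)) * \<omega> (insert k J - {i}) (add_mset i (m - {#k#})))
          = (\<Sum>i\<in>J. s i (insert k (J - {i})) * int (Suc (count m i)) * \<omega> (insert k (J - {i})) (add_mset i m - {#k#}))"
          by (intro sum.cong refl) simp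
        moreover have "insert k J - {k} = J" "add_mset k (m - {#k#}) = m"
          using k by auto
        ultimately show ?thesis
          unfolding de_rham_d_int s_def[symmetric] using fin k ak by (simp del: of_nat_Suc)
      qed
      then show ?thesis
        by (simp only: distrib_left sum_distrib_left F_def mult_ac ss mult_1_right)
    qed
    then show ?thesis
      unfolding contraction_def a_def[symmetric] c_def[symmetric] s_def[symmetric]
      by (simp add: sum.distrib sum_distrib_right sum.swap[of _ J])
  qed
  \<comment> \<open>Adding \<open>i\<close> and removing \<open>k\<close> anticommute.\<close>
  have cancel: "s i (J - {i}) * s k (J - {i}) + s k J * s i (insert k (J - {i})) = 0"
    if "i \<in> J" "k \<in> ?D" for i k
  proof -
    have "s i (J - {i}) * s k J = - (s k (J - {i}) * s i (insert k (J - {i})))"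
      using wedge_sign_swap[of i "J - {i}" k] that by (auto simp: s_def insert_absorb)
    then have "s i (J - {i}) * (s i (J - {i}) * s k J) * s i (insert k (J - {i}))
        = - (s i (J - {i}) * (s k (J - {i}) * s i (insert k (J - {i})))) * s i (insert k (J - {i}))"
      by simp
    then have "s k J * s i (insert k (J - {i})) = - (s i (J - {i}) * s k (J - {i}))"
      by (simp only: ss minus_mult_left[symmetric]) (simp add: mult_ac ss)
    then show ?thesis by simp
  qed
  have "(\<Sum>i\<in>J. \<Sum>k\<in>?D. s i (J - {i}) * s k (J - {i}) * F i k)
      + (\<Sum>i\<in>J. \<Sum>k\<in>?D. s k J * s i (insert k (J - {i})) * F i k) = 0"
    unfolding sum.distrib[symmetric] distrib_right[symmetric] using cancel by simp
  moreover have "(\<Sum>i\<in>J. c i * int (count a i)) + (\<Sum>k\<in>?D. c k * int (count a k)) = content a"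
  proof -
    have "set_mset a = J \<union> ?D"
      using fin by (auto simp: a_def)
    then show ?thesis
      using fin sum_bezout[of a] by (simp add: c_def sum.union_disjoint[symmetric])
  qed
  ultimately show ?thesis
    unfolding dh hd a_def[symmetric] by (simp add: algebra_simps flip: distrib_left)
qed

lemmas int_module_forms = cring.module_forms_of_rank[OF int_is_cring]
lemmas int_forms_mono = cring.carrier_forms_mono[OF int_is_cring]
lemmas int_linear_d = cring.linear_de_rham_d[OF int_is_cring]
lemmas int_d_square = cring.de_rham_d_square[OF int_is_cring]

lemma int_forms_iff: "\<omega> \<in> carrier (forms_of_rank \<Z> n T) \<longleftrightarrow>
    finite {(J, m). \<omega> J m \<noteq> 0} \<and> (\<forall>J m. \<omega> J m \<noteq> 0 \<longrightarrow> (J, m) \<in> form_index n T)"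
  by (auto simp: cring.carrier_forms_of_rank[OF int_is_cring] cring.fin_supp_def[OF int_is_cring] case_prod_unfold)

lemma int_forms_subset:
  assumes "\<omega> \<in> carrier (forms_of_rank \<Z> n T)" "\<And>J m. \<eta> J m \<noteq> 0 \<Longrightarrow> \<omega> J m \<noteq> 0 \<and> card J \<in> T'"
  shows "\<eta> \<in> carrier (forms_of_rank \<Z> n T')"
proof -
  have "{(J, m). \<eta> J m \<noteq> 0} \<subseteq> {(J, m). \<omega> J m \<noteq> 0}"
    using assms(2) by auto
  then have "finite {(J, m). \<eta> J m \<noteq> 0}"
    by (rule finite_subset) (use assms(1) in \<open>simp add: int_forms_iff\<close>)
  with assms show ?thesis
    by (fastforce simp: int_forms_iff form_index_def)
qed

lemma int_forms_finite:
  assumes "\<omega> \<in> carrier (forms_of_rank \<Z> n T)" "\<omega> J m \<noteq> 0"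
  shows "finite J" "J \<subseteq> {1..n}" "card J \<in> T"
proof -
  show J: "J \<subseteq> {1..n}" "card J \<in> T"
    using assms by (auto simp: int_forms_iff form_index_def)
  show "finite J"
    using J(1) by (rule finite_subset) simp
qed

lemma contraction_closed:
  assumes \<omega>: "\<omega> \<in> carrier (forms_of_rank \<Z> n T)" and T: "\<And>k. Suc k \<in> T \<Longrightarrow> k \<in> T'"
  shows "contraction \<omega> \<in> carrier (forms_of_rank \<Z> n T')"
proof -
  have ex: "\<exists>k\<in>set_mset m - J. \<omega> (insert k J) (m - {#k#}) \<noteq> 0" if "contraction \<omega> J m \<noteq> 0" for J m
  proof (rule ccontr)
    assume "\<not> ?thesis"
    then have "contraction \<omega> J m = 0"
      unfolding contraction_def by (intro sum.neutral) auto
    with that show False by simp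
  qed
  have "{(J, m). contraction \<omega> J m \<noteq> 0}
      \<subseteq> (\<lambda>(k, J, m). (J - {k}, add_mset k m)) ` ({1..n} \<times> {(J, m). \<omega> J m \<noteq> 0})"
  proof clarify
    fix J m assume "contraction \<omega> J m \<noteq> 0"
    then obtain k where k: "k \<in># m" "k \<notin> J" "\<omega> (insert k J) (m - {#k#}) \<noteq> 0"
      using ex by blast
    then have "k \<in> {1..n}"
      using int_forms_finite(2)[OF \<omega> k(3)] by simp
    with k show "(J, m) \<in> (\<lambda>(k, J, m). (J - {k}, add_mset k m)) ` ({1..n} \<times> {(J, m). \<omega> J m \<noteq> 0})"
      by (intro image_eqI[of _ _ "(k, insert k J, m - {#k#})"]) auto
  qed
  then have "finite {(J, m). contraction \<omega> J m \<noteq> 0}"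
    by (rule finite_subset) (use \<omega> in \<open>simp add: int_forms_iff\<close>)
  moreover have "(J, m) \<in> form_index n T'" if nz: "contraction \<omega> J m \<noteq> 0" for J m
  proof -
    obtain k where k: "k \<in># m" "k \<notin> J" "\<omega> (insert k J) (m - {#k#}) \<noteq> 0"
      using ex[OF nz] by blast
    have fin: "finite J"
      using int_forms_finite(1)[OF \<omega> k(3)] by simp
    have idx: "(insert k J, m - {#k#}) \<in> form_index n T"
      using \<omega> k(3) by (simp add: int_forms_iff)
    have "set_mset m = insert k (set_mset (m - {#k#}))"
      using insert_DiffM[OF k(1)] by (metis set_mset_add_mset_insert)
    with idx have "set_mset m \<subseteq> {1..n}"
      by (simp add: form_index_def)
    with idx fin k(2) T show ?thesis
      by (simp add: form_index_def)
  qed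
  ultimately show ?thesis
    by (simp add: int_forms_iff)
qed

lemma contraction_add: "contraction (\<lambda>J m. \<omega> J m + \<eta> J m) J m = contraction \<omega> J m + contraction \<eta> J m"
  by (simp add: contraction_def distrib_left sum.distrib)

lemma de_rham_d_int_add: "de_rham_d \<Z> (\<lambda>J m. \<omega> J m + \<eta> J m) J m = de_rham_d \<Z> \<omega> J m + de_rham_d \<Z> \<eta> J m"
  by (simp add: de_rham_d_int distrib_left sum.distrib)

lemma de_rham_d_int_empty: "J = {} \<or> infinite J \<Longrightarrow> de_rham_d \<Z> \<omega> J m = 0"
  by (auto simp: de_rham_d_int)

text \<open>The division is exact, because \<open>d\<close> multiplies by exponents that occur in the multidegree. In rank 0
the value is 0.\<close>

definition closed_part :: "int_form_fun \<Rightarrow> int_form_fun"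
  where "closed_part \<omega> J m = de_rham_d \<Z> (contraction \<omega>) J m div content (multidegree J m)"

lemma content_dvd_d: "content (multidegree J m) dvd de_rham_d \<Z> \<omega> J m"
proof (cases "finite J")
  case True
  show ?thesis
    unfolding de_rham_d_int
  proof (rule dvd_sum)
    fix i assume i: "i \<in> J"
    have "content (multidegree J m) dvd int (count (multidegree J m) i)"
      using True i by (intro content_dvd) simp
    then have "content (multidegree J m) dvd int (Suc (count m i))"
      using True i by simp
    then show "content (multidegree J m) dvd
        wedge_sign {i} (J - {i}) * int (Suc (count m i)) * \<omega> (J - {i}) (add_mset i m)"
      by (simp only: dvd_mult dvd_mult2)
  qed
qed (simp add: de_rham_d_int_empty)

lemma content_mult_closed_part:
  "content (multidegree J m) * closed_part \<omega> J m = de_rham_d \<Z> (contraction \<omega>) J m"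
  unfolding closed_part_def using content_dvd_d by (rule dvd_mult_div_cancel)

lemma closed_part_add: "closed_part (\<lambda>J m. \<omega> J m + \<eta> J m) J m = closed_part \<omega> J m + closed_part \<eta> J m"
  using content_dvd_d[where J = J and m = m and \<omega> = "contraction \<omega>"]
  by (simp add: closed_part_def contraction_add[abs_def] de_rham_d_int_add div_plus_div_distrib_dvd_left)

lemma content_multidegree_nonzero: "finite J \<Longrightarrow> J \<noteq> {} \<Longrightarrow> content (multidegree J m) \<noteq> 0"
  using content_nonzero[of _ "multidegree J m"] by fastforce

lemma closed_part_in_carrier:
  assumes "\<omega> \<in> carrier (forms_of_rank \<Z> n T)"
  shows "closed_part \<omega> \<in> carrier (forms_of_rank \<Z> n T)"
proof -
  have d: "de_rham_d \<Z> (contraction \<omega>) \<in> carrier (forms_of_rank \<Z> n T)"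
    by (rule linear_map_closed[OF int_linear_d[of "{k. Suc k \<in> T}"] contraction_closed[OF assms]]) auto
  show ?thesis
  proof (rule int_forms_subset[OF d])
    fix J m assume "closed_part \<omega> J m \<noteq> 0"
    then have "de_rham_d \<Z> (contraction \<omega>) J m \<noteq> 0"
      by (auto simp: closed_part_def)
    then show "de_rham_d \<Z> (contraction \<omega>) J m \<noteq> 0 \<and> card J \<in> T"
      using int_forms_finite(3)[OF d] by blast
  qed
qed

lemma closed_part_closed:
  assumes "\<omega> \<in> carrier (forms_of_rank \<Z> n T)"
  shows "de_rham_d \<Z> (closed_part \<omega>) J m = 0"
proof (cases "finite J \<and> J \<noteq> {}")
  case True
  let ?a = "multidegree J m"
  have "content ?a * de_rham_d \<Z> (closed_part \<omega>) J m = de_rham_d \<Z> (de_rham_d \<Z> (contraction \<omega>)) J m"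
    unfolding de_rham_d_int[of "closed_part \<omega>"] de_rham_d_int[of "de_rham_d \<Z> (contraction \<omega>)"] sum_distrib_left
  proof (rule sum.cong[OF refl])
    fix i assume "i \<in> J"
    then have "multidegree (J - {i}) (add_mset i m) = ?a"
      using True by (intro multidegree_shift) auto
    then have "content ?a * closed_part \<omega> (J - {i}) (add_mset i m) = de_rham_d \<Z> (contraction \<omega>) (J - {i}) (add_mset i m)"
      using content_mult_closed_part[where J = "J - {i}" and m = "add_mset i m" and \<omega> = \<omega>] by (simp only:)
    then show "content ?a * (wedge_sign {i} (J - {i}) * int (Suc (count m i)) * closed_part \<omega> (J - {i}) (add_mset i m))
        = wedge_sign {i} (J - {i}) * int (Suc (count m i)) * de_rham_d \<Z> (contraction \<omega>) (J - {i}) (add_mset i m)"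
      by (simp only: mult.left_commute[of "content ?a"])
  qed
  also have "\<dots> = 0"
    using int_d_square[OF contraction_closed[OF assms, of UNIV]] by (simp add: fun_eq_iff)
  finally show ?thesis
    using content_multidegree_nonzero[of J m] True by simp
qed (auto simp: de_rham_d_int_empty)

lemma contraction_zero [simp]: "contraction (\<lambda>J m. 0) = (\<lambda>J m. 0)"
  by (simp add: contraction_def fun_eq_iff)

text \<open>For closed \<open>\<omega>\<close> the homotopy formula reads \<open>d h \<omega> = gcd a \<cdot> \<omega>\<close>.\<close>

lemma closed_part_of_closed:
  assumes \<omega>: "\<omega> \<in> carrier (forms_of_rank \<Z> n T)" "0 \<notin> T" and cl: "de_rham_d \<Z> \<omega> = (\<lambda>J m. 0)"
  shows "closed_part \<omega> = \<omega>"
proof (intro ext)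
  fix J m
  show "closed_part \<omega> J m = \<omega> J m"
  proof (cases "finite J \<and> J \<noteq> {}")
    case True
    then have "de_rham_d \<Z> (contraction \<omega>) J m = content (multidegree J m) * \<omega> J m"
      using homotopy_formula[of J \<omega> m] cl by simp
    then show ?thesis
      using content_multidegree_nonzero[of J m] True by (simp add: closed_part_def)
  next
    case False
    then have "\<omega> J m = 0"
      using int_forms_finite(1,3)[OF \<omega>(1), of J m] \<omega>(2) by (metis card.empty)
    with False show ?thesis
      by (auto simp: closed_part_def de_rham_d_int_empty)
  qed
qed

definition rank_part :: "nat \<Rightarrow> int_form_fun \<Rightarrow> int_form_fun"
  where "rank_part i \<omega> J m = (if card J = i then \<omega> J m else 0)"

lemma rank_part_closed:
  "\<omega> \<in> carrier (forms_of_rank \<Z> n T) \<Longrightarrow> rank_part i \<omega> \<in> carrier (forms_of_rank \<Z> n {i})"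
  by (rule int_forms_subset[of \<omega>]) (auto simp: rank_part_def)

lemma rank_part_add: "rank_part i (\<lambda>J m. \<omega> J m + \<eta> J m) = (\<lambda>J m. rank_part i \<omega> J m + rank_part i \<eta> J m)"
  by (intro ext) (simp add: rank_part_def)

lemma de_rham_d_rank_part: "de_rham_d \<Z> (rank_part i \<omega>) = rank_part (Suc i) (de_rham_d \<Z> \<omega>)"
proof (intro ext)
  fix J m
  show "de_rham_d \<Z> (rank_part i \<omega>) J m = rank_part (Suc i) (de_rham_d \<Z> \<omega>) J m"
  proof (cases "finite J")
    case True
    then have "card (J - {k}) = i \<longleftrightarrow> card J = Suc i" if "k \<in> J" for k
      using card_Suc_Diff1[OF True that] by auto
    then have "de_rham_d \<Z> (rank_part i \<omega>) J m = (\<Sum>k\<in>J. if card J = Suc i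
        then wedge_sign {k} (J - {k}) * int (Suc (count m k)) * \<omega> (J - {k}) (add_mset k m) else 0)"
      unfolding de_rham_d_int by (intro sum.cong refl) (simp add: rank_part_def)
    then show ?thesis
      by (simp add: de_rham_d_int rank_part_def)
  qed (simp add: de_rham_d_int_empty rank_part_def)
qed

section \<open>Splitting off the even cohomology\<close>

text \<open>The additive group of a module record retains the scalar multiplication as an unspecified extra
field, so the two structures are only compared field by field.\<close>

lemma quotient_as_factor_group:
  "carrier (add_monoid (quotient_module M N)) = carrier (add_monoid M Mod N)"
  "monoid.mult (add_monoid (quotient_module M N)) = monoid.mult (add_monoid M Mod N)"
  "one (add_monoid (quotient_module M N)) = one (add_monoid M Mod N)"
  by (simp_all add: quotient_module_def ring.defs module.defs FactRing_def FactGroup_def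
      A_RCOSETS_def set_add_def[abs_def])

lemma (in module) group_quotient:
  assumes "submodule N R M"
  shows "group (add_monoid (quotient_module M N))"
proof -
  have "group (add_monoid M Mod N)"
    by (rule normal.factorgroup_is_group) (rule abelian_subgroup.a_normal[OF submodule_abelian_subgroup[OF assms]])
  then show ?thesis
    unfolding group_def Group.monoid_def group_axioms_def Units_def quotient_as_factor_group .
qed

lemma submodule_linear_image:
  assumes M: "module R M" and L: "module R L" and lin: "linear_map R M L h" and N: "submodule N R M"
  shows "submodule (h ` N) R L"
proof -
  have "N \<subseteq> carrier M"
    by (rule module.submoduleE(1)[OF M N])
  then have "linear_map R (M\<lparr>carrier := N\<rparr>) L h"
    using lin by (simp add: linear_map_def Pi_iff subset_iff)
  then show ?thesis
    using submodule_image[OF submodule.submodule_is_module[OF N M] L] by simp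
qed

context cring
begin

lemma linear_forms_incl:
  "T \<subseteq> T' \<Longrightarrow> linear_map R (forms_of_rank R n T) (forms_of_rank R n T') (\<lambda>\<omega>. \<omega>)"
  using carrier_forms_mono[of T T'] by (auto simp: linear_map_def forms_of_rank_simps)

lemma closed_forms_iff: "\<omega> \<in> closed_forms R n T \<longleftrightarrow>
    \<omega> \<in> carrier (forms_of_rank R n T) \<and> de_rham_d R \<omega> = (\<lambda>J m. \<zero>)"
  by (simp add: closed_forms_def forms_simps)

lemma submodule_closed_forms:
  assumes "T \<subseteq> T'"
  shows "submodule (closed_forms R n T) R (forms_of_rank R n T')"
proof -
  have "submodule {\<omega> \<in> carrier (forms_of_rank R n T). de_rham_d R \<omega> \<in> {\<zero>\<^bsub>forms_of_rank R n UNIV\<^esub>}}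
      R (forms_of_rank R n T)"
    by (rule submodule_vimage[OF module_forms_of_rank module_forms_of_rank linear_de_rham_d
          module.submodule_zero[OF module_forms_of_rank]]) simp
  moreover have "{\<omega> \<in> carrier (forms_of_rank R n T). de_rham_d R \<omega> \<in> {\<zero>\<^bsub>forms_of_rank R n UNIV\<^esub>}} = closed_forms R n T"
    by (auto simp: closed_forms_iff forms_of_rank_simps)
  ultimately show ?thesis
    using submodule_linear_image[OF module_forms_of_rank module_forms_of_rank linear_forms_incl[OF assms]]
    by fastforce
qed

lemma module_closed_forms: "module R ((forms R n)\<lparr>carrier := closed_forms R n T\<rparr>)"
  using submodule.submodule_is_module[OF submodule_closed_forms[of T UNIV n] module_forms_of_rank]
  by (simp add: forms_of_rank_UNIV)

lemma submodule_exact_in_closed: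
  "submodule (exact_forms R n T) R ((forms R n)\<lparr>carrier := closed_forms R n T\<rparr>)"
  unfolding exact_forms_def
proof (rule submodule_image[OF module_forms_of_rank module_closed_forms])
  have d: "linear_map R (forms_of_rank R n {j. Suc j \<in> T}) (forms_of_rank R n T) (de_rham_d R)"
    by (rule linear_de_rham_d) simp
  show "linear_map R (forms_of_rank R n {j. Suc j \<in> T}) ((forms R n)\<lparr>carrier := closed_forms R n T\<rparr>) (de_rham_d R)"
    using d by (auto simp: linear_map_def closed_forms_iff de_rham_d_square forms_of_rank_simps forms_simps)
qed

lemma exact_formsD:
  "\<omega> \<in> exact_forms R n T \<Longrightarrow> \<omega> \<in> carrier (forms_of_rank R n T) \<and> de_rham_d R \<omega> = (\<lambda>J m. \<zero>)"
  using module.submoduleE(1)[OF module_closed_forms submodule_exact_in_closed, of n T]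
  by (auto simp: closed_forms_iff)

end

lemmas int_closed_iff = cring.closed_forms_iff[OF int_is_cring, simplified]

lemma int_exact_eq: "exact_forms \<Z> n T = de_rham_d \<Z> ` carrier (forms_of_rank \<Z> n {j. Suc j \<in> T})"
  by (simp add: exact_forms_def)

lemma int_exact_mono: "T \<subseteq> T' \<Longrightarrow> \<omega> \<in> exact_forms \<Z> n T \<Longrightarrow> \<omega> \<in> exact_forms \<Z> n T'"
  unfolding int_exact_eq by (rule subsetD[OF image_mono]) (auto intro: int_forms_mono[rotated])

lemma rank_part_exact:
  assumes "\<omega> \<in> exact_forms \<Z> n T"
  shows "rank_part i \<omega> \<in> exact_forms \<Z> n {i}"
proof -
  obtain \<eta> where \<eta>: "\<eta> \<in> carrier (forms_of_rank \<Z> n {j. Suc j \<in> T})" and \<omega>: "\<omega> = de_rham_d \<Z> \<eta>"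
    using assms by (auto simp: int_exact_eq)
  show ?thesis
  proof (cases i)
    case 0
    have "rank_part 0 \<omega> = de_rham_d \<Z> (\<lambda>J m. 0)"
    proof (intro ext)
      fix J m
      show "rank_part 0 \<omega> J m = de_rham_d \<Z> (\<lambda>J m. 0) J m"
        using de_rham_d_int_empty[of J \<eta> m] by (auto simp: rank_part_def \<omega> de_rham_d_int card_eq_0_iff)
    qed
    moreover have "(\<lambda>J m. 0) \<in> carrier (forms_of_rank \<Z> n {j. Suc j \<in> {i}})"
      by (simp add: int_forms_iff)
    ultimately show ?thesis
      unfolding int_exact_eq 0 by blast
  next
    case (Suc k)
    have "rank_part i \<omega> = de_rham_d \<Z> (rank_part k \<eta>)"
      by (simp add: \<omega> Suc de_rham_d_rank_part)
    moreover have "rank_part k \<eta> \<in> carrier (forms_of_rank \<Z> n {j. Suc j \<in> {i}})"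
      using rank_part_closed[OF \<eta>, of k] by (simp add: Suc)
    ultimately show ?thesis
      unfolding int_exact_eq by blast
  qed
qed

text \<open>A form has finitely many nonzero parts, so it is the sum of the parts of rank at most \<open>n\<close>.\<close>

lemma exact_of_rank_parts:
  assumes \<omega>: "\<omega> \<in> carrier (forms_of_rank \<Z> n T)" and "0 \<notin> T"
    and ex: "\<And>i. i \<in> T \<Longrightarrow> rank_part i \<omega> \<in> exact_forms \<Z> n {i}"
  shows "\<omega> \<in> exact_forms \<Z> n T"
proof -
  let ?U = "{j. Suc j \<in> T}"
  interpret M: module \<Z> "forms_of_rank \<Z> n ?U"
    by (rule int_module_forms)
  \<comment> \<open>Partial sums of the parts of \<open>\<omega>\<close>; rank 0 contributes nothing.\<close>
  define upto where "upto k J m = (if card J \<le> k then \<omega> J m else 0)" for k :: nat and J m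
  have add: "(\<lambda>J m. \<alpha> J m + \<beta> J m) \<in> exact_forms \<Z> n T"
    if \<alpha>: "\<alpha> \<in> exact_forms \<Z> n T" and \<beta>: "\<beta> \<in> exact_forms \<Z> n T" for \<alpha> \<beta>
  proof -
    obtain \<eta> where \<eta>: "\<eta> \<in> carrier (forms_of_rank \<Z> n ?U)" "\<alpha> = de_rham_d \<Z> \<eta>"
      using \<alpha> by (auto simp: int_exact_eq)
    obtain \<theta> where \<theta>: "\<theta> \<in> carrier (forms_of_rank \<Z> n ?U)" "\<beta> = de_rham_d \<Z> \<theta>"
      using \<beta> by (auto simp: int_exact_eq)
    have "(\<lambda>J m. \<eta> J m + \<theta> J m) \<in> carrier (forms_of_rank \<Z> n ?U)"
      using M.M.a_closed[OF \<eta>(1) \<theta>(1)] by (simp add: forms_of_rank_simps)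
    moreover have "(\<lambda>J m. \<alpha> J m + \<beta> J m) = de_rham_d \<Z> (\<lambda>J m. \<eta> J m + \<theta> J m)"
      by (simp add: \<eta>(2) \<theta>(2) de_rham_d_int_add fun_eq_iff)
    ultimately show ?thesis
      unfolding int_exact_eq by blast
  qed
  have zero: "(\<lambda>J m. 0) \<in> exact_forms \<Z> n T"
  proof -
    have "(\<lambda>J m. 0) = de_rham_d \<Z> (\<lambda>J m. 0)"
      by (simp add: de_rham_d_int fun_eq_iff)
    moreover have "(\<lambda>J m. 0) \<in> carrier (forms_of_rank \<Z> n ?U)"
      by (simp add: int_forms_iff)
    ultimately show ?thesis
      unfolding int_exact_eq by blast
  qed
  have vanish: "\<omega> J m = 0" if "card J \<notin> T \<or> card J > n" for J m
  proof (rule ccontr)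
    assume nz: "\<omega> J m \<noteq> 0"
    have "card J \<le> n"
      using card_mono[OF _ int_forms_finite(2)[OF \<omega> nz]] by simp
    with that int_forms_finite(3)[OF \<omega> nz] show False by simp
  qed
  have "upto k \<in> exact_forms \<Z> n T" for k
  proof (induction k)
    case 0
    have "upto 0 = (\<lambda>J m. 0)"
      using assms(2) by (intro ext) (simp add: upto_def vanish)
    with zero show ?case by simp
  next
    case (Suc k)
    have "rank_part (Suc k) \<omega> \<in> exact_forms \<Z> n T"
    proof (cases "Suc k \<in> T")
      case True
      then show ?thesis
        by (intro int_exact_mono[OF _ ex[OF True]]) simp
    next
      case False
      then have "rank_part (Suc k) \<omega> = (\<lambda>J m. 0)"
        by (intro ext) (simp add: rank_part_def vanish)
      with zero show ?thesis by simp
    qed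
    moreover have "upto (Suc k) = (\<lambda>J m. upto k J m + rank_part (Suc k) \<omega> J m)"
      by (intro ext) (simp add: upto_def rank_part_def le_Suc_eq)
    ultimately show ?case
      using add[OF Suc] by simp
  qed
  moreover have "upto n = \<omega>"
    by (intro ext) (simp add: upto_def vanish)
  ultimately show ?thesis by metis
qed

lemma closed_part_zero: "closed_part (\<lambda>J m. 0) = (\<lambda>J m. 0)"
  by (simp add: closed_part_def de_rham_d_int fun_eq_iff)

text \<open>A closed form that represents the rank \<open>i\<close> component in the cohomology; for closed \<open>\<omega>\<close> and
positive \<open>i\<close> it is the rank \<open>i\<close> part of \<open>\<omega>\<close> itself.\<close>

definition class_part :: "nat \<Rightarrow> int_form_fun \<Rightarrow> int_form_fun"
  where "class_part i \<omega> = closed_part (rank_part i \<omega>)"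

lemma class_part_closed:
  assumes "\<omega> \<in> carrier (forms_of_rank \<Z> n T)"
  shows "class_part i \<omega> \<in> closed_forms \<Z> n {i}"
  using closed_part_in_carrier[OF rank_part_closed[OF assms]] closed_part_closed[OF rank_part_closed[OF assms]]
  by (simp add: int_closed_iff class_part_def fun_eq_iff)

lemma class_part_add:
  "class_part i (\<lambda>J m. \<omega> J m + \<eta> J m) = (\<lambda>J m. class_part i \<omega> J m + class_part i \<eta> J m)"
  by (simp add: class_part_def rank_part_add closed_part_add fun_eq_iff)

lemma class_part_of_closed:
  assumes "\<omega> \<in> closed_forms \<Z> n T" "i > 0"
  shows "class_part i \<omega> = rank_part i \<omega>"
  unfolding class_part_def
proof (rule closed_part_of_closed)
  show "rank_part i \<omega> \<in> carrier (forms_of_rank \<Z> n {i})"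
    using assms(1) by (auto simp: int_closed_iff intro: rank_part_closed)
  show "de_rham_d \<Z> (rank_part i \<omega>) = (\<lambda>J m. 0)"
    using assms(1) by (simp add: int_closed_iff de_rham_d_rank_part rank_part_def fun_eq_iff)
qed (use assms(2) in simp)

lemma closed_of_rank_parts:
  assumes \<omega>: "\<omega> \<in> carrier (forms_of_rank \<Z> n T)"
    and cl: "\<And>i. de_rham_d \<Z> (rank_part i \<omega>) = (\<lambda>J m. 0)"
  shows "\<omega> \<in> closed_forms \<Z> n T"
proof -
  have "de_rham_d \<Z> \<omega> J m = 0" for J m
  proof (cases "card J")
    case 0
    then show ?thesis by (intro de_rham_d_int_empty) (auto simp: card_eq_0_iff)
  next
    case (Suc i)
    then have "de_rham_d \<Z> \<omega> J m = de_rham_d \<Z> (rank_part i \<omega>) J m"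
      by (simp add: de_rham_d_rank_part rank_part_def)
    then show ?thesis by (simp add: cl)
  qed
  with \<omega> show ?thesis
    by (simp add: int_closed_iff fun_eq_iff)
qed

text \<open>Since the projection fixes closed forms, adding a closed form with parts \<open>\<alpha>\<^sub>i - class_part i \<beta>\<close> changes
the components of \<open>\<beta>\<close> to the prescribed ones.\<close>

lemma exists_form_with_class_parts:
  assumes \<beta>: "\<beta> \<in> carrier (forms_of_rank \<Z> n T)" and T: "T' \<subseteq> T" "0 \<notin> T'"
    and \<alpha>: "\<And>i. i \<in> T' \<Longrightarrow> \<alpha> i \<in> closed_forms \<Z> n {i}"
  obtains \<gamma> where "\<gamma> \<in> closed_forms \<Z> n T'"
    "\<And>i. i \<in> T' \<Longrightarrow> class_part i (\<lambda>J m. \<beta> J m + \<gamma> J m) = \<alpha> i"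
proof -
  \<comment> \<open>The required correction in rank \<open>i\<close>.\<close>
  define \<delta> where "\<delta> i = (\<lambda>J m. \<alpha> i J m - class_part i \<beta> J m)" for i
  define \<gamma> where "\<gamma> J m = (if card J \<in> T' then \<delta> (card J) J m else 0)" for J m
  have \<delta>: "\<delta> i \<in> closed_forms \<Z> n {i}" if "i \<in> T'" for i
  proof -
    interpret M: module \<Z> "forms_of_rank \<Z> n {i}"
      by (rule int_module_forms)
    have sub: "submodule (closed_forms \<Z> n {i}) \<Z> (forms_of_rank \<Z> n {i})"
      by (rule cring.submodule_closed_forms[OF int_is_cring]) simp
    note E = M.submoduleE[OF sub]
    have "\<alpha> i \<oplus>\<^bsub>forms_of_rank \<Z> n {i}\<^esub> ((- 1) \<odot>\<^bsub>forms_of_rank \<Z> n {i}\<^esub> class_part i \<beta>) \<in> closed_forms \<Z> n {i}"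
      by (intro E(4,5) \<alpha>[OF that] class_part_closed[OF \<beta>]) simp
    then show ?thesis
      by (simp add: \<delta>_def forms_of_rank_simps)
  qed
  have \<delta>_rank: "\<delta> i J m = 0" if "i \<in> T'" "card J \<noteq> i" for i J m
    using \<delta>[OF that(1)] that(2) int_forms_finite(3)[of "\<delta> i" n "{i}" J m] by (auto simp: int_closed_iff)
  have part: "rank_part i \<gamma> = (if i \<in> T' then \<delta> i else (\<lambda>J m. 0))" for i
    using \<delta>_rank by (auto simp: rank_part_def \<gamma>_def fun_eq_iff)
  have \<gamma>: "\<gamma> \<in> carrier (forms_of_rank \<Z> n T')"
  proof -
    have idx: "J \<subseteq> {1..n} \<and> card J \<in> T' \<and> \<delta> (card J) J m \<noteq> 0 \<and> (J, m) \<in> form_index n T'"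
      if "\<gamma> J m \<noteq> 0" for J m
    proof -
      have J: "card J \<in> T'" "\<delta> (card J) J m \<noteq> 0"
        using that unfolding \<gamma>_def by metis+
      then have "(J, m) \<in> form_index n {card J}"
        using \<delta>[OF J(1)] by (auto simp: int_closed_iff int_forms_iff)
      with J show ?thesis
        by (auto simp: form_index_def)
    qed
    have "{(J, m). \<gamma> J m \<noteq> 0} \<subseteq> (\<Union>i\<in>T' \<inter> {..n}. {(J, m). \<delta> i J m \<noteq> 0})"
    proof clarify
      fix J m assume nz: "\<gamma> J m \<noteq> 0"
      have "card J \<le> n"
        using card_mono[of "{1..n}" J] idx[OF nz] by simp
      then show "(J, m) \<in> (\<Union>i\<in>T' \<inter> {..n}. {(J, m). \<delta> i J m \<noteq> 0})"
        using idx[OF nz] by auto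
    qed
    moreover have "finite (\<Union>i\<in>T' \<inter> {..n}. {(J, m). \<delta> i J m \<noteq> 0})"
      using \<delta> by (auto simp: int_closed_iff int_forms_iff)
    ultimately have "finite {(J, m). \<gamma> J m \<noteq> 0}"
      by (rule finite_subset)
    with idx show ?thesis
      by (simp add: int_forms_iff)
  qed
  have cl: "\<gamma> \<in> closed_forms \<Z> n T'"
  proof (rule closed_of_rank_parts[OF \<gamma>])
    show "de_rham_d \<Z> (rank_part i \<gamma>) = (\<lambda>J m. 0)" for i
      using \<delta>[of i] by (simp add: part int_closed_iff) (simp add: de_rham_d_int fun_eq_iff)
  qed
  show thesis
  proof (rule that[OF cl])
    fix i assume i: "i \<in> T'"
    then have "i > 0" using T(2) by (cases i) auto
    then have "class_part i \<gamma> = \<delta> i"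
      using class_part_of_closed[OF cl] i by (simp add: part)
    then show "class_part i (\<lambda>J m. \<beta> J m + \<gamma> J m) = \<alpha> i"
      by (simp add: class_part_add \<delta>_def fun_eq_iff)
  qed
qed

text \<open>Send \<open>\<omega>\<close> to the classes of its projected parts and to its class modulo closed forms. Exact forms are
closed and thus fixed by the projection, so they go to zero; conversely, if \<open>\<omega>\<close> goes to zero, it is
closed, hence equal to its projection, and all its parts are exact.\<close>

theorem even_forms_mod_exact_iso:
  "add_monoid (quotient_module (forms_of_rank \<Z> n even_ranks) (exact_forms \<Z> n even_ranks))
    \<cong> even_cohomology_pos \<Z> n \<times>\<times>
      add_monoid (quotient_module (forms_of_rank \<Z> n even_ranks) (closed_forms \<Z> n pos_even_ranks))"
proof -
  let ?M = "forms_of_rank \<Z> n even_ranks"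
  define Z where "Z i = (forms \<Z> n)\<lparr>carrier := closed_forms \<Z> n {i}\<rparr>" for i
  define B where "B i = exact_forms \<Z> n {i}" for i
  define C where "C = closed_forms \<Z> n pos_even_ranks"
  define H where "H i = add_monoid (quotient_module (Z i) (B i))" for i
  define Q where "Q = add_monoid (quotient_module ?M C)"
  have coh: "even_cohomology_pos \<Z> n = sum_group pos_even_ranks H"
    by (simp add: even_cohomology_pos_def de_rham_cohomology_def H_def[abs_def] Z_def B_def)
  interpret M: module \<Z> ?M
    by (rule int_module_forms)
  have Z: "module \<Z> (Z i)" and B: "submodule (B i) \<Z> (Z i)" for i
    by (simp_all add: Z_def B_def cring.module_closed_forms[OF int_is_cring]
        cring.submodule_exact_in_closed[OF int_is_cring])
  have C: "submodule C \<Z> ?M"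
    unfolding C_def by (rule cring.submodule_closed_forms[OF int_is_cring]) auto
  have H: "group (H i)" for i
    unfolding H_def by (rule module.group_quotient[OF Z B])
  have Q: "group Q"
    unfolding Q_def by (rule M.group_quotient[OF C])
  have G: "group (add_monoid ?M)"
    using M.M.a_comm_group by (rule comm_group.axioms(2))
  have H_simps: "carrier (H i) = (\<lambda>x. B i +>\<^bsub>Z i\<^esub> x) ` closed_forms \<Z> n {i}" "\<one>\<^bsub>H i\<^esub> = B i" for i
    by (simp_all add: H_def quotient_module_simps) (simp add: Z_def)
  have Q_simps: "carrier Q = (\<lambda>x. C +>\<^bsub>?M\<^esub> x) ` carrier ?M" "\<one>\<^bsub>Q\<^esub> = C"
    by (simp_all add: Q_def quotient_module_simps)
  have Z_add: "x \<oplus>\<^bsub>Z i\<^esub> y = (\<lambda>J m. x J m + y J m)" and Z_zero: "\<zero>\<^bsub>Z i\<^esub> = (\<lambda>J m. 0)"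
    and Z_carrier: "carrier (Z i) = closed_forms \<Z> n {i}" for i x y
    by (simp_all add: Z_def forms_simps)
  have coset_zero_iff: "N +>\<^bsub>L\<^esub> x = N \<longleftrightarrow> x \<in> N"
    if "module \<Z> L" "submodule N \<Z> L" "x \<in> carrier L" for L :: "(int, int_form_fun) module" and N x
  proof -
    interpret L: module \<Z> L by fact
    interpret N: abelian_subgroup N L
      by (rule L.submodule_abelian_subgroup) fact
    show ?thesis
      using that(3) N.a_rcos_self[of x] L.a_coset_join2[OF that(3)] N.a_subgroup by auto
  qed
  define comp where "comp \<omega> = (\<lambda>i\<in>pos_even_ranks. B i +>\<^bsub>Z i\<^esub> class_part i \<omega>)" for \<omega>
  define f where "f \<omega> = (comp \<omega>, C +>\<^bsub>?M\<^esub> \<omega>)" for \<omega>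
  have comp_closed: "comp \<omega> \<in> carrier (sum_group pos_even_ranks H)" if \<omega>: "\<omega> \<in> carrier ?M" for \<omega>
  proof -
    have "B i +>\<^bsub>Z i\<^esub> class_part i \<omega> = B i" if "i > n" for i
    proof -
      have "rank_part i \<omega> = (\<lambda>J m. 0)"
      proof (rule ccontr)
        assume "rank_part i \<omega> \<noteq> (\<lambda>J m. 0)"
        then obtain J m where nz: "\<omega> J m \<noteq> 0" and "card J = i"
          by (auto simp: rank_part_def fun_eq_iff split: if_splits)
        then show False
          using card_mono[OF _ int_forms_finite(2)[OF \<omega> nz]] \<open>i > n\<close> by simp
      qed
      then have "class_part i \<omega> = \<zero>\<^bsub>Z i\<^esub>"
        by (simp only: class_part_def closed_part_zero Z_zero)
      then show ?thesis
        using coset_zero_iff[OF Z B, of "class_part i \<omega>" i] class_part_closed[OF \<omega>, of i]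
          subgroup.one_closed[OF submodule.axioms(1)[OF B[of i]]] by (simp add: Z_carrier)
    qed
    then have "{i \<in> pos_even_ranks. comp \<omega> i \<noteq> \<one>\<^bsub>H i\<^esub>} \<subseteq> {..n}"
      by (auto simp: comp_def H_simps not_le)
    then have "finite {i \<in> pos_even_ranks. comp \<omega> i \<noteq> \<one>\<^bsub>H i\<^esub>}"
      by (rule finite_subset) simp
    then show ?thesis
      using class_part_closed[OF \<omega>] by (auto simp: carrier_sum_group[OF H] comp_def H_simps)
  qed
  have hom: "f \<in> hom (add_monoid ?M) (sum_group pos_even_ranks H \<times>\<times> Q)"
  proof (rule homI)
    fix \<omega> assume "\<omega> \<in> carrier (add_monoid ?M)"
    then show "f \<omega> \<in> carrier (sum_group pos_even_ranks H \<times>\<times> Q)"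
      by (auto simp: f_def comp_closed Q_simps)
  next
    fix \<omega> \<eta> assume "\<omega> \<in> carrier (add_monoid ?M)" "\<eta> \<in> carrier (add_monoid ?M)"
    then have carr: "\<omega> \<in> carrier ?M" "\<eta> \<in> carrier ?M" by simp_all
    have "(B i +>\<^bsub>Z i\<^esub> class_part i \<omega>) \<otimes>\<^bsub>H i\<^esub> (B i +>\<^bsub>Z i\<^esub> class_part i \<eta>)
        = B i +>\<^bsub>Z i\<^esub> class_part i (\<omega> \<oplus>\<^bsub>?M\<^esub> \<eta>)" for i
      using module.quotient_add[OF Z B, of "class_part i \<omega>" i "class_part i \<eta>"]
        class_part_closed[OF carr(1)] class_part_closed[OF carr(2)]
      by (simp add: H_def Z_carrier Z_add forms_of_rank_simps class_part_add)
    then have "comp (\<omega> \<oplus>\<^bsub>?M\<^esub> \<eta>) = comp \<omega> \<otimes>\<^bsub>sum_group pos_even_ranks H\<^esub> comp \<eta>"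
      by (auto simp: comp_def fun_eq_iff)
    moreover have "C +>\<^bsub>?M\<^esub> (\<omega> \<oplus>\<^bsub>?M\<^esub> \<eta>) = (C +>\<^bsub>?M\<^esub> \<omega>) \<otimes>\<^bsub>Q\<^esub> (C +>\<^bsub>?M\<^esub> \<eta>)"
      using M.quotient_add[OF C carr] by (simp add: Q_def)
    ultimately show "f (\<omega> \<otimes>\<^bsub>add_monoid ?M\<^esub> \<eta>) = f \<omega> \<otimes>\<^bsub>sum_group pos_even_ranks H \<times>\<times> Q\<^esub> f \<eta>"
      by (simp add: f_def)
  qed
  interpret f: group_hom "add_monoid ?M" "sum_group pos_even_ranks H \<times>\<times> Q" f
    by (simp add: group_hom_def group_hom_axioms_def hom G DirProd_group sum_group H Q)
  have ker: "f \<omega> = \<one>\<^bsub>sum_group pos_even_ranks H \<times>\<times> Q\<^esub> \<longleftrightarrow> \<omega> \<in> exact_forms \<Z> n even_ranks"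
    if \<omega>: "\<omega> \<in> carrier ?M" for \<omega>
  proof -
    have "f \<omega> = \<one>\<^bsub>sum_group pos_even_ranks H \<times>\<times> Q\<^esub>
        \<longleftrightarrow> (\<forall>i\<in>pos_even_ranks. B i +>\<^bsub>Z i\<^esub> class_part i \<omega> = B i) \<and> C +>\<^bsub>?M\<^esub> \<omega> = C"
      by (auto simp: f_def comp_def H_simps Q_simps fun_eq_iff)
    also have "\<dots> \<longleftrightarrow> (\<forall>i\<in>pos_even_ranks. class_part i \<omega> \<in> B i) \<and> \<omega> \<in> C"
    proof -
      have "B i +>\<^bsub>Z i\<^esub> class_part i \<omega> = B i \<longleftrightarrow> class_part i \<omega> \<in> B i" for i
        by (rule coset_zero_iff[OF Z B]) (simp add: Z_carrier class_part_closed[OF \<omega>])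
      then show ?thesis
        by (simp only: coset_zero_iff[OF M.module_axioms C \<omega>])
    qed
    also have "\<dots> \<longleftrightarrow> \<omega> \<in> exact_forms \<Z> n even_ranks"
    proof
      assume *: "(\<forall>i\<in>pos_even_ranks. class_part i \<omega> \<in> B i) \<and> \<omega> \<in> C"
      have "\<omega> \<in> exact_forms \<Z> n pos_even_ranks"
      proof (rule exact_of_rank_parts)
        show "\<omega> \<in> carrier (forms_of_rank \<Z> n pos_even_ranks)"
          using * by (simp add: C_def int_closed_iff)
        show "rank_part i \<omega> \<in> exact_forms \<Z> n {i}" if "i \<in> pos_even_ranks" for i
        proof -
          have "class_part i \<omega> \<in> B i"
            using * that by blast
          moreover have "class_part i \<omega> = rank_part i \<omega>"
            using * that by (intro class_part_of_closed[of _ n pos_even_ranks]) (auto simp: C_def)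
          ultimately show ?thesis
            by (simp add: B_def)
        qed
      qed simp
      then show "\<omega> \<in> exact_forms \<Z> n even_ranks"
        by (rule int_exact_mono[rotated]) auto
    next
      assume ex: "\<omega> \<in> exact_forms \<Z> n even_ranks"
      have "\<omega> \<in> exact_forms \<Z> n pos_even_ranks"
      proof -
        \<comment> \<open>An exact form has no part of rank 0.\<close>
        have "{j. Suc j \<in> even_ranks} = {j. Suc j \<in> pos_even_ranks}"
          by (auto elim: oddE)
        with ex show ?thesis
          unfolding int_exact_eq by simp
      qed
      then have C': "\<omega> \<in> C"
        using cring.exact_formsD[OF int_is_cring] by (fastforce simp: C_def int_closed_iff)
      then have "class_part i \<omega> \<in> B i" if "i \<in> pos_even_ranks" for i
        using class_part_of_closed[of \<omega> n pos_even_ranks i] that rank_part_exact[OF ex, of i]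
        by (simp add: C_def B_def)
      with C' show "(\<forall>i\<in>pos_even_ranks. class_part i \<omega> \<in> B i) \<and> \<omega> \<in> C"
        by blast
    qed
    finally show ?thesis .
  qed
  have "f ` carrier (add_monoid ?M) = carrier (sum_group pos_even_ranks H \<times>\<times> Q)"
  proof
    show "f ` carrier (add_monoid ?M) \<subseteq> carrier (sum_group pos_even_ranks H \<times>\<times> Q)"
      using f.hom_closed by blast
    show "carrier (sum_group pos_even_ranks H \<times>\<times> Q) \<subseteq> f ` carrier (add_monoid ?M)"
    proof
      fix xy assume "xy \<in> carrier (sum_group pos_even_ranks H \<times>\<times> Q)"
      then obtain x \<beta> where x: "x \<in> carrier (sum_group pos_even_ranks H)" and \<beta>: "\<beta> \<in> carrier ?M"
        and xy: "xy = (x, C +>\<^bsub>?M\<^esub> \<beta>)"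
        by (auto simp: Q_simps)
      have "\<exists>\<alpha>. \<alpha> \<in> closed_forms \<Z> n {i} \<and> x i = B i +>\<^bsub>Z i\<^esub> \<alpha>" if "i \<in> pos_even_ranks" for i
      proof -
        have "x i \<in> carrier (H i)"
          using x that by (auto simp: carrier_sum_group[OF H] PiE_iff)
        then show ?thesis by (auto simp: H_simps)
      qed
      then obtain \<alpha> where \<alpha>: "\<And>i. i \<in> pos_even_ranks \<Longrightarrow> \<alpha> i \<in> closed_forms \<Z> n {i}"
        and x\<alpha>: "\<And>i. i \<in> pos_even_ranks \<Longrightarrow> x i = B i +>\<^bsub>Z i\<^esub> \<alpha> i"
        by metis
      have T: "pos_even_ranks \<subseteq> even_ranks" "0 \<notin> pos_even_ranks" by auto
      obtain \<gamma> where \<gamma>: "\<gamma> \<in> C"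
        and part: "\<And>i. i \<in> pos_even_ranks \<Longrightarrow> class_part i (\<lambda>J m. \<beta> J m + \<gamma> J m) = \<alpha> i"
        using exists_form_with_class_parts[OF \<beta> T \<alpha>] unfolding C_def by blast
      have \<gamma>M: "\<gamma> \<in> carrier ?M"
        using \<gamma> M.submoduleE(1)[OF C] by blast
      have sum: "\<beta> \<oplus>\<^bsub>?M\<^esub> \<gamma> = (\<lambda>J m. \<beta> J m + \<gamma> J m)"
        by (simp add: forms_of_rank_simps)
      have "comp (\<beta> \<oplus>\<^bsub>?M\<^esub> \<gamma>) = x"
      proof
        fix i
        show "comp (\<beta> \<oplus>\<^bsub>?M\<^esub> \<gamma>) i = x i"
        proof (cases "i \<in> pos_even_ranks")
          case True
          then show ?thesis
            by (simp only: comp_def restrict_apply' sum part x\<alpha>)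
        next
          case False
          then show ?thesis
            using x by (auto simp: comp_def carrier_sum_group[OF H] PiE_iff extensional_def)
        qed
      qed
      moreover have "C +>\<^bsub>?M\<^esub> (\<beta> \<oplus>\<^bsub>?M\<^esub> \<gamma>) = C +>\<^bsub>?M\<^esub> \<beta>"
        using \<beta> \<gamma> \<gamma>M by (simp add: M.coset_eq_iff[OF C] a_minus_def M.M.add.m_comm[of \<beta> \<gamma>] M.M.add.m_assoc M.M.r_neg)
      ultimately have "f (\<beta> \<oplus>\<^bsub>?M\<^esub> \<gamma>) = xy"
        by (simp add: f_def xy)
      then show "xy \<in> f ` carrier (add_monoid ?M)"
        using M.M.a_closed[OF \<beta> \<gamma>M] by force
    qed
  qed
  then have "add_monoid ?M Mod kernel (add_monoid ?M) (sum_group pos_even_ranks H \<times>\<times> Q) f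
      \<cong> sum_group pos_even_ranks H \<times>\<times> Q"
    by (rule f.FactGroup_iso)
  moreover have "kernel (add_monoid ?M) (sum_group pos_even_ranks H \<times>\<times> Q) f = exact_forms \<Z> n even_ranks"
    using ker cring.exact_formsD[OF int_is_cring, of _ n even_ranks] by (auto simp: kernel_def)
  ultimately show ?thesis
    by (simp only: coh Q_def C_def is_iso_def iso_def hom_def
        quotient_as_factor_group[of ?M "exact_forms \<Z> n even_ranks"] not_False_eq_True)
qed

theorem corollary3p7:
  fixes n :: nat
  assumes "n \<ge> 1"
  shows "(\<forall>R :: ('a, 'm) ring_scheme. cring R \<longrightarrow>
            module_isomorphic R
              (B1_bar R (free_algebra R n))
              (quotient_module (forms_of_rank R n even_ranks) (exact_forms R n even_ranks)))
       \<and> add_monoid (B1_bar \<Z> (free_algebra \<Z> n))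
           \<cong> even_cohomology_pos \<Z> n \<times>\<times>
             add_monoid (quotient_module (forms_of_rank \<Z> n even_ranks)
                                         (closed_forms \<Z> n pos_even_ranks))"
proof
  show "\<forall>R :: ('a, 'm) ring_scheme. cring R \<longrightarrow>
            module_isomorphic R
              (B1_bar R (free_algebra R n))
              (quotient_module (forms_of_rank R n even_ranks) (exact_forms R n even_ranks))"
    by (simp add: cring.B1_bar_free_algebra_isomorphic)
  have "module_isomorphic \<Z> (B1_bar \<Z> (free_algebra \<Z> n))
      (quotient_module (forms_of_rank \<Z> n even_ranks) (exact_forms \<Z> n even_ranks))"
    by (rule cring.B1_bar_free_algebra_isomorphic[OF int_is_cring])
  then have "add_monoid (B1_bar \<Z> (free_algebra \<Z> n))
      \<cong> add_monoid (quotient_module (forms_of_rank \<Z> n even_ranks) (exact_forms \<Z> n even_ranks))"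
    by (auto simp: module_isomorphic_def module_iso_def is_iso_def)
  then show "add_monoid (B1_bar \<Z> (free_algebra \<Z> n))
           \<cong> even_cohomology_pos \<Z> n \<times>\<times>
             add_monoid (quotient_module (forms_of_rank \<Z> n even_ranks)
                                         (closed_forms \<Z> n pos_even_ranks))"
    using even_forms_mod_exact_iso by (rule iso_trans)
qed

end
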